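(* Let $\lambda$ be a partition and let $\boldsymbol t=(t_1,t_2,\ldots)$ be formal variables. Define the multivariable formal series $K_{\lambda,0}^{C_\infty}(\boldsymbol t)$ by $$\frac{K_{\lambda,0}^{C_\infty}(\boldsymbol t)}{\prod_{i=1}^{\infty}(1-t_{2i})}=\sum_{\nu\in\mathcal P^{(2)}}\sum_{\delta\in\mathcal P^{(1,1)}}\boldsymbol t^{\frac12\nu}c_{\lambda,\delta}^{\nu}.$$ Then $$K_{\lambda,0}^{C_\infty}(\boldsymbol t)=\sum_{b\in D(\lambda)}\boldsymbol t^{\frac12(\boldsymbol{\varphi}(b)+\mu_b)}.$$
   Context: $\mathcal P$ is the set of all partitions. Write $\omega_i=(1^i)$, so each partition is $\kappa=\sum_i a_i\omega_i$ with $a_i$ the number of columns of height $i$. For $\beta=\sum_i\beta_i\omega_i$ set $\boldsymbol t^{\beta}=\prod_{i\ge1}t_i^{\beta_i}$. Let $\mathcal P^{(2)}=\{\sum_i 2a_i\omega_i\}$ (all rows of even length), $\mathcal P^{(1,1)}=\{\sum_i a_i\omega_{2i}\}$ (all columns of even height), $\mathcal P^{\boxplus}=\mathcal P^{(2)}\cap\mathcal P^{(1,1)}$, with $a_i\in\mathbb Z_{\ge0}$ almost all zero. For partitions, $\lambda\le_{\boxplus}\mu$ means $\mu-\lambda\in\mathcal P^{\boxplus}$. $c_{\lambda,\delta}^{\nu}$ are Littlewood–Richardson coefficients. $B(\lambda)$ is the type $A_{+\infty}$ crystal of semistandard tableaux of shape $\lambda$ with entries in $\{1<2<3<\cdots\}$.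 For $b\in B(\lambda)$ and $i\ge1$: read $b$ by columns from right to left, each from top to bottom; keep only letters $i$ (written $+$) and $i+1$ (written $-$); recursively delete adjacent factors $+-$; the result is $-^{p}+^{q}$, and $\varepsilon_i(b)=p$, $\varphi_i(b)=q$. Set $\boldsymbol{\varepsilon}(b)=\sum_i\varepsilon_i(b)\omega_i$ and $\boldsymbol{\varphi}(b)=\sum_i\varphi_i(b)\omega_i$ (finite sums). For a partition $\mu$, $b\in B(\lambda)$ is $\mu$-distinguished if there is $(\nu,\delta)\in\mathcal P^{(2)}\times\mathcal P^{(1,1)}$ with $\boldsymbol{\varphi}(b)=\nu-\mu$ and $\boldsymbol{\varepsilon}(b)=\delta-\mu$. $D(\lambda)$ is the set of $b\in B(\lambda)$ that are $\mu$-distinguished for at least one partition $\mu$. For $b\in D(\lambda)$, $\mu_b$ is the (unique) $\le_{\boxplus}$-minimal partition $\mu$ such that $b$ is $\mu$-distinguished; explicitly $\mu_b=\sum_i(\varphi_{2i}(b)\bmod 2)\,\omega_{2i}$ with residues in $\{0,1\}$. *)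

theory Defs
  imports Main "HOL-Library.Poly_Mapping"
begin

abbreviation lookup :: "('a \<Rightarrow>\<^sub>0 'b) \<Rightarrow> 'a \<Rightarrow> 'b::zero" where
  "lookup \<equiv> Poly_Mapping.lookup"

abbreviation keys :: "('a \<Rightarrow>\<^sub>0 'b::zero) \<Rightarrow> 'a set" where
  "keys \<equiv> Poly_Mapping.keys"

section \<open>Formal series in infinitely many variables\<close>

text \<open>Integral formal power series in the commuting variables \<open>t\<^sub>0, t\<^sub>1, t\<^sub>2, \<dots>\<close>: arbitrary
  functions on the finitely supported exponent vectors. Every series below involves only the
  variables with index at least 1.\<close>

typedef mseries = "UNIV :: ((nat \<Rightarrow>\<^sub>0 nat) \<Rightarrow> int) set"
  morphisms mcoeff MSeries ..

lemma mcoeff_MSeries [simp]: "mcoeff (MSeries f) = f"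
  by (simp add: MSeries_inverse)

lemma mseries_eqI: "(\<And>\<alpha>. mcoeff F \<alpha> = mcoeff G \<alpha>) \<Longrightarrow> F = G"
  by (metis ext mcoeff_inject)

abbreviation splits :: "(nat \<Rightarrow>\<^sub>0 nat) \<Rightarrow> ((nat \<Rightarrow>\<^sub>0 nat) \<times> (nat \<Rightarrow>\<^sub>0 nat)) set" where
  "splits \<gamma> \<equiv> {(\<alpha>, \<beta>). \<alpha> + \<beta> = \<gamma>}"

lemma finite_splits: "finite (splits \<gamma>)"
proof -
  let ?D = "{\<alpha> :: nat \<Rightarrow>\<^sub>0 nat. \<forall>i. lookup \<alpha> i \<le> lookup \<gamma> i}"
  let ?F = "{f :: nat \<Rightarrow> nat. \<forall>i. (i \<in> keys \<gamma> \<longrightarrow> f i \<in> {..(\<Sum>j\<in>keys \<gamma>. lookup \<gamma> j)})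
              \<and> (i \<notin> keys \<gamma> \<longrightarrow> f i = 0)}"
  have "finite ?F"
    by (rule finite_set_of_finite_funs) auto
  moreover have "lookup ` ?D \<subseteq> ?F"
  proof (rule image_subsetI)
    fix \<alpha> assume "\<alpha> \<in> ?D"
    then have le: "lookup \<alpha> i \<le> lookup \<gamma> i" for i
      by simp
    have "lookup \<alpha> i \<le> (\<Sum>j\<in>keys \<gamma>. lookup \<gamma> j)" if "i \<in> keys \<gamma>" for i
      using le [of i] member_le_sum [OF that, of "lookup \<gamma>"] by simp
    moreover have "lookup \<alpha> i = 0" if "i \<notin> keys \<gamma>" for i
      using le [of i] that by (simp add: in_keys_iff)
    ultimately show "lookup \<alpha> \<in> ?F"
      by simp
  qed
  ultimately have "finite (lookup ` ?D)"
    by (rule rev_finite_subset)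
  then have fin: "finite ?D"
    by (rule finite_imageD) (simp add: inj_on_def poly_mapping_eqI)
  have "splits \<gamma> \<subseteq> ?D \<times> ?D"
    by (auto simp: lookup_add)
  then show ?thesis
    using fin by (meson finite_SigmaI finite_subset)
qed

instantiation mseries :: comm_ring_1
begin

definition "0 = MSeries (\<lambda>_. 0)"
definition "1 = MSeries (\<lambda>\<alpha>. if \<alpha> = 0 then 1 else 0)"
definition "F + G = MSeries (\<lambda>\<alpha>. mcoeff F \<alpha> + mcoeff G \<alpha>)"
definition "F - G = MSeries (\<lambda>\<alpha>. mcoeff F \<alpha> - mcoeff G \<alpha>)"
definition "- F = MSeries (\<lambda>\<alpha>. - mcoeff F \<alpha>)"
definition "F * G = MSeries (\<lambda>\<gamma>. \<Sum>(\<alpha>, \<beta>)\<in>splits \<gamma>. mcoeff F \<alpha> * mcoeff G \<beta>)"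

lemmas mseries_ops = zero_mseries_def one_mseries_def plus_mseries_def minus_mseries_def
  uminus_mseries_def times_mseries_def

instance
proof
  fix F G H :: mseries
  show "F * G * H = F * (G * H)"
  proof (rule mseries_eqI)
    fix \<delta>
    let ?f = "mcoeff F" and ?g = "mcoeff G" and ?h = "mcoeff H"
    have "mcoeff (F * G * H) \<delta> =
      (\<Sum>p\<in>splits \<delta>. \<Sum>q\<in>splits (fst p). ?f (fst q) * ?g (snd q) * ?h (snd p))"
      by (simp add: times_mseries_def sum_distrib_right split_beta)
    also have "\<dots> = (\<Sum>(p, q)\<in>Sigma (splits \<delta>) (\<lambda>p. splits (fst p)).
        ?f (fst q) * ?g (snd q) * ?h (snd p))"
      by (rule sum.Sigma) (auto simp: finite_splits)
    also have "\<dots> = (\<Sum>(p, q)\<in>Sigma (splits \<delta>) (\<lambda>p. splits (snd p)).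
        ?f (fst p) * (?g (fst q) * ?h (snd q)))"
      by (rule sum.reindex_bij_witness
          [where i = "\<lambda>((a, b), (c, d)). ((a + c, d), (a, c))"
             and j = "\<lambda>((a, b), (c, d)). ((c, d + b), (d, b))"])
        (auto simp: add.assoc mult.assoc)
    also have "\<dots> = (\<Sum>p\<in>splits \<delta>. \<Sum>q\<in>splits (snd p). ?f (fst p) * (?g (fst q) * ?h (snd q)))"
      by (rule sum.Sigma [symmetric]) (auto simp: finite_splits)
    also have "\<dots> = mcoeff (F * (G * H)) \<delta>"
      by (simp add: times_mseries_def sum_distrib_left split_beta)
    finally show "mcoeff (F * G * H) \<delta> = mcoeff (F * (G * H)) \<delta>" .
  qed
  show "F * G = G * F"
  proof (rule mseries_eqI)
    fix \<gamma>
    show "mcoeff (F * G) \<gamma> = mcoeff (G * F) \<gamma>"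
      unfolding times_mseries_def mcoeff_MSeries
      by (rule sum.reindex_bij_witness [where i = prod.swap and j = prod.swap])
        (auto simp: add.commute mult.commute)
  qed
  show "1 * F = F"
  proof (rule mseries_eqI)
    fix \<gamma>
    have "mcoeff (1 * F) \<gamma> = (\<Sum>p\<in>splits \<gamma>. if p = (0, \<gamma>) then mcoeff F \<gamma> else 0)"
      unfolding times_mseries_def one_mseries_def mcoeff_MSeries
      by (rule sum.cong) (auto split: if_splits)
    also have "\<dots> = mcoeff F \<gamma>"
      by (simp add: finite_splits)
    finally show "mcoeff (1 * F) \<gamma> = mcoeff F \<gamma>" .
  qed
  show "(F + G) * H = F * H + G * H"
    by (simp add: times_mseries_def plus_mseries_def algebra_simps sum.distrib split_beta)
  show "(0 :: mseries) \<noteq> 1"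
  proof
    assume "(0 :: mseries) = 1"
    then have "mcoeff 0 0 = mcoeff 1 0" by simp
    then show False by (simp add: zero_mseries_def one_mseries_def)
  qed
qed (simp_all add: mseries_ops algebra_simps mcoeff_inverse)

end

definition monomial :: "(nat \<Rightarrow>\<^sub>0 nat) \<Rightarrow> mseries" where
  "monomial \<beta> = MSeries (\<lambda>\<alpha>. if \<alpha> = \<beta> then 1 else 0)"

definition tvar :: "nat \<Rightarrow> mseries" where
  "tvar i = monomial (Poly_Mapping.single i 1)"

text \<open>The sum of a family in which every monomial occurs in only finitely many members; this is
  the case for all families to which it is applied below.\<close>

definition formal_sum :: "'a set \<Rightarrow> ('a \<Rightarrow> mseries) \<Rightarrow> mseries" where
  "formal_sum X F = MSeries (\<lambda>\<alpha>. \<Sum>x\<in>{x \<in> X. mcoeff (F x) \<alpha> \<noteq> 0}. mcoeff (F x) \<alpha>)"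

text \<open>The product over all \<open>i \<ge> 1\<close>: the coefficientwise limit of the partial products, each
  coefficient being eventually constant.\<close>

definition formal_prod :: "(nat \<Rightarrow> mseries) \<Rightarrow> mseries" where
  "formal_prod F = MSeries (\<lambda>\<alpha>.
     THE c. eventually (\<lambda>n. mcoeff (\<Prod>i = 1..n. F i) \<alpha> = c) sequentially)"


section \<open>Partitions\<close>

text \<open>A partition is the finitely supported sequence \<open>\<kappa>\<^sub>1 \<ge> \<kappa>\<^sub>2 \<ge> \<dots>\<close> of its row lengths; the
  position 0 is unused. Addition of partitions is addition of row lengths.\<close>

definition partitions :: "(nat \<Rightarrow>\<^sub>0 nat) set" where
  "partitions = {\<kappa>. lookup \<kappa> 0 = 0 \<and> (\<forall>i\<ge>1. lookup \<kappa> (Suc i) \<le> lookup \<kappa> i)}"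

text \<open>\<open>\<omega>\<^sub>i = (1\<^sup>i)\<close>, one column of height \<open>i\<close>. Note that \<open>\<omega>\<^sub>0 = 0\<close>.\<close>

definition omega :: "nat \<Rightarrow> (nat \<Rightarrow>\<^sub>0 nat)" where
  "omega i = (\<Sum>j = 1..i. Poly_Mapping.single j 1)"

definition cmul :: "nat \<Rightarrow> (nat \<Rightarrow>\<^sub>0 nat) \<Rightarrow> (nat \<Rightarrow>\<^sub>0 nat)" (infixr "\<cdot>" 75) where
  "k \<cdot> \<kappa> = Poly_Mapping.map (\<lambda>x. k * x) \<kappa>"

definition P2 :: "(nat \<Rightarrow>\<^sub>0 nat) set" where
  "P2 = {\<Sum>i\<in>keys a. (2 * lookup a i) \<cdot> omega i | a. True}"

definition P11 :: "(nat \<Rightarrow>\<^sub>0 nat) set" where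
  "P11 = {\<Sum>i\<in>keys a. lookup a i \<cdot> omega (2 * i) | a. True}"

definition Pbox :: "(nat \<Rightarrow>\<^sub>0 nat) set" where
  "Pbox = P2 \<inter> P11"

definition le_box :: "(nat \<Rightarrow>\<^sub>0 nat) \<Rightarrow> (nat \<Rightarrow>\<^sub>0 nat) \<Rightarrow> bool" where
  "le_box \<kappa> \<mu> \<longleftrightarrow> (\<exists>\<rho>\<in>Pbox. \<mu> = \<kappa> + \<rho>)"

text \<open>The coordinates of a partition in the \<open>\<omega>\<^sub>i\<close>: the number \<open>\<kappa>\<^sub>i - \<kappa>\<^sub>i\<^sub>+\<^sub>1\<close> of columns of
  height \<open>i\<close> (for a partition the subtraction is never truncated).\<close>

definition omega_coords :: "(nat \<Rightarrow>\<^sub>0 nat) \<Rightarrow> (nat \<Rightarrow>\<^sub>0 nat)" where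
  "omega_coords \<kappa> = (\<Sum>i\<in>keys \<kappa>. Poly_Mapping.single i (lookup \<kappa> i - lookup \<kappa> (Suc i)))"

text \<open>\<open>t\<^sup>\<beta>\<close> for a partition \<open>\<beta> = \<Sum>\<^sub>i \<beta>\<^sub>i \<omega>\<^sub>i\<close>.\<close>

definition t_pow :: "(nat \<Rightarrow>\<^sub>0 nat) \<Rightarrow> mseries" where
  "t_pow \<beta> = monomial (omega_coords \<beta>)"

text \<open>Halving of all row lengths; only applied to elements of \<^term>\<open>P2\<close>, where it is exact.\<close>

definition half :: "(nat \<Rightarrow>\<^sub>0 nat) \<Rightarrow> (nat \<Rightarrow>\<^sub>0 nat)" where
  "half \<kappa> = Poly_Mapping.map (\<lambda>x. x div 2) \<kappa>"


section \<open>Semistandard tableaux and Littlewood--Richardson coefficients\<close>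

definition diagram :: "(nat \<Rightarrow>\<^sub>0 nat) \<Rightarrow> (nat \<times> nat) set" where
  "diagram lam = {(r, c). 1 \<le> r \<and> 1 \<le> c \<and> c \<le> lookup lam r}"

text \<open>A tableau maps row and column to the entry; it is \<open>0\<close> outside its shape.\<close>

definition SSYT :: "(nat \<Rightarrow>\<^sub>0 nat) \<Rightarrow> (nat \<Rightarrow> nat \<Rightarrow> nat) set" where
  "SSYT lam = {b.
     (\<forall>r c. (r, c) \<in> diagram lam \<longrightarrow> 1 \<le> b r c) \<and>
     (\<forall>r c. (r, c) \<notin> diagram lam \<longrightarrow> b r c = 0) \<and>
     (\<forall>r c. (r, c) \<in> diagram lam \<and> (r, Suc c) \<in> diagram lam \<longrightarrow> b r c \<le> b r (Suc c)) \<and>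
     (\<forall>r c. (r, c) \<in> diagram lam \<and> (Suc r, c) \<in> diagram lam \<longrightarrow> b r c < b (Suc r) c)}"

definition content :: "(nat \<Rightarrow>\<^sub>0 nat) \<Rightarrow> (nat \<Rightarrow> nat \<Rightarrow> nat) \<Rightarrow> (nat \<Rightarrow>\<^sub>0 nat)" where
  "content lam b = (\<Sum>(r, c)\<in>diagram lam. Poly_Mapping.single (b r c) 1)"

text \<open>The Schur function in infinitely many variables, as generating function of tableaux.\<close>

definition schur :: "(nat \<Rightarrow>\<^sub>0 nat) \<Rightarrow> mseries" where
  "schur lam = MSeries (\<lambda>\<alpha>. int (card {b \<in> SSYT lam. content lam b = \<alpha>}))"

text \<open>The Littlewood--Richardson coefficients \<open>c\<^sub>l\<^sub>a\<^sub>m\<^sub>,\<^sub>\<delta>\<^sup>\<nu>\<close> are the structure constants of the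
  basis of Schur functions; the finitely supported family of coefficients is unique because the
  Schur functions are linearly independent.\<close>

definition LR :: "(nat \<Rightarrow>\<^sub>0 nat) \<Rightarrow> (nat \<Rightarrow>\<^sub>0 nat) \<Rightarrow> (nat \<Rightarrow>\<^sub>0 nat) \<Rightarrow> int" where
  "LR lam \<delta> \<nu> = lookup (THE c :: (nat \<Rightarrow>\<^sub>0 nat) \<Rightarrow>\<^sub>0 int.
     keys c \<subseteq> partitions \<and>
     schur lam * schur \<delta> = (\<Sum>\<kappa>\<in>keys c. of_int (lookup c \<kappa>) * schur \<kappa>)) \<nu>"


section \<open>The crystal of tableaux\<close>

definition column_height :: "(nat \<Rightarrow>\<^sub>0 nat) \<Rightarrow> nat \<Rightarrow> nat" where
  "column_height lam c = card {r. (r, c) \<in> diagram lam}"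

definition reading :: "(nat \<Rightarrow>\<^sub>0 nat) \<Rightarrow> (nat \<Rightarrow> nat \<Rightarrow> nat) \<Rightarrow> nat list" where
  "reading lam b = concat (map (\<lambda>c. map (\<lambda>r. b r c) [1..<Suc (column_height lam c)])
                             (rev [1..<Suc (lookup lam 1)]))"

datatype sign = Plus | Minus

definition sign_word :: "(nat \<Rightarrow>\<^sub>0 nat) \<Rightarrow> (nat \<Rightarrow> nat \<Rightarrow> nat) \<Rightarrow> nat \<Rightarrow> sign list" where
  "sign_word lam b i = map (\<lambda>x. if x = i then Plus else Minus)
                         (filter (\<lambda>x. x = i \<or> x = Suc i) (reading lam b))"

inductive cancel :: "sign list \<Rightarrow> sign list \<Rightarrow> bool" where
  "cancel (u @ [Plus, Minus] @ v) (u @ v)"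

definition eps_i :: "(nat \<Rightarrow>\<^sub>0 nat) \<Rightarrow> (nat \<Rightarrow> nat \<Rightarrow> nat) \<Rightarrow> nat \<Rightarrow> nat" where
  "eps_i lam b i =
     (THE p. \<exists>q. cancel\<^sup>*\<^sup>* (sign_word lam b i) (replicate p Minus @ replicate q Plus))"

definition phi_i :: "(nat \<Rightarrow>\<^sub>0 nat) \<Rightarrow> (nat \<Rightarrow> nat \<Rightarrow> nat) \<Rightarrow> nat \<Rightarrow> nat" where
  "phi_i lam b i =
     (THE q. \<exists>p. cancel\<^sup>*\<^sup>* (sign_word lam b i) (replicate p Minus @ replicate q Plus))"

definition eps :: "(nat \<Rightarrow>\<^sub>0 nat) \<Rightarrow> (nat \<Rightarrow> nat \<Rightarrow> nat) \<Rightarrow> (nat \<Rightarrow>\<^sub>0 nat)" where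
  "eps lam b = (\<Sum>i\<in>{i. 1 \<le> i \<and> eps_i lam b i \<noteq> 0}. eps_i lam b i \<cdot> omega i)"

definition phi :: "(nat \<Rightarrow>\<^sub>0 nat) \<Rightarrow> (nat \<Rightarrow> nat \<Rightarrow> nat) \<Rightarrow> (nat \<Rightarrow>\<^sub>0 nat)" where
  "phi lam b = (\<Sum>i\<in>{i. 1 \<le> i \<and> phi_i lam b i \<noteq> 0}. phi_i lam b i \<cdot> omega i)"

text \<open>The equations \<open>\<phi>(b) = \<nu> - \<mu>\<close> and \<open>\<epsilon>(b) = \<delta> - \<mu>\<close> hold in the weight lattice; they are
  written additively because subtraction of natural numbers is truncated.\<close>

definition distinguished :: "(nat \<Rightarrow>\<^sub>0 nat) \<Rightarrow> (nat \<Rightarrow>\<^sub>0 nat) \<Rightarrow> (nat \<Rightarrow> nat \<Rightarrow> nat) \<Rightarrow> bool" where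
  "distinguished lam \<mu> b \<longleftrightarrow> (\<exists>\<nu>\<in>P2. \<exists>\<delta>\<in>P11. phi lam b + \<mu> = \<nu> \<and> eps lam b + \<mu> = \<delta>)"

definition D :: "(nat \<Rightarrow>\<^sub>0 nat) \<Rightarrow> (nat \<Rightarrow> nat \<Rightarrow> nat) set" where
  "D lam = {b \<in> SSYT lam. \<exists>\<mu>\<in>partitions. distinguished lam \<mu> b}"

definition mu_min :: "(nat \<Rightarrow>\<^sub>0 nat) \<Rightarrow> (nat \<Rightarrow> nat \<Rightarrow> nat) \<Rightarrow> (nat \<Rightarrow>\<^sub>0 nat)" where
  "mu_min lam b = (THE \<mu>. \<mu> \<in> partitions \<and> distinguished lam \<mu> b \<and>
     (\<forall>\<mu>'\<in>partitions. distinguished lam \<mu>' b \<and> le_box \<mu>' \<mu> \<longrightarrow> \<mu>' = \<mu>))"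


section \<open>The series \<open>K\<close>\<close>

text \<open>The defining equation \<open>K / \<Prod>\<^sub>i (1 - t\<^sub>2\<^sub>i) = \<Sum>\<^sub>\<nu>\<^sub>,\<^sub>\<delta> t\<^sup>\<nu>\<^sup>/\<^sup>2 c\<^sub>l\<^sub>a\<^sub>m\<^sub>,\<^sub>\<delta>\<^sup>\<nu>\<close>, multiplied by its
  denominator, which is a unit (its constant term is 1).\<close>

definition K_C_inf :: "(nat \<Rightarrow>\<^sub>0 nat) \<Rightarrow> mseries" where
  "K_C_inf lam = formal_prod (\<lambda>i. 1 - tvar (2 * i)) *
     formal_sum P2 (\<lambda>\<nu>. formal_sum P11 (\<lambda>\<delta>. t_pow (half \<nu>) * of_int (LR lam \<delta> \<nu>)))"

end

theory Submission
  imports Defs "HOL-Combinatorics.Permutations"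
begin

text \<open>The Littlewood--Richardson coefficient \<open>LR lam \<delta> \<nu>\<close> counts the tableaux \<open>b\<close> of shape
  \<open>lam\<close> with \<open>\<epsilon>\<^sub>i(b) \<le> \<delta>\<^sub>i - \<delta>\<^sub>i\<^sub>+\<^sub>1\<close> and \<open>\<delta> + wt(b) = \<nu>\<close>; with \<open>\<mu> = \<delta> - \<epsilon>(b)\<close> these are the pairs
  \<open>(b, \<mu>)\<close> such that \<open>b\<close> is \<open>\<mu>\<close>-distinguished and \<open>\<phi>(b) + \<mu> = \<nu>\<close>. For a fixed \<open>b\<close> the admissible \<open>\<mu>\<close> form
  the coset \<open>\<mu>\<^sub>b + Pbox\<close>, and the sum of \<open>t\<^sup>\<rho>\<^sup>/\<^sup>2\<close> over \<open>\<rho> \<in> Pbox\<close> is the inverse of the product of the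
  \<open>1 - t\<^sub>2\<^sub>i\<close>.

  The Littlewood--Richardson rule is obtained by Stembridge's argument. In \<open>n\<close> variables,
  \<open>a(\<delta> + \<rho>) \<cdot> s(lam)\<close> is the sum of \<open>a(\<delta> + \<rho> + wt(b))\<close> over all tableaux \<open>b\<close>, because \<open>s(lam)\<close> is symmetric. A
  Bender--Knuth involution restricted to the columns left of the first column, read from the right,
  where \<open>\<delta>\<close> plus the content read so far is not a partition cancels all \<open>b\<close> for which such a
  column exists. The case \<open>\<delta> = 0\<close> is the bialternant formula, and \<open>a(\<rho>)\<close> can be cancelled.\<close>

section \<open>Alternants\<close>

text \<open>\<open>LR\<close> is fixed only by a \<open>THE\<close> over expansions in infinitely
  many variables, so the counting has to come with linear independence of the Schur functions; the
  same alternants give both. Alternants live in n variables, and n is chosen per coefficient: large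
  enough for its exponent, for \<delta>, and for every entry that a lattice tableau can have.
  Patterns make the Bender--Knuth involution a single formula, and cutting a tableau at column m
  becomes truncation: \<open>min\<close> with m for the left part, truncated subtraction for the
  right part. Under the cut the two letter counts are still exchanged because k is absent from
  column m + 1. The first violation is by exactly 1, which \<rho> turns into an equality of
  exponents; this is the source of the sign. The reading word enters only through \<epsilon>.
  Columns increase strictly, so testing the prefixes that end with a column suffices, and the
  column-wise condition on patterns becomes a bound on \<epsilon>.\<close>

type_synonym int_mpoly = "(nat \<Rightarrow>\<^sub>0 nat) \<Rightarrow>\<^sub>0 int"

definition exp_vec :: "nat \<Rightarrow> (nat \<Rightarrow> nat) \<Rightarrow> (nat \<Rightarrow>\<^sub>0 nat)" where
  "exp_vec n f = (\<Sum>i = 1..n. Poly_Mapping.single i (f i))"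

lemma lookup_exp_vec: "lookup (exp_vec n f) i = (if i \<in> {1..n} then f i else 0)"
  by (simp add: exp_vec_def lookup_sum lookup_single when_def)

lemma exp_vec_cong: "(\<And>i. i \<in> {1..n} \<Longrightarrow> f i = g i) \<Longrightarrow> exp_vec n f = exp_vec n g"
  by (simp add: exp_vec_def)

lemma exp_vec_add: "exp_vec n f + exp_vec n g = exp_vec n (\<lambda>i. f i + g i)"
  by (rule poly_mapping_eqI) (simp add: lookup_add lookup_exp_vec)

lemma exp_vec_eq_iff: "exp_vec n f = exp_vec n g \<longleftrightarrow> (\<forall>i\<in>{1..n}. f i = g i)"
  by (auto simp: poly_mapping_eq_iff fun_eq_iff lookup_exp_vec)

definition xpow :: "nat \<Rightarrow> (nat \<Rightarrow> nat) \<Rightarrow> int_mpoly" where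
  "xpow n f = Poly_Mapping.single (exp_vec n f) 1"

lemma xpow_cong: "(\<And>i. i \<in> {1..n} \<Longrightarrow> f i = g i) \<Longrightarrow> xpow n f = xpow n g"
  unfolding xpow_def by (metis exp_vec_cong)

lemma xpow_mult: "xpow n f * xpow n g = xpow n (\<lambda>i. f i + g i)"
  by (simp add: xpow_def mult_single exp_vec_add)

text \<open>The determinant of the powers x_i ^ (f j), expanded over permutations. Exponents stay
  plain functions so that permuting variables is composition.\<close>

definition alternant :: "nat \<Rightarrow> (nat \<Rightarrow> nat) \<Rightarrow> int_mpoly" where
  "alternant n f = (\<Sum>p | p permutes {1..n}. of_int (sign p) * xpow n (f \<circ> p))"

lemma alternant_cong:
  assumes "\<And>i. i \<in> {1..n} \<Longrightarrow> f i = g i"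
  shows "alternant n f = alternant n g"
  unfolding alternant_def
proof (rule sum.cong)
  fix p assume "p \<in> {p. p permutes {1..n}}"
  then have "p i \<in> {1..n}" if "i \<in> {1..n}" for i
    using that permutes_in_image [of p "{1..n}" i] by simp
  then have "xpow n (f \<circ> p) = xpow n (g \<circ> p)"
    by (intro xpow_cong) (simp add: assms)
  then show "of_int (sign p) * xpow n (f \<circ> p) = of_int (sign p) * xpow n (g \<circ> p)"
    by simp
qed simp

text \<open>Left composition with the transposition permutes the index set of the sum and flips each
  sign.\<close>

lemma alternant_transpose:
  assumes "i \<in> {1..n}" "j \<in> {1..n}" "i \<noteq> j"
  shows "alternant n (f \<circ> Transposition.transpose i j) = - alternant n f"
proof -
  let ?t = "Transposition.transpose i j"
  have t: "?t permutes {1..n}"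
    using assms by (simp add: permutes_swap_id)
  have "alternant n f = (\<Sum>p | p permutes {1..n}. of_int (sign (?t \<circ> p)) * xpow n (f \<circ> (?t \<circ> p)))"
    unfolding alternant_def by (rule setum_permutations_compose_left [OF t])
  also have "\<dots> = (\<Sum>p | p permutes {1..n}. - (of_int (sign p) * xpow n ((f \<circ> ?t) \<circ> p)))"
  proof (rule sum.cong)
    fix p assume "p \<in> {p. p permutes {1..n}}"
    then have "permutation p"
      using permutation_permutes by blast
    then have sgn: "sign (?t \<circ> p) = - sign p"
      by (subst sign_compose) (auto simp: permutation_swap_id sign_swap_id assms(3))
    then show "of_int (sign (?t \<circ> p)) * xpow n (f \<circ> (?t \<circ> p)) = - (of_int (sign p) * xpow n ((f \<circ> ?t) \<circ> p))"
      by (simp only: sgn comp_assoc of_int_minus mult_minus_left)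
  qed simp
  finally show ?thesis
    by (simp add: alternant_def sum_negf)
qed

lemma eq_minus_self_imp_0: "(x :: int_mpoly) = - x \<Longrightarrow> x = 0"
proof -
  assume "x = - x"
  then have "2 * x = 0"
    by (metis add.right_inverse mult_2)
  then show "x = 0" by simp
qed

text \<open>Terms exchanged by a transposition of their exponents cancel in pairs.\<close>

lemma sum_alternant_eq_0:
  assumes "bij_betw \<tau> X X"
    and "\<And>x. x \<in> X \<Longrightarrow> \<exists>i\<in>{1..n}. \<exists>j\<in>{1..n}. i \<noteq> j \<and>
      (\<forall>l\<in>{1..n}. f (\<tau> x) l = f x (Transposition.transpose i j l))"
  shows "(\<Sum>x\<in>X. alternant n (f x)) = 0"
proof (rule eq_minus_self_imp_0)
  \<comment> \<open>Fixed points of \<tau> are covered too: their alternant has a repeated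
    exponent.\<close>
  have "(\<Sum>x\<in>X. alternant n (f x)) = (\<Sum>x\<in>X. alternant n (f (\<tau> x)))"
    by (rule sum.reindex_bij_betw [OF assms(1), symmetric])
  also have "\<dots> = (\<Sum>x\<in>X. - alternant n (f x))"
  proof (rule sum.cong)
    fix x assume "x \<in> X"
    from assms(2) [OF this] obtain i j where ij: "i \<in> {1..n}" "j \<in> {1..n}" "i \<noteq> j"
      and eq: "\<forall>l\<in>{1..n}. f (\<tau> x) l = f x (Transposition.transpose i j l)"
      by blast
    have "alternant n (f (\<tau> x)) = alternant n (f x \<circ> Transposition.transpose i j)"
      by (rule alternant_cong) (use eq in simp)
    then show "alternant n (f (\<tau> x)) = - alternant n (f x)"
      by (simp add: alternant_transpose [OF ij])
  qed simp
  finally show "(\<Sum>x\<in>X. alternant n (f x)) = - (\<Sum>x\<in>X. alternant n (f x))"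
    by (simp add: sum_negf)
qed

text \<open>An increasing p satisfies i \<le> p i on 1..n, and a permutation preserves the sum of
  1..n, so no inequality can be strict.\<close>

lemma permutes_strict_mono_eq_id:
  fixes p :: "nat \<Rightarrow> nat"
  assumes p: "p permutes {1..n}" and less: "\<And>i j. i \<in> {1..n} \<Longrightarrow> j \<in> {1..n} \<Longrightarrow> i < j \<Longrightarrow> p i < p j"
  shows "p = id"
proof -
  have ge: "i \<le> p i" if "i \<in> {1..n}" for i
    using that
  proof (induction i)
    case (Suc i)
    show ?case
    proof (cases "i = 0")
      case True
      then show ?thesis
        using permutes_in_image [OF p, of "Suc i"] Suc.prems by simp
    next
      case False
      then have "i \<le> p i" "p i < p (Suc i)"
        using Suc less [of i "Suc i"] by auto
      then show ?thesis by simp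
    qed
  qed simp
  have "p i = i" if "i \<in> {1..n}" for i
  proof (rule ccontr)
    assume "p i \<noteq> i"
    with ge that have lt: "i < p i" by (metis le_neq_implies_less)
    have "(\<Sum>j\<in>{1..n}. j) < (\<Sum>j\<in>{1..n}. p j)"
      using ge that lt by (intro sum_strict_mono_ex1) auto
    moreover have "(\<Sum>j\<in>{1..n}. p j) = (\<Sum>j\<in>{1..n}. j)"
      using sum.permute [OF p, of id] by simp
    ultimately show False by simp
  qed
  then show ?thesis
    using p by (auto simp: permutes_def fun_eq_iff)
qed

text \<open>Two strictly decreasing exponents can be matched by the identity permutation only, so
  such an alternant has exactly one strictly decreasing monomial. This gives both the nonvanishing
  of the denominator and the independence of Schur functions.\<close>

lemma lookup_alternant_strict:
  assumes f: "\<And>i j. i \<in> {1..n} \<Longrightarrow> j \<in> {1..n} \<Longrightarrow> i < j \<Longrightarrow> f j < f i"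
    and g: "\<And>i j. i \<in> {1..n} \<Longrightarrow> j \<in> {1..n} \<Longrightarrow> i < j \<Longrightarrow> g j < g i"
  shows "lookup (alternant n f) (exp_vec n g) = (if \<forall>i\<in>{1..n}. f i = g i then 1 else 0)"
proof -
  have "lookup (of_int (sign p) * xpow n (f \<circ> p)) (exp_vec n g)
      = (if p = id then if \<forall>i\<in>{1..n}. f i = g i then 1 else 0 else 0)"
    if p: "p permutes {1..n}" for p
  proof -
    have "p = id" if eq: "\<forall>i\<in>{1..n}. f (p i) = g i"
    proof (rule permutes_strict_mono_eq_id [OF p])
      fix i j assume ij: "i \<in> {1..n}" "j \<in> {1..n}" "i < j"
      then have "f (p j) < f (p i)" "p i \<in> {1..n}" "p j \<in> {1..n}"
        using eq g [OF ij] permutes_in_image [OF p] by auto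
      then show "p i < p j"
        using f [of "p j" "p i"] by (metis less_asym linorder_neqE_nat)
    qed
    moreover have "lookup (of_int (sign p) * xpow n (f \<circ> p)) (exp_vec n g)
        = (if \<forall>i\<in>{1..n}. f (p i) = g i then sign p else 0)"
      by (auto simp: xpow_def sign_def lookup_single when_def exp_vec_eq_iff)
    ultimately show ?thesis
      by auto
  qed
  then have "lookup (alternant n f) (exp_vec n g) =
      (\<Sum>p | p permutes {1..n}. if p = id then if \<forall>i\<in>{1..n}. f i = g i then 1 else 0 else 0)"
    by (simp add: alternant_def lookup_sum)
  also have "\<dots> = (if \<forall>i\<in>{1..n}. f i = g i then 1 else 0)"
    using finite_permutations [of "{1..n}"] permutes_id [of "{1..n}"]
    by (subst sum.delta) auto
  finally show ?thesis .
qed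

section \<open>Symmetry tested on adjacent transpositions\<close>

lemma permutes_adjacent_induct [consumes 1, case_names id adjacent comp]:
  assumes p: "p permutes {1..n::nat}"
    and id: "P id"
    and adj: "\<And>k. 1 \<le> k \<Longrightarrow> k < n \<Longrightarrow> P (Transposition.transpose k (Suc k))"
    and comp: "\<And>p q. p permutes {1..n} \<Longrightarrow> q permutes {1..n} \<Longrightarrow> P p \<Longrightarrow> P q \<Longrightarrow> P (p \<circ> q)"
  shows "P p"
proof -
  have trans: "1 \<le> a \<Longrightarrow> a + Suc d \<le> n \<Longrightarrow> P (Transposition.transpose a (a + Suc d))" for a d
  proof (induction d arbitrary: a)
    case 0
    then show ?case using adj [of a] by simp
  next
    case (Suc d)
    \<comment> \<open>Conjugating the transposition of a + 1 and a + d + 2 by the adjacent one gives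
      that of a and a + d + 2.\<close>
    let ?s = "Transposition.transpose a (Suc a)"
    let ?t = "Transposition.transpose (Suc a) (Suc a + Suc d)"
    have "P ?t" "P ?s"
      using Suc.IH [of "Suc a"] Suc.prems adj [of a] by simp_all
    moreover have "?s permutes {1..n}" "?t permutes {1..n}"
      using Suc.prems by (auto intro!: permutes_swap_id)
    ultimately have "P (?s \<circ> (?t \<circ> ?s))"
      by (intro comp permutes_compose)
    moreover have "?s \<circ> (?t \<circ> ?s) = Transposition.transpose a (a + Suc (Suc d))"
      by (auto simp: fun_eq_iff Transposition.transpose_def)
    ultimately show ?case by simp
  qed
  have trans': "P (Transposition.transpose a b)" if "a \<in> {1..n}" "b \<in> {1..n}" "a < b" for a b
    using trans [of a "b - Suc a"] that by simp
  from p finite_atLeastAtMost show ?thesis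
  proof (induction rule: permutes_induct)
    case (swap a b p)
    have "P (Transposition.transpose a b)"
      using trans' [of a b] trans' [of b a] swap.hyps
      by (metis linorder_neqE_nat transpose_commute)
    then show ?case
      using swap by (intro comp) (auto intro: permutes_swap_id)
  qed (use id in \<open>simp_all add: id_def\<close>)
qed

text \<open>Symmetry of the weight sum, recorded as bijections of the index set; adjacent letters
  are what the Bender--Knuth involutions provide.\<close>

locale symmetric_family =
  fixes n :: nat and X :: "'a set" and wt :: "'a \<Rightarrow> nat \<Rightarrow> nat"
  assumes adjacent_bij: "1 \<le> k \<Longrightarrow> k < n \<Longrightarrow> \<exists>\<tau>. bij_betw \<tau> X X \<and>
    (\<forall>x\<in>X. \<forall>i\<in>{1..n}. wt (\<tau> x) i = wt x (Transposition.transpose k (Suc k) i))"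
begin

lemma permutes_bij:
  "p permutes {1..n} \<Longrightarrow>
    \<exists>\<tau>. bij_betw \<tau> X X \<and> (\<forall>x\<in>X. \<forall>i\<in>{1..n}. wt (\<tau> x) i = wt x (p i))"
proof (induction rule: permutes_adjacent_induct)
  case id
  show ?case by (rule exI [of _ "\<lambda>x. x"]) (simp add: bij_betw_def)
next
  case (adjacent k)
  then show ?case by (rule adjacent_bij)
next
  case (comp p q)
  then obtain \<sigma> \<tau> where \<sigma>: "bij_betw \<sigma> X X" "\<forall>x\<in>X. \<forall>i\<in>{1..n}. wt (\<sigma> x) i = wt x (p i)"
    and \<tau>: "bij_betw \<tau> X X" "\<forall>x\<in>X. \<forall>i\<in>{1..n}. wt (\<tau> x) i = wt x (q i)"
    by blast
  \<comment> \<open>\<sigma> acts first: the weight of \<tau> (\<sigma> x) at i is that of \<sigma>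
    x at q i, hence that of x at p (q i).\<close>
  have "wt ((\<tau> \<circ> \<sigma>) x) i = wt x ((p \<circ> q) i)" if "x \<in> X" "i \<in> {1..n}" for x i
  proof -
    have "\<sigma> x \<in> X" "q i \<in> {1..n}"
      using \<sigma>(1) that permutes_in_image [OF comp(2), of i] by (auto dest: bij_betwE)
    then show ?thesis
      using \<sigma>(2) \<tau>(2) that by simp
  qed
  then show ?case
    using bij_betw_trans [OF \<sigma>(1) \<tau>(1)] by blast
qed

text \<open>For each p the symmetric factor is rewritten with its exponents permuted by p. Both
  exponents are then twisted by the same p and regroup into one alternant per x.\<close>

lemma alternant_mult:
  "alternant n f * (\<Sum>x\<in>X. xpow n (wt x)) = (\<Sum>x\<in>X. alternant n (\<lambda>i. f i + wt x i))"
proof -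
  have "xpow n (f \<circ> p) * (\<Sum>x\<in>X. xpow n (wt x)) = (\<Sum>x\<in>X. xpow n ((\<lambda>i. f i + wt x i) \<circ> p))"
    if p: "p permutes {1..n}" for p
  proof -
    obtain \<tau> where \<tau>: "bij_betw \<tau> X X" "\<forall>x\<in>X. \<forall>i\<in>{1..n}. wt (\<tau> x) i = wt x (p i)"
      using permutes_bij [OF p] by blast
    have "(\<Sum>x\<in>X. xpow n (wt x)) = (\<Sum>x\<in>X. xpow n (wt (\<tau> x)))"
      by (rule sum.reindex_bij_betw [OF \<tau>(1), symmetric])
    also have "\<dots> = (\<Sum>x\<in>X. xpow n (wt x \<circ> p))"
      by (intro sum.cong xpow_cong) (use \<tau> in simp_all)
    finally show ?thesis
      by (simp add: sum_distrib_left xpow_mult comp_def)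
  qed
  then have "alternant n f * (\<Sum>x\<in>X. xpow n (wt x)) =
      (\<Sum>p | p permutes {1..n}. \<Sum>x\<in>X. of_int (sign p) * xpow n ((\<lambda>i. f i + wt x i) \<circ> p))"
    unfolding alternant_def sum_distrib_right
    by (intro sum.cong) (simp_all add: mult.assoc sum_distrib_left [symmetric])
  also have "\<dots> = (\<Sum>x\<in>X. alternant n (\<lambda>i. f i + wt x i))"
    unfolding alternant_def by (rule sum.swap)
  finally show ?thesis .
qed

end

section \<open>Gelfand--Tsetlin patterns\<close>

text \<open>A tableau with entries at most \<open>n\<close> is encoded by the numbers \<open>g k r\<close> of entries at most \<open>k\<close> in
  row \<open>r\<close>. Row 0 is a sentinel of constant length \<open>lam\<^sub>1\<close>, which makes the bounds on row 1 uniform.\<close>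

definition gt_patterns :: "nat \<Rightarrow> (nat \<Rightarrow>\<^sub>0 nat) \<Rightarrow> (nat \<Rightarrow> nat \<Rightarrow> nat) set" where
  "gt_patterns n lam = {g. (\<forall>k. g k 0 = lookup lam 1) \<and> (\<forall>r\<ge>1. g 0 r = 0) \<and>
     (\<forall>k r. g k r \<le> g (Suc k) r) \<and> (\<forall>k r. g (Suc k) (Suc r) \<le> g k r) \<and>
     (\<forall>k r. n \<le> k \<longrightarrow> 1 \<le> r \<longrightarrow> g k r = lookup lam r)}"

text \<open>The number of letters \<open>k\<close> in the columns to the right of column \<open>m\<close>.\<close>

definition letters :: "nat \<Rightarrow> (nat \<Rightarrow> nat \<Rightarrow> nat) \<Rightarrow> nat \<Rightarrow> nat \<Rightarrow> nat" where
  "letters n g k m = (\<Sum>r = 1..n. (g k r - m) - (g (k - 1) r - m))"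

text \<open>The occurrences of \<open>k\<close> in column \<open>m + 1\<close>.\<close>

definition column_has :: "nat \<Rightarrow> (nat \<Rightarrow> nat \<Rightarrow> nat) \<Rightarrow> nat \<Rightarrow> nat \<Rightarrow> nat" where
  "column_has n g k m = card {r \<in> {1..n}. g (k - 1) r \<le> m \<and> m < g k r}"

text \<open>Row r has k in column m + 1 exactly when g (k - 1) r \<le> m < g k r; here this is
  excluded for all rows at once.\<close>

definition column_lacks :: "nat \<Rightarrow> nat \<Rightarrow> (nat \<Rightarrow> nat \<Rightarrow> nat) \<Rightarrow> bool" where
  "column_lacks k m g \<longleftrightarrow> (\<forall>r\<ge>1. g k r \<le> m \<or> m < g (k - 1) r)"

text \<open>The Bender--Knuth involution for \<open>k\<close> and \<open>k + 1\<close> on the columns up to \<open>m\<close>: it reflects \<open>g k r\<close>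
  in the interval that the levels \<open>k - 1\<close> and \<open>k + 1\<close> leave for it.\<close>

definition toggle :: "nat \<Rightarrow> nat \<Rightarrow> (nat \<Rightarrow> nat \<Rightarrow> nat) \<Rightarrow> (nat \<Rightarrow> nat \<Rightarrow> nat)" where
  "toggle k m g = (\<lambda>j r. if j = k \<and> 1 \<le> r \<and> g k r \<le> m
     then min (min (g (Suc k) r) m) (g (k - 1) (r - 1)) + max (g (Suc k) (Suc r)) (g (k - 1) r) - g k r
     else g j r)"

text \<open>The lattice condition tested after whole columns only. For m at least the first row
  length it constrains d alone; m = 0 concerns d plus the whole content.\<close>

definition yamanouchi :: "nat \<Rightarrow> (nat \<Rightarrow> nat) \<Rightarrow> (nat \<Rightarrow> nat \<Rightarrow> nat) \<Rightarrow> bool" where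
  "yamanouchi n d g \<longleftrightarrow>
     (\<forall>m k. 1 \<le> k \<and> k < n \<longrightarrow> d (Suc k) + letters n g (Suc k) m \<le> d k + letters n g k m)"

text \<open>By min x y + max x y = x + y, the \<open>max\<close> of row r pairs with the
  \<open>min\<close> of row r + 1, and only terms at the two ends remain. The summands are the sums
  of the two ends of the toggle intervals.\<close>

lemma sum_min_max_telescope:
  fixes a b :: "nat \<Rightarrow> nat"
  shows "(\<Sum>r = 1..n. min (a r) (b (r - 1)) + max (a (Suc r)) (b r)) + max (a 1) (b 0) + b n =
    (\<Sum>r = 1..n. a r) + (\<Sum>r = 1..n. b r) + b 0 + max (a (Suc n)) (b n)"
proof (induction n)
  case (Suc n)
  define p q q' where "p = min (a (Suc n)) (b n)" and "q = max (a (Suc n)) (b n)"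
    and "q' = max (a (Suc (Suc n))) (b (Suc n))"
  have "p + q = a (Suc n) + b n"
    by (simp add: p_def q_def)
  with Suc.IH show ?case
    unfolding sum.atLeast1_atMost_eq by (simp add: p_def [symmetric] q_def [symmetric] q'_def [symmetric])
qed simp

context
  fixes n :: nat and lam :: "nat \<Rightarrow>\<^sub>0 nat" and g :: "nat \<Rightarrow> nat \<Rightarrow> nat"
  assumes g: "g \<in> gt_patterns n lam"
begin

lemma GT_row0: "g k 0 = lookup lam 1"
  and GT_level0: "1 \<le> r \<Longrightarrow> g 0 r = 0"
  and GT_up: "g k r \<le> g (Suc k) r"
  and GT_diag: "g (Suc k) (Suc r) \<le> g k r"
  and GT_top: "n \<le> k \<Longrightarrow> 1 \<le> r \<Longrightarrow> g k r = lookup lam r"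
  using g by (auto simp: gt_patterns_def)

lemma GT_row_le: "g k (Suc r) \<le> g k r"
  using GT_up [of k "Suc r"] GT_diag [of k r] by (rule order_trans)

lemma GT_antimono: "r \<le> r' \<Longrightarrow> g k r' \<le> g k r"
  by (rule lift_Suc_antimono_le [of "g k"]) (rule GT_row_le)

lemma GT_level_mono: "k \<le> k' \<Longrightarrow> g k r \<le> g k' r"
  by (rule lift_Suc_mono_le [of "\<lambda>k. g k r"]) (rule GT_up)

text \<open>Column strictness in pattern form: entries of row r are at least r. The induction
  descends along the diagonal to level 0.\<close>

lemma GT_zero: "k < r \<Longrightarrow> g k r = 0"
proof (induction k arbitrary: r)
  case 0
  then show ?case using GT_level0 by simp
next
  case (Suc k)
  then obtain r' where "r = Suc r'" "k < r'" by (cases r) auto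
  then show ?case
    using Suc.IH [of r'] GT_diag [of k r'] by simp
qed

lemma GT_le_first: "g k r \<le> lookup lam 1"
  using GT_antimono [of 0 r k] GT_row0 [of k] by simp

lemma GT_lam_zero: "n < r \<Longrightarrow> lookup lam r = 0"
  using GT_top [of n r] GT_zero [of n r] by simp

lemma letters_add: "1 \<le> k \<Longrightarrow> (\<Sum>r = 1..n. g (k - 1) r - m) + letters n g k m = (\<Sum>r = 1..n. g k r - m)"
  unfolding letters_def sum.distrib [symmetric]
proof (rule sum.cong)
  fix r
  assume "1 \<le> k"
  then have "g (k - 1) r \<le> g k r"
    using GT_up [of "k - 1" r] by simp
  then show "g (k - 1) r - m + (g k r - m - (g (k - 1) r - m)) = g k r - m"
    by linarith
qed simp

lemma letters_eq_0: "lookup lam 1 \<le> m \<Longrightarrow> letters n g k m = 0"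
  using order_trans [OF GT_le_first] by (simp add: letters_def)

context
  fixes k m :: nat
  assumes k: "1 \<le> k" "k < n" and column_lacks: "column_lacks k m g"
begin

lemma toggle_bounds:
  assumes "1 \<le> r" "g k r \<le> m"
  shows "max (g (Suc k) (Suc r)) (g (k - 1) r) \<le> g k r"
    and "g k r \<le> min (min (g (Suc k) r) m) (g (k - 1) (r - 1))"
    and "max (g (Suc k) (Suc r)) (g (k - 1) r) \<le> toggle k m g k r"
    and "toggle k m g k r \<le> min (min (g (Suc k) r) m) (g (k - 1) (r - 1))"
proof -
  \<comment> \<open>Reflection in an interval maps it to itself; the interval is the room left by
    the interlacing conditions, capped by m.\<close>
  have reflect: "lo \<le> hi + lo - x" "hi + lo - x \<le> hi" if "lo \<le> x" "x \<le> hi" for lo x hi :: nat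
    using that by linarith+
  show lo: "max (g (Suc k) (Suc r)) (g (k - 1) r) \<le> g k r"
    and hi: "g k r \<le> min (min (g (Suc k) r) m) (g (k - 1) (r - 1))"
    using assms k GT_up [of k r] GT_up [of "k - 1" r] GT_diag [of k r] GT_diag [of "k - 1" "r - 1"] by simp_all
  show "max (g (Suc k) (Suc r)) (g (k - 1) r) \<le> toggle k m g k r"
    and "toggle k m g k r \<le> min (min (g (Suc k) r) m) (g (k - 1) (r - 1))"
    using reflect [OF lo hi] assms unfolding toggle_def by (simp_all only: simp_thms if_True)
qed

lemma toggle_row: "toggle k m g k r = g k r" if "\<not> (1 \<le> r \<and> g k r \<le> m)"
  using that by (auto simp: toggle_def)

lemma toggle_level: "j \<noteq> k \<Longrightarrow> toggle k m g j r = g j r"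
  by (simp add: toggle_def)

text \<open>The upper end of the interval is capped by m, so the same rows are reflected before and
  after; the involution property rests on this.\<close>

lemma toggle_le_iff: "1 \<le> r \<Longrightarrow> toggle k m g k r \<le> m \<longleftrightarrow> g k r \<le> m"
  by (cases "g k r \<le> m") (use toggle_bounds(4) [of r] toggle_row [of r] in simp_all)

text \<open>The interval lies within the interlacing bounds that levels k - 1 and k + 1 impose on
  level k, and rows beyond m keep their value.\<close>

lemma toggle_in_GT: "toggle k m g \<in> gt_patterns n lam"
proof -
  let ?h = "toggle k m g"
  have up: "g (k - 1) r \<le> ?h k r" "?h k r \<le> g (Suc k) r" for r
    using toggle_bounds(3,4) [of r] toggle_row [of r] GT_up [of k r] GT_up [of "k - 1" r] k
    by (cases "1 \<le> r \<and> g k r \<le> m"; simp)+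
  have diag1: "g (Suc k) (Suc r) \<le> ?h k r" for r
    using toggle_bounds(3) [of r] toggle_row [of r] GT_diag [of k r]
    by (cases "1 \<le> r \<and> g k r \<le> m") simp_all
  have diag2: "?h k (Suc r) \<le> g (k - 1) r" for r
    using toggle_bounds(4) [of "Suc r"] toggle_row [of "Suc r"] GT_diag [of "k - 1" r] k
    by (cases "g k (Suc r) \<le> m") simp_all
  note diag = diag1 diag2
  have "?h j r \<le> ?h (Suc j) r" for j r
    using up [of r] GT_up [of j r] by (cases "j = k"; cases "Suc j = k") (auto simp: toggle_level)
  moreover have "?h (Suc j) (Suc r) \<le> ?h j r" for j r
    using diag [of r] GT_diag [of j r] by (cases "j = k"; cases "Suc j = k") (auto simp: toggle_level)
  moreover have "?h j 0 = lookup lam 1" for j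
    using GT_row0 by (simp add: toggle_def)
  ultimately show ?thesis
    using k GT_level0 GT_top by (auto simp: gt_patterns_def toggle_level)
qed

lemma toggle_toggle: "toggle k m (toggle k m g) = g"
proof (intro ext)
  fix j r
  let ?h = "toggle k m g"
  show "toggle k m ?h j r = g j r"
  proof (cases "j = k \<and> 1 \<le> r \<and> g k r \<le> m")
    case True
    let ?hi = "min (min (g (Suc k) r) m) (g (k - 1) (r - 1))"
    let ?lo = "max (g (Suc k) (Suc r)) (g (k - 1) r)"
    have "?h k r = ?hi + ?lo - g k r"
      using True by (simp add: toggle_def)
    moreover have "toggle k m ?h k r = ?hi + ?lo - ?h k r"
      using True toggle_le_iff [of r] k by (simp add: toggle_def [of k m ?h] toggle_level)
    moreover have "x = hi + lo - (hi + lo - x)" if "lo \<le> x" "x \<le> hi" for lo x hi :: nat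
      using that by linarith
    ultimately show ?thesis
      using True toggle_bounds(1,2) [of r] by metis
  next
    case False
    then have "?h j r = g j r"
      using toggle_row [of r] toggle_level [of j r] by blast
    moreover have "\<not> (j = k \<and> 1 \<le> r \<and> ?h k r \<le> m)"
      using False toggle_le_iff [of r] by blast
    then have "toggle k m ?h j r = ?h j r"
      unfolding toggle_def [of k m ?h] by (simp only: if_False)
    ultimately show ?thesis by simp
  qed
qed

text \<open>A reflected entry is at most m before and after, so both truncated differences are 0:
  columns right of m are untouched.\<close>

lemma toggle_diff: "m \<le> m' \<Longrightarrow> toggle k m g j r - m' = g j r - m'"
proof (cases "j = k \<and> 1 \<le> r \<and> g k r \<le> m")
  case True
  then show "m \<le> m' \<Longrightarrow> ?thesis"
    using toggle_le_iff [of r] by simp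
qed (auto simp: toggle_def)

lemma letters_toggle: "m \<le> m' \<Longrightarrow> letters n (toggle k m g) j m' = letters n g j m'"
  by (simp add: letters_def toggle_diff)

text \<open>The Bender--Knuth exchange for the left part of the tableau, whose pattern is g
  truncated by m. In each row, old and new value add up to the two ends of the interval, and these
  sums telescope.\<close>

lemma sum_min_toggle:
  "(\<Sum>r = 1..n. min (toggle k m g k r) m) + (\<Sum>r = 1..n. min (g k r) m) =
    (\<Sum>r = 1..n. min (g (Suc k) r) m) + (\<Sum>r = 1..n. min (g (k - 1) r) m)"
proof -
  let ?a = "\<lambda>r. min (g (Suc k) r) m" and ?b = "\<lambda>r. min (g (k - 1) r) m"
  have "min (toggle k m g k r) m + min (g k r) m = min (?a r) (?b (r - 1)) + max (?a (Suc r)) (?b r)"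
    if r: "1 \<le> r" for r
  proof (cases "g k r \<le> m")
    case True
    let ?hi = "min (min (g (Suc k) r) m) (g (k - 1) (r - 1))"
    let ?lo = "max (g (Suc k) (Suc r)) (g (k - 1) r)"
    have "min (toggle k m g k r) m = ?hi + ?lo - g k r"
      using True r toggle_le_iff [of r] by (simp add: toggle_def min_absorb1 del: min.bounded_iff max.bounded_iff)
    moreover have "min (g k r) m = g k r" "g k r \<le> ?hi + ?lo"
      using True toggle_bounds(2) [OF r True] by (simp_all add: trans_le_add1 min_absorb1 del: min.bounded_iff)
    moreover have "min (?a r) (?b (r - 1)) = ?hi"
      by (metis min.assoc min.commute min.idem)
    moreover have "?a (Suc r) = g (Suc k) (Suc r)" "?b r = g (k - 1) r"
      using toggle_bounds(1) [OF r True] True by simp_all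
    ultimately show ?thesis
      by (simp only: le_add_diff_inverse2)
  next
    case False
    \<comment> \<open>Absence of k from column m + 1 enters here: an unreflected row reaches beyond
      m already at level k - 1, so all truncated terms in it equal m.\<close>
    then have "m < g (k - 1) r"
      using column_lacks r by (auto simp: column_lacks_def)
    moreover have "g (k - 1) r \<le> g (k - 1) (r - 1)" "g k r \<le> g (Suc k) r"
      using GT_antimono [of "r - 1" r] GT_up by simp_all
    ultimately show ?thesis
      using False toggle_row [of r] by simp
  qed
  then have "(\<Sum>r = 1..n. min (toggle k m g k r) m) + (\<Sum>r = 1..n. min (g k r) m) =
      (\<Sum>r = 1..n. min (?a r) (?b (r - 1)) + max (?a (Suc r)) (?b r))"
    by (simp add: sum.distrib [symmetric])
  \<comment> \<open>Boundary terms: the sentinel row dominates at the top, and k < n makes the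
    bottom entries 0.\<close>
  moreover have "max (?a 1) (?b 0) = ?b 0"
    using GT_le_first [of "Suc k" 1] GT_row0 [of "k - 1"] by simp
  moreover have "g (k - 1) n = 0" "g (Suc k) (Suc n) = 0"
    using k GT_zero by simp_all
  ultimately show ?thesis
    using sum_min_max_telescope [of ?a ?b n] by simp
qed

lemma toggle_letters_other: "j \<noteq> k \<Longrightarrow> j \<noteq> Suc k \<Longrightarrow> 1 \<le> j \<Longrightarrow> letters n (toggle k m g) j m' = letters n g j m'"
proof -
  assume "j \<noteq> k" "j \<noteq> Suc k" "1 \<le> j"
  then have "j - 1 \<noteq> k" by simp
  with \<open>j \<noteq> k\<close> show ?thesis
    by (simp add: letters_def toggle_level)
qed

text \<open>Left of the cut the numbers of k and k + 1 are exchanged, right of it nothing changes;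
  the totals are compared without subtraction.\<close>

lemma toggle_letters:
  "letters n (toggle k m g) k 0 + letters n g (Suc k) m = letters n g k m + letters n g (Suc k) 0"
  "letters n (toggle k m g) (Suc k) 0 + letters n g k m = letters n g (Suc k) m + letters n g k 0"
proof -
  let ?h = "toggle k m g"
  have split: "(\<Sum>r = 1..n. f r) = (\<Sum>r = 1..n. min (f r) m) + (\<Sum>r = 1..n. f r - m)" for f :: "nat \<Rightarrow> nat"
    unfolding sum.distrib [symmetric] by (rule sum.cong) auto
  have add: "(\<Sum>r = 1..n. g (k - 1) r - m') + letters n g k m' = (\<Sum>r = 1..n. g k r - m')"
    "(\<Sum>r = 1..n. g k r - m') + letters n g (Suc k) m' = (\<Sum>r = 1..n. g (Suc k) r - m')" for m'
    using letters_add [of k m'] letters_add [of "Suc k" m'] k by simp_all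
  have hadd: "(\<Sum>r = 1..n. g (k - 1) r) + letters n ?h k 0 = (\<Sum>r = 1..n. ?h k r)"
    "(\<Sum>r = 1..n. ?h k r) + letters n ?h (Suc k) 0 = (\<Sum>r = 1..n. g (Suc k) r)"
    using Submission.letters_add [OF toggle_in_GT, of k 0] Submission.letters_add [OF toggle_in_GT, of "Suc k" 0] k
    by (simp_all add: toggle_level)
  have "(\<Sum>r = 1..n. ?h k r - m) = (\<Sum>r = 1..n. g k r - m)"
    by (simp add: toggle_diff)
  then show "letters n ?h k 0 + letters n g (Suc k) m = letters n g k m + letters n g (Suc k) 0"
    "letters n ?h (Suc k) 0 + letters n g k m = letters n g (Suc k) m + letters n g k 0"
    using hadd add [of 0, unfolded minus_nat.diff_0] add [of m] sum_min_toggle split [of "?h k"] split [of "g k"]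
      split [of "g (Suc k)"] split [of "g (k - 1)"] by linarith+
qed

end

lemma letters_Suc: "1 \<le> k \<Longrightarrow> letters n g k m = letters n g k (Suc m) + column_has n g k m"
proof -
  assume k: "1 \<le> k"
  have "(g k r - m) - (g (k - 1) r - m) = (g k r - Suc m) - (g (k - 1) r - Suc m) +
      (if g (k - 1) r \<le> m \<and> m < g k r then 1 else 0)" for r
    using GT_up [of "k - 1" r] k by auto
  then have "letters n g k m = letters n g k (Suc m) +
      (\<Sum>r = 1..n. if g (k - 1) r \<le> m \<and> m < g k r then 1 else 0)"
    by (simp add: letters_def sum.distrib)
  also have "(\<Sum>r = 1..n. if g (k - 1) r \<le> m \<and> m < g k r then 1 else 0) = column_has n g k m"
    by (simp add: column_has_def sum.If_cases Int_def)
  finally show ?thesis .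
qed

text \<open>Rows r' < r with k in the same column would give g k r \<le> g k (r' + 1) \<le> g (k -
  1) r' \<le> m, against m < g k r.\<close>

lemma column_has_le_1: "1 \<le> k \<Longrightarrow> column_has n g k m \<le> 1"
proof -
  assume k: "1 \<le> k"
  have le: "r \<le> r'" if "g (k - 1) r' \<le> m" "m < g k r" for r r'
  proof (rule ccontr)
    assume "\<not> r \<le> r'"
    then have "g k r \<le> g k (Suc r')"
      by (intro GT_antimono) simp
    also have "\<dots> \<le> g (k - 1) r'"
      using GT_diag [of "k - 1" r'] k by simp
    finally show False using that by simp
  qed
  have "r = r'" if "g (k - 1) r \<le> m" "m < g k r" "g (k - 1) r' \<le> m" "m < g k r'" for r r'
    using le [of r' r] le [of r r'] that by simp
  then have "\<forall>r\<in>{r \<in> {1..n}. g (k - 1) r \<le> m \<and> m < g k r}. \<forall>r'\<in>{r \<in> {1..n}. g (k - 1) r \<le> m \<and> m < g k r}. r = r'"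
    by blast
  then show ?thesis
    unfolding column_has_def One_nat_def by (subst card_le_Suc0_iff_eq) auto
qed

lemma column_has_0_imp_column_lacks: "k < n \<Longrightarrow> column_has n g k m = 0 \<Longrightarrow> column_lacks k m g"
proof -
  assume k: "k < n" and "column_has n g k m = 0"
  have "g k r \<le> m \<or> m < g (k - 1) r" if "r \<in> {1..n}" for r
  proof (rule ccontr)
    assume "\<not> (g k r \<le> m \<or> m < g (k - 1) r)"
    then have "r \<in> {r \<in> {1..n}. g (k - 1) r \<le> m \<and> m < g k r}"
      using that by simp
    then show False
      using \<open>column_has n g k m = 0\<close> unfolding column_has_def by (subst (asm) card_0_eq) auto
  qed
  moreover have "g k r \<le> m" if "n < r" for r
    using GT_zero [of k r] k that by simp
  ultimately show ?thesis
    unfolding column_lacks_def by (metis atLeastAtMost_iff not_le)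
qed

end

text \<open>Values outside the box k < n, 1 \<le> r \<le> n are forced, and inside they are at most
  the first row length.\<close>

lemma finite_GT: "finite (gt_patterns n lam)"
proof -
  let ?A = "{0..<n} \<times> {1..n}"
  let ?cut = "\<lambda>g (k, r). if k < n \<and> 1 \<le> r \<and> r \<le> n then g k r else (0::nat)"
  let ?F = "{f :: nat \<times> nat \<Rightarrow> nat. \<forall>x. (x \<in> ?A \<longrightarrow> f x \<in> {..lookup lam 1}) \<and> (x \<notin> ?A \<longrightarrow> f x = 0)}"
  have "finite ?F"
    by (rule finite_set_of_finite_funs) auto
  moreover have "?cut ` gt_patterns n lam \<subseteq> ?F"
    using GT_le_first by auto
  ultimately have "finite (?cut ` gt_patterns n lam)"
    by (rule rev_finite_subset)
  moreover have "inj_on ?cut (gt_patterns n lam)"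
  proof (rule inj_onI, intro ext)
    fix g h k r
    assume gh: "g \<in> gt_patterns n lam" "h \<in> gt_patterns n lam" and eq: "?cut g = ?cut h"
    consider "r = 0" | "n \<le> k" "1 \<le> r" | "k < n" "n < r" | "k < n" "1 \<le> r" "r \<le> n"
      by linarith
    then show "g k r = h k r"
    proof cases
      case 4
      then show ?thesis
        using fun_cong [OF eq, of "(k, r)"] by simp
    qed (simp_all add: gh [THEN GT_row0] gh [THEN GT_top] gh [THEN GT_zero])
  qed
  ultimately show ?thesis
    by (rule finite_imageD)
qed

text \<open>The Schur polynomial in n variables; \<open>lookup_gt_poly\<close> identifies it with
  \<open>schur\<close> after the variables beyond n are set to 0.\<close>

definition gt_poly :: "nat \<Rightarrow> (nat \<Rightarrow>\<^sub>0 nat) \<Rightarrow> int_mpoly" where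
  "gt_poly n lam = (\<Sum>g\<in>gt_patterns n lam. xpow n (\<lambda>i. letters n g i 0))"

lemma symmetric_family_GT: "symmetric_family n (gt_patterns n lam) (\<lambda>g i. letters n g i 0)"
proof
  fix k assume k: "1 \<le> k" "k < n"
  \<comment> \<open>A cut at the full width leaves nothing to the right: this is the ordinary
    Bender--Knuth involution.\<close>
  let ?\<tau> = "toggle k (lookup lam 1)"
  have column_lacks: "column_lacks k (lookup lam 1) g" if "g \<in> gt_patterns n lam" for g
    using GT_le_first [OF that] by (simp add: column_lacks_def)
  have "bij_betw ?\<tau> (gt_patterns n lam) (gt_patterns n lam)"
    by (rule bij_betw_byWitness [where f' = ?\<tau>])
      (use toggle_toggle toggle_in_GT k column_lacks in auto)
  moreover have "letters n (?\<tau> g) i 0 = letters n g (Transposition.transpose k (Suc k) i) 0"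
    if g: "g \<in> gt_patterns n lam" and i: "i \<in> {1..n}" for g i
  proof -
    note eq = toggle_letters [OF g k column_lacks [OF g]] letters_eq_0 [OF g order_refl]
    consider "i = k" | "i = Suc k" | "i \<noteq> k" "i \<noteq> Suc k" by blast
    then show ?thesis
      using eq toggle_letters_other [OF g k column_lacks [OF g], of i 0] i by cases auto
  qed
  ultimately show "\<exists>\<tau>. bij_betw \<tau> (gt_patterns n lam) (gt_patterns n lam) \<and> (\<forall>g\<in>gt_patterns n lam. \<forall>i\<in>{1..n}.
      letters n (\<tau> g) i 0 = letters n g (Transposition.transpose k (Suc k) i) 0)"
    by blast
qed

section \<open>Sign-reversing involution on the patterns that break the lattice condition\<close>

definition violates :: "nat \<Rightarrow> (nat \<Rightarrow> nat) \<Rightarrow> (nat \<Rightarrow> nat \<Rightarrow> nat) \<Rightarrow> nat \<Rightarrow> nat \<Rightarrow> bool" where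
  "violates n d g m k \<longleftrightarrow> 1 \<le> k \<and> k < n \<and> d k + letters n g k m < d (Suc k) + letters n g (Suc k) m"

lemma yamanouchi_iff: "yamanouchi n d g \<longleftrightarrow> (\<forall>m k. \<not> violates n d g m k)"
  unfolding yamanouchi_def violates_def not_le [symmetric] by blast

text \<open>Reading from the right meets the greatest m first, since \<open>letters\<close> at m
  counts the columns beyond m.\<close>

definition last_column :: "nat \<Rightarrow> (nat \<Rightarrow> nat) \<Rightarrow> (nat \<Rightarrow> nat \<Rightarrow> nat) \<Rightarrow> nat" where
  "last_column n d g = (GREATEST m. \<exists>k. violates n d g m k)"

text \<open>A choice that depends only on counts right of the cut, which the toggle preserves; it
  can therefore be recovered from the image.\<close>

definition first_letter :: "nat \<Rightarrow> (nat \<Rightarrow> nat) \<Rightarrow> (nat \<Rightarrow> nat \<Rightarrow> nat) \<Rightarrow> nat" where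
  "first_letter n d g = (LEAST k. violates n d g (last_column n d g) k)"

context
  fixes n :: nat and lam :: "nat \<Rightarrow>\<^sub>0 nat" and d :: "nat \<Rightarrow> nat"
  assumes d: "\<And>k. 1 \<le> k \<Longrightarrow> k < n \<Longrightarrow> d (Suc k) \<le> d k"
begin

lemma violates_imp_less:
  assumes "g \<in> gt_patterns n lam" "violates n d g m k"
  shows "m \<le> lookup lam 1"
proof (rule ccontr)
  assume "\<not> m \<le> lookup lam 1"
  then have "letters n g j m = 0" for j
    by (intro letters_eq_0 [OF assms(1)]) simp
  then show False
    using assms(2) d [of k] by (simp add: violates_def)
qed

lemma violates_first_letter:
  assumes g: "g \<in> gt_patterns n lam" and bad: "\<not> yamanouchi n d g"
  shows "violates n d g (last_column n d g) (first_letter n d g)"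
proof -
  obtain m k where "violates n d g m k"
    using bad unfolding yamanouchi_iff by blast
  then have "\<exists>m k. violates n d g m k" by blast
  then have "\<exists>k. violates n d g (last_column n d g) k"
    unfolding last_column_def
    by (rule GreatestI_ex_nat [where b = "lookup lam 1"]) (use violates_imp_less [OF g] in blast)
  then show ?thesis
    unfolding first_letter_def by (rule LeastI_ex)
qed

lemma not_violates_after:
  assumes g: "g \<in> gt_patterns n lam" and "last_column n d g < m"
  shows "\<not> violates n d g m k"
proof
  assume "violates n d g m k"
  then have "\<exists>k. violates n d g m k" by blast
  then have "m \<le> last_column n d g"
    unfolding last_column_def
    by (rule Greatest_le_nat [where b = "lookup lam 1"]) (use violates_imp_less [OF g] in blast)
  with assms(2) show False by simp
qed

text \<open>In the last column that breaks the condition, the letter \<open>k + 1\<close> occurs and \<open>k\<close> does not.\<close>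

lemma violates_tight:
  assumes g: "g \<in> gt_patterns n lam" and bad: "\<not> yamanouchi n d g"
  defines "m \<equiv> last_column n d g" and "k \<equiv> first_letter n d g"
  shows "Suc (d k + letters n g k m) = d (Suc k) + letters n g (Suc k) m" and "column_lacks k m g"
proof -
  have v: "1 \<le> k" "k < n" "d k + letters n g k m < d (Suc k) + letters n g (Suc k) m"
    using violates_first_letter [OF g bad] by (simp_all add: violates_def m_def k_def)
  have "d (Suc k) + letters n g (Suc k) (Suc m) \<le> d k + letters n g k (Suc m)"
    using not_violates_after [OF g, of "Suc m" k] v by (simp add: violates_def m_def)
  moreover have "letters n g k m = letters n g k (Suc m) + column_has n g k m"
    "letters n g (Suc k) m = letters n g (Suc k) (Suc m) + column_has n g (Suc k) m"
    "column_has n g (Suc k) m \<le> 1"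
    using letters_Suc [OF g, of k m] letters_Suc [OF g, of "Suc k" m]
      column_has_le_1 [OF g, of "Suc k" m] v by simp_all
  \<comment> \<open>Before column m + 1 is read the inequality holds, and this column adds at most
    one k + 1. So it adds one k + 1 and no k, and the violation is by exactly 1.\<close>
  ultimately have "column_has n g k m = 0"
    and "Suc (d k + letters n g k m) = d (Suc k) + letters n g (Suc k) m"
    using v(3) by linarith+
  then show "Suc (d k + letters n g k m) = d (Suc k) + letters n g (Suc k) m" and "column_lacks k m g"
    using column_has_0_imp_column_lacks [OF g] v by simp_all
qed

text \<open>The violation by 1 is compensated by n - k against n - (k + 1): with d and \<rho>
  included, the parts of the exponents right of the cut agree at k and k + 1. Left of it the toggle
  exchanges the two counts, so altogether the exponents at k and k + 1 are swapped.\<close>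

lemma sum_not_yamanouchi:
  "(\<Sum>g | g \<in> gt_patterns n lam \<and> \<not> yamanouchi n d g. alternant n (\<lambda>i. d i + (n - i) + letters n g i 0)) = 0"
proof (rule sum_alternant_eq_0)
  let ?B = "{g. g \<in> gt_patterns n lam \<and> \<not> yamanouchi n d g}"
  let ?\<tau> = "\<lambda>g. toggle (first_letter n d g) (last_column n d g) g"
  have props: "?\<tau> g \<in> ?B \<and> ?\<tau> (?\<tau> g) = g" if g: "g \<in> ?B" for g
  proof -
    define m k where "m = last_column n d g" and "k = first_letter n d g"
    have gG: "g \<in> gt_patterns n lam" and bad: "\<not> yamanouchi n d g"
      using g by simp_all
    have v: "violates n d g m k"
      using violates_first_letter [OF gG bad] by (simp add: m_def k_def)
    then have k: "1 \<le> k" "k < n"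
      by (simp_all add: violates_def)
    have clr: "column_lacks k m g"
      using violates_tight [OF gG bad] by (simp add: m_def k_def)
    let ?h = "toggle k m g"
    have hG: "?h \<in> gt_patterns n lam"
      by (rule toggle_in_GT [OF gG k clr])
    \<comment> \<open>Violations at all cuts from m on are the same for the toggled pattern, so it
      selects the same m and k.\<close>
    have viol: "violates n d ?h m' j = violates n d g m' j" if "m \<le> m'" for m' j
      using letters_toggle [OF gG k clr that] by (simp add: violates_def)
    have badh: "\<not> yamanouchi n d ?h"
      using viol [of m k] v unfolding yamanouchi_iff by blast
    have last: "last_column n d ?h = m"
    proof (rule antisym)
      show "last_column n d ?h \<le> m"
      proof (rule ccontr)
        assume lt: "\<not> last_column n d ?h \<le> m"
        then have "violates n d g (last_column n d ?h) (first_letter n d ?h)"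
          using violates_first_letter [OF hG badh] viol by simp
        with lt show False
          using not_violates_after [OF gG] by (simp add: m_def)
      qed
      show "m \<le> last_column n d ?h"
        using not_violates_after [OF hG, of m k] viol [of m k] v by (simp add: not_less [symmetric]) blast
    qed
    have "first_letter n d ?h = (LEAST j. violates n d g m j)"
      unfolding first_letter_def last by (rule arg_cong [of _ _ Least], rule ext) (rule viol [OF order_refl])
    then have "first_letter n d ?h = k"
      by (simp only: k_def m_def first_letter_def)
    with last show ?thesis
      using hG badh toggle_toggle [OF gG k clr] unfolding m_def k_def by simp
  qed
  show "bij_betw ?\<tau> ?B ?B"
    by (rule bij_betw_byWitness [where f' = ?\<tau>]) (use props in blast)+
  fix g assume g: "g \<in> ?B"
  define m k where "m = last_column n d g" and "k = first_letter n d g"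
  have gG: "g \<in> gt_patterns n lam" and bad: "\<not> yamanouchi n d g"
    using g by simp_all
  have k: "1 \<le> k" "k < n"
    using violates_first_letter [OF gG bad] by (simp_all add: violates_def k_def)
  have clr: "column_lacks k m g" and tight: "Suc (d k + letters n g k m) = d (Suc k) + letters n g (Suc k) m"
    using violates_tight [OF gG bad] by (simp_all add: m_def k_def)
  let ?f = "\<lambda>g i. d i + (n - i) + letters n g i 0"
  have "?f (toggle k m g) l = ?f g (Transposition.transpose k (Suc k) l)" if l: "l \<in> {1..n}" for l
  proof -
    let ?t = "Transposition.transpose k (Suc k)"
    consider "l = k" "?t l = Suc k" | "l = Suc k" "?t l = k" | "l \<noteq> k" "l \<noteq> Suc k" "?t l = l"
      by (metis transpose_apply_first transpose_apply_second transpose_apply_other)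
    then show ?thesis
    proof cases
      case 1
      then show ?thesis
        using toggle_letters(1) [OF gG k clr] tight k unfolding 1(2) unfolding 1(1) by linarith
    next
      case 2
      then show ?thesis
        using toggle_letters(2) [OF gG k clr] tight k unfolding 2(2) unfolding 2(1) by linarith
    next
      case 3
      then show ?thesis
        using toggle_letters_other [OF gG k clr, of l 0] l by simp
    qed
  qed
  then show "\<exists>i\<in>{1..n}. \<exists>j\<in>{1..n}. i \<noteq> j \<and>
      (\<forall>l\<in>{1..n}. ?f (?\<tau> g) l = ?f g (Transposition.transpose i j l))"
    using k by (intro bexI [of _ k] bexI [of _ "Suc k"]) (simp_all add: m_def k_def)
qed

lemma alternant_mult_gt_poly:
  "alternant n (\<lambda>i. d i + (n - i)) * gt_poly n lam =
    (\<Sum>g | g \<in> gt_patterns n lam \<and> yamanouchi n d g. alternant n (\<lambda>i. d i + (n - i) + letters n g i 0))"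
proof -
  let ?a = "\<lambda>g. alternant n (\<lambda>i. d i + (n - i) + letters n g i 0)"
  interpret symmetric_family n "gt_patterns n lam" "\<lambda>g i. letters n g i 0"
    by (rule symmetric_family_GT)
  have "alternant n (\<lambda>i. d i + (n - i)) * gt_poly n lam = sum ?a (gt_patterns n lam)"
    unfolding gt_poly_def by (rule alternant_mult)
  also have "gt_patterns n lam = {g. g \<in> gt_patterns n lam \<and> yamanouchi n d g} \<union> {g. g \<in> gt_patterns n lam \<and> \<not> yamanouchi n d g}"
    by blast
  also have "sum ?a \<dots> = sum ?a {g. g \<in> gt_patterns n lam \<and> yamanouchi n d g} + sum ?a {g. g \<in> gt_patterns n lam \<and> \<not> yamanouchi n d g}"
    by (rule sum.union_disjoint) (auto simp: finite_GT)
  finally show ?thesis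
    by (simp add: sum_not_yamanouchi)
qed

end

section \<open>Bialternant formula and the product rule in n variables\<close>

lemma partitions_antimono: "lam \<in> partitions \<Longrightarrow> 1 \<le> i \<Longrightarrow> i \<le> j \<Longrightarrow> lookup lam j \<le> lookup lam i"
proof -
  assume lam: "lam \<in> partitions" and i: "1 \<le> i" "i \<le> j"
  show ?thesis
    using i(2)
  proof (induction j rule: dec_induct)
    case (step m)
    then have "lookup lam (Suc m) \<le> lookup lam m"
      using lam i by (simp add: partitions_def)
    with step show ?case by simp
  qed simp
qed

text \<open>Pattern of the tableau whose row r is filled with r, with the sentinel row 0.\<close>

definition superstandard :: "(nat \<Rightarrow>\<^sub>0 nat) \<Rightarrow> nat \<Rightarrow> nat \<Rightarrow> nat" where
  "superstandard lam k r = (if r = 0 then lookup lam 1 else if r \<le> k then lookup lam r else 0)"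

text \<open>Strong induction on the row, rows above r being filled with their own index. If the last
  entry x of row r exceeded r, then in the columns from the end of row r on, x would occur once and
  x - 1 not at all.\<close>

lemma yamanouchi_0_imp_superstandard:
  assumes g: "g \<in> gt_patterns n lam" and yam: "yamanouchi n (\<lambda>_. 0) g"
  shows "g = superstandard lam"
proof -
  have full: "g k r = lookup lam r" if "1 \<le> r" "r \<le> k" for r k
    using that
  proof (induction r arbitrary: k rule: less_induct)
    case (less r)
    have top: "g (n + r) r = lookup lam r"
      using GT_top [OF g, of "n + r" r] less.prems by simp
    \<comment> \<open>The first level from r on at which row r is complete: its last entry, unless
      the row is empty.\<close>
    define x where "x = (LEAST x. r \<le> x \<and> g x r = lookup lam r)"
    have "r \<le> n + r \<and> g (n + r) r = lookup lam r"
      using top by simp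
    then have x: "r \<le> x" "g x r = lookup lam r"
      unfolding x_def using LeastI [of "\<lambda>x. r \<le> x \<and> g x r = lookup lam r"] by blast+
    have "x = r"
    proof (rule ccontr)
      assume "x \<noteq> r"
      then have x1: "r \<le> x - 1" "1 \<le> x - 1" "Suc (x - 1) = x"
        using x less.prems by simp_all
      have "\<not> (r \<le> x - 1 \<and> g (x - 1) r = lookup lam r)"
        unfolding x_def by (rule not_less_Least) (use x1 in \<open>simp add: x_def [symmetric]\<close>)
      moreover have "g (x - 1) r \<le> lookup lam r"
        using GT_up [OF g, of "x - 1" r] x x1 by simp
      ultimately have lt: "g (x - 1) r < lookup lam r"
        using x1 by simp
      \<comment> \<open>The columns beyond this m start with the last column of row r.\<close>
      define m where "m = lookup lam r - 1"
      have m: "g (x - 1) r \<le> m" "lookup lam r = Suc m"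
        using lt by (simp_all add: m_def)
      have xn: "x \<le> n"
      proof (rule ccontr)
        assume "\<not> x \<le> n"
        then have "g (x - 1) r = lookup lam r"
          using GT_top [OF g, of "x - 1" r] less.prems by simp
        with lt show False by simp
      qed
      \<comment> \<open>Since r' < r \<le> x - 1, row r' is complete already at level x - 2.\<close>
      have above: "g j r' = lookup lam r'" if "1 \<le> r'" "r' < r" "j \<in> {x, x - 1, x - 1 - 1}" for j r'
        using less.IH [of r' j] that x1 by auto
      have below: "g j r' \<le> m" if "r < r'" "j \<in> {x, x - 1, x - 1 - 1}" for j r'
      proof -
        have "g j r' \<le> g x r'"
          using that by (intro GT_level_mono [OF g]) auto
        also have "\<dots> \<le> g x (Suc r)"
          using that by (intro GT_antimono [OF g]) simp
        also have "\<dots> \<le> g (x - 1) r"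
          using GT_diag [OF g, of "x - 1" r] x1 by simp
        finally show ?thesis using m by simp
      qed
      have "(g x r' - m) - (g (x - 1) r' - m) = (if r' = r then 1 else 0)" if "r' \<in> {1..n}" for r'
        using that above [of r' x] above [of r' "x - 1"] below [of r' x] x(2) m
        by (cases r' r rule: linorder_cases) auto
      then have "letters n g x m = 1"
        using less.prems x(1) xn by (simp add: letters_def)
      moreover have "(g (x - 1) r' - m) - (g (x - 1 - 1) r' - m) = 0" if "r' \<in> {1..n}" for r'
        using that above [of r' "x - 1 - 1"] above [of r' "x - 1"] below [of r' "x - 1"] m
        by (cases r' r rule: linorder_cases) auto
      then have "letters n g (x - 1) m = 0"
        by (simp add: letters_def)
      moreover have "letters n g x m \<le> letters n g (x - 1) m"
        using yam x1 xn unfolding yamanouchi_def by (metis add_0 Suc_le_lessD)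
      ultimately show False by simp
    qed
    then have "g r r = lookup lam r" using x by simp
    moreover have "g r r \<le> g k r" "g k r \<le> g (n + k) r"
      using less.prems by (auto intro: GT_level_mono [OF g])
    moreover have "g (n + k) r = lookup lam r"
      using GT_top [OF g, of "n + k" r] less.prems by simp
    ultimately show ?case by simp
  qed
  show ?thesis
    using full GT_zero [OF g] GT_row0 [OF g] by (auto simp: superstandard_def fun_eq_iff not_le)
qed

context
  fixes n :: nat and lam :: "nat \<Rightarrow>\<^sub>0 nat"
  assumes lam: "lam \<in> partitions" and n: "keys lam \<subseteq> {..n}"
begin

lemma lookup_beyond: "n < r \<Longrightarrow> lookup lam r = 0"
  using n by (metis atMost_iff in_keys_iff leD subsetD)

lemma superstandard_in_GT: "superstandard lam \<in> gt_patterns n lam"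
  using partitions_antimono [OF lam] lookup_beyond
  by (auto simp: gt_patterns_def superstandard_def Suc_le_eq)

lemma letters_superstandard: "i \<in> {1..n} \<Longrightarrow> letters n (superstandard lam) i m = lookup lam i - m"
proof -
  assume i: "i \<in> {1..n}"
  then have "letters n (superstandard lam) i m = (\<Sum>r = 1..n. if r = i then lookup lam i - m else 0)"
    unfolding letters_def by (intro sum.cong) (auto simp: superstandard_def)
  then show ?thesis
    using i by simp
qed

text \<open>For d = 0 the cancellation leaves a single tableau, the superstandard one, and its
  content is the shape.\<close>

lemma alternant_mult_gt_poly_0:
  "alternant n (\<lambda>i. n - i) * gt_poly n lam = alternant n (\<lambda>i. lookup lam i + (n - i))"
proof -
  have "yamanouchi n (\<lambda>_. 0) (superstandard lam)"
    unfolding yamanouchi_def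
    using letters_superstandard partitions_antimono [OF lam] by (auto intro: diff_le_mono)
  then have "{g. g \<in> gt_patterns n lam \<and> yamanouchi n (\<lambda>_. 0) g} = {superstandard lam}"
    using yamanouchi_0_imp_superstandard superstandard_in_GT by blast
  then have "alternant n (\<lambda>i. n - i) * gt_poly n lam =
      alternant n (\<lambda>i. n - i + letters n (superstandard lam) i 0)"
    using alternant_mult_gt_poly [of n "\<lambda>_. 0" lam] by simp
  also have "\<dots> = alternant n (\<lambda>i. lookup lam i + (n - i))"
    by (rule alternant_cong) (simp add: letters_superstandard)
  finally show ?thesis .
qed

end

lemma alternant_rho_nonzero: "alternant n (\<lambda>i. n - i) \<noteq> 0"
proof -
  have "lookup (alternant n (\<lambda>i. n - i)) (exp_vec n (\<lambda>i. n - i)) = 1"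
    by (subst lookup_alternant_strict) auto
  then show ?thesis by auto
qed

theorem gt_poly_mult:
  assumes dl: "dl \<in> partitions" "keys dl \<subseteq> {..n}"
  shows "gt_poly n lam * gt_poly n dl =
    (\<Sum>g | g \<in> gt_patterns n lam \<and> yamanouchi n (lookup dl) g.
      gt_poly n (exp_vec n (\<lambda>i. lookup dl i + letters n g i 0)))"
proof -
  let ?Y = "{g. g \<in> gt_patterns n lam \<and> yamanouchi n (lookup dl) g}"
  let ?nu = "\<lambda>g. exp_vec n (\<lambda>i. lookup dl i + letters n g i 0)"
  let ?a = "alternant n (\<lambda>i. n - i)"
  have "?a * gt_poly n (?nu g) = alternant n (\<lambda>i. lookup dl i + (n - i) + letters n g i 0)"
    if g: "g \<in> ?Y" for g
  proof -
    \<comment> \<open>The lattice condition at m = 0 makes the exponent a partition, so that the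
      bialternant formula applies to it.\<close>
    have "lookup dl (Suc i) + letters n g (Suc i) 0 \<le> lookup dl i + letters n g i 0" if "1 \<le> i" "i < n" for i
      using g that by (simp add: yamanouchi_def)
    then have "?nu g \<in> partitions" "keys (?nu g) \<subseteq> {..n}"
      by (auto simp: partitions_def lookup_exp_vec in_keys_iff split: if_splits)
    then have "?a * gt_poly n (?nu g) = alternant n (\<lambda>i. lookup (?nu g) i + (n - i))"
      by (rule alternant_mult_gt_poly_0)
    also have "\<dots> = alternant n (\<lambda>i. lookup dl i + (n - i) + letters n g i 0)"
      by (rule alternant_cong) (simp add: lookup_exp_vec)
    finally show ?thesis .
  qed
  then have "?a * (\<Sum>g\<in>?Y. gt_poly n (?nu g)) =
      (\<Sum>g\<in>?Y. alternant n (\<lambda>i. lookup dl i + (n - i) + letters n g i 0))"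
    unfolding sum_distrib_left by (intro sum.cong) auto
  also have "\<dots> = alternant n (\<lambda>i. lookup dl i + (n - i)) * gt_poly n lam"
    using dl by (subst alternant_mult_gt_poly) (auto simp: partitions_def)
  also have "\<dots> = ?a * (gt_poly n lam * gt_poly n dl)"
    by (simp add: alternant_mult_gt_poly_0 [OF dl, symmetric] mult_ac)
  \<comment> \<open>The denominator cancels because \<open>int_mpoly\<close> has no zero
    divisors.\<close>
  finally show ?thesis
    using alternant_rho_nonzero [of n] by simp
qed

section \<open>Tableaux and patterns\<close>

lemma finite_diagram: "finite (diagram lam)"
proof -
  have "diagram lam \<subseteq> (SIGMA r:keys lam. {..lookup lam r})"
    by (auto simp: diagram_def in_keys_iff)
  then show ?thesis
    by (rule finite_subset) simp
qed

lemma diagram_left: "(r, c) \<in> diagram lam \<Longrightarrow> 1 \<le> c' \<Longrightarrow> c' \<le> c \<Longrightarrow> (r, c') \<in> diagram lam"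
  by (auto simp: diagram_def)

lemma diagram_up: "lam \<in> partitions \<Longrightarrow> (r, c) \<in> diagram lam \<Longrightarrow> 1 \<le> r' \<Longrightarrow> r' \<le> r \<Longrightarrow> (r', c) \<in> diagram lam"
  using partitions_antimono [of lam r' r] by (auto simp: diagram_def)

lemma SSYT_pos: "b \<in> SSYT lam \<Longrightarrow> (r, c) \<in> diagram lam \<Longrightarrow> 1 \<le> b r c"
  and SSYT_outside: "b \<in> SSYT lam \<Longrightarrow> (r, c) \<notin> diagram lam \<Longrightarrow> b r c = 0"
  and SSYT_row: "b \<in> SSYT lam \<Longrightarrow> (r, Suc c) \<in> diagram lam \<Longrightarrow> (r, c) \<in> diagram lam \<Longrightarrow> b r c \<le> b r (Suc c)"
  and SSYT_col: "b \<in> SSYT lam \<Longrightarrow> (r, c) \<in> diagram lam \<Longrightarrow> (Suc r, c) \<in> diagram lam \<Longrightarrow> b r c < b (Suc r) c"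
  by (auto simp: SSYT_def)

lemma SSYT_row_mono:
  assumes b: "b \<in> SSYT lam" and c': "(r, c') \<in> diagram lam" and c: "1 \<le> c" "c \<le> c'"
  shows "b r c \<le> b r c'"
  using c(2) c'
proof (induction c' rule: dec_induct)
  case (step m)
  then have "(r, m) \<in> diagram lam"
    using c diagram_left [of r "Suc m" lam m] by simp
  then show ?case
    using step SSYT_row [OF b, of r m] by simp
qed simp

lemma SSYT_col_strict_mono:
  assumes lam: "lam \<in> partitions" and b: "b \<in> SSYT lam"
    and r': "(r', c) \<in> diagram lam" and r: "1 \<le> r" "r < r'"
  shows "b r c < b r' c"
proof -
  from r(2) have "Suc r \<le> r'" by simp
  then show ?thesis
    using r'
  proof (induction r' rule: dec_induct)
    case base
    then show ?case
      using diagram_up [OF lam, of "Suc r" c r] SSYT_col [OF b] r by simp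
  next
    case (step m)
    then have "(m, c) \<in> diagram lam"
      using r diagram_up [OF lam, of "Suc m" c m] by simp
    then show ?case
      using step SSYT_col [OF b, of m c] by simp
  qed
qed

lemma down_closed_eq_interval:
  fixes S :: "nat set"
  assumes "finite S" "0 \<notin> S" and down: "\<And>c c'. c' \<in> S \<Longrightarrow> 1 \<le> c \<Longrightarrow> c \<le> c' \<Longrightarrow> c \<in> S"
  shows "S = {1..card S}"
proof (cases "S = {}")
  case False
  have "S = {1..Max S}"
  proof (intro equalityI subsetI)
    fix x assume "x \<in> S"
    then show "x \<in> {1..Max S}"
      using assms by (cases x) auto
  next
    fix x assume "x \<in> {1..Max S}"
    then show "x \<in> S"
      using down [of "Max S" x] Max_in [OF assms(1) False] by simp
  qed
  then show ?thesis
    by (metis card_atLeastAtMost diff_Suc_1)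
qed simp

definition gt_of :: "(nat \<Rightarrow>\<^sub>0 nat) \<Rightarrow> (nat \<Rightarrow> nat \<Rightarrow> nat) \<Rightarrow> nat \<Rightarrow> nat \<Rightarrow> nat" where
  "gt_of lam b k r = (if r = 0 then lookup lam 1 else card {c. (r, c) \<in> diagram lam \<and> b r c \<le> k})"

definition tableaux :: "nat \<Rightarrow> (nat \<Rightarrow>\<^sub>0 nat) \<Rightarrow> (nat \<Rightarrow> nat \<Rightarrow> nat) set" where
  "tableaux n lam = {b \<in> SSYT lam. \<forall>r c. b r c \<le> n}"

lemma gt_of_row:
  assumes "b \<in> SSYT lam" "1 \<le> r"
  shows "{c. (r, c) \<in> diagram lam \<and> b r c \<le> k} = {1..gt_of lam b k r}"
proof -
  let ?S = "{c. (r, c) \<in> diagram lam \<and> b r c \<le> k}"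
  have "?S = {1..card ?S}"
  proof (rule down_closed_eq_interval)
    show "finite ?S"
      by (rule finite_subset [of _ "{..lookup lam r}"]) (auto simp: diagram_def)
    show "0 \<notin> ?S"
      by (simp add: diagram_def)
    show "c \<in> ?S" if "c' \<in> ?S" "1 \<le> c" "c \<le> c'" for c c'
      using that diagram_left [of r c' lam c] SSYT_row_mono [OF assms(1), of r c' c] by simp
  qed
  then show ?thesis
    using assms(2) by (simp add: gt_of_def)
qed

lemma gt_of_le_iff:
  assumes "b \<in> SSYT lam" "(r, c) \<in> diagram lam"
  shows "b r c \<le> k \<longleftrightarrow> c \<le> gt_of lam b k r"
proof -
  have "1 \<le> r" "1 \<le> c"
    using assms(2) by (simp_all add: diagram_def)
  then show ?thesis
    using gt_of_row [OF assms(1), of r k] assms(2) by (simp add: set_eq_iff) metis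
qed

lemma gt_of_le: "1 \<le> r \<Longrightarrow> b \<in> SSYT lam \<Longrightarrow> gt_of lam b k r \<le> lookup lam r"
proof -
  assume r: "1 \<le> r" and b: "b \<in> SSYT lam"
  have "{1..gt_of lam b k r} \<subseteq> {1..lookup lam r}"
    unfolding gt_of_row [OF b r, symmetric] by (auto simp: diagram_def)
  then show ?thesis
    by (simp add: atLeastatMost_subset_iff) linarith
qed

lemma gt_of_in_GT:
  assumes lam: "lam \<in> partitions" and b: "b \<in> tableaux n lam"
  shows "gt_of lam b \<in> gt_patterns n lam"
proof -
  have B: "b \<in> SSYT lam" and le_n: "b r c \<le> n" for r c
    using b by (auto simp: tableaux_def)
  have level0: "gt_of lam b 0 r = 0" if "1 \<le> r" for r
  proof -
    have "{c. (r, c) \<in> diagram lam \<and> b r c \<le> 0} = {}"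
      using SSYT_pos [OF B, of r] by fastforce
    then have "card {c. (r, c) \<in> diagram lam \<and> b r c \<le> 0} = 0"
      by (simp only: card.empty)
    then show ?thesis
      using that by (simp add: gt_of_def)
  qed
  have up: "gt_of lam b k r \<le> gt_of lam b (Suc k) r" for k r
  proof (cases "r = 0")
    case False
    then have "{1..gt_of lam b k r} \<subseteq> {1..gt_of lam b (Suc k) r}"
      using gt_of_row [OF B, of r, symmetric] by auto
    then show ?thesis
      by (simp add: atLeastatMost_subset_iff) linarith
  qed (simp add: gt_of_def)
  have diag: "gt_of lam b (Suc k) (Suc r) \<le> gt_of lam b k r" for k r
  proof (cases "r = 0 \<or> gt_of lam b (Suc k) (Suc r) = 0")
    case True
    then show ?thesis
      using gt_of_le [OF _ B, of 1] by (auto simp: gt_of_def [of _ _ _ 0])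
  next
    case False
    \<comment> \<open>The last column of row r + 1 with an entry at most k + 1; by column strictness
      the entry above is at most k.\<close>
    define c where "c = gt_of lam b (Suc k) (Suc r)"
    have "c \<in> {c. (Suc r, c) \<in> diagram lam \<and> b (Suc r) c \<le> Suc k}"
      by (subst gt_of_row [OF B]) (use False in \<open>simp_all add: c_def\<close>)
    then have c: "(Suc r, c) \<in> diagram lam" "b (Suc r) c \<le> Suc k"
      by simp_all
    then have "(r, c) \<in> diagram lam"
      using diagram_up [OF lam, of "Suc r" c r] False by simp
    moreover from this have "b r c \<le> k"
      using SSYT_col [OF B, of r c] c by simp
    ultimately have "c \<le> gt_of lam b k r"
      using gt_of_le_iff [OF B, of r c k] by blast
    then show ?thesis by (simp only: c_def)
  qed
  have top: "gt_of lam b k r = lookup lam r" if "n \<le> k" "1 \<le> r" for k r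
  proof -
    have "{c. (r, c) \<in> diagram lam \<and> b r c \<le> k} = {1..lookup lam r}"
      using order_trans [OF le_n that(1)] that(2) by (auto simp: diagram_def)
    then show ?thesis
      using that by (simp add: gt_of_def)
  qed
  have row0: "gt_of lam b k 0 = lookup lam 1" for k
    by (simp add: gt_of_def)
  show ?thesis
    unfolding gt_patterns_def using level0 up diag top row0 by blast
qed

definition tab_of :: "(nat \<Rightarrow>\<^sub>0 nat) \<Rightarrow> (nat \<Rightarrow> nat \<Rightarrow> nat) \<Rightarrow> nat \<Rightarrow> nat \<Rightarrow> nat" where
  "tab_of lam g r c = (if (r, c) \<in> diagram lam then LEAST k. c \<le> g k r else 0)"

text \<open>Counterpart of \<open>gt_of_le_iff\<close>. An entry is determined by the k that bound
  it, so the two equivalences make \<open>gt_of\<close> and \<open>tab_of\<close> inverse to each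
  other.\<close>

lemma tab_of_le_iff:
  assumes g: "g \<in> gt_patterns n lam" and rc: "(r, c) \<in> diagram lam"
  shows "tab_of lam g r c \<le> k \<longleftrightarrow> c \<le> g k r"
proof -
  have "c \<le> g n r"
    using GT_top [OF g, of n r] rc by (simp add: diagram_def)
  then have least: "c \<le> g (tab_of lam g r c) r"
    unfolding tab_of_def using rc by (simp, intro LeastI [of "\<lambda>k. c \<le> g k r"])
  show ?thesis
  proof
    assume "tab_of lam g r c \<le> k"
    then show "c \<le> g k r"
      using GT_level_mono [OF g] least order_trans by blast
  next
    assume "c \<le> g k r"
    then show "tab_of lam g r c \<le> k"
      unfolding tab_of_def using rc by (simp add: Least_le)
  qed
qed

lemma tab_of_in_tableaux:
  assumes g: "g \<in> gt_patterns n lam"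
  shows "tab_of lam g \<in> tableaux n lam"
proof -
  let ?b = "tab_of lam g"
  note iff = tab_of_le_iff [OF g]
  have pos: "1 \<le> ?b r c" if "(r, c) \<in> diagram lam" for r c
  proof (rule ccontr)
    assume "\<not> 1 \<le> ?b r c"
    then have "c \<le> g 0 r"
      using iff [OF that, of 0] by simp
    then show False
      using that GT_level0 [OF g, of r] by (simp add: diagram_def)
  qed
  have row: "?b r c \<le> ?b r (Suc c)" if "(r, c) \<in> diagram lam" "(r, Suc c) \<in> diagram lam" for r c
    using iff [OF that(1)] iff [OF that(2), of "?b r (Suc c)"] by simp
  have col: "?b r c < ?b (Suc r) c" if "(r, c) \<in> diagram lam" "(Suc r, c) \<in> diagram lam" for r c
  proof -
    note cells = that
    obtain k where k: "?b (Suc r) c = Suc k"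
      using pos [OF cells(2)] by (cases "?b (Suc r) c") auto
    then have "c \<le> g (Suc k) (Suc r)"
      using iff [OF that(2), of "Suc k"] by simp
    then have "c \<le> g k r"
      using GT_diag [OF g, of k r] by simp
    then show ?thesis
      using iff [OF that(1), of k] k by simp
  qed
  have le_n: "?b r c \<le> n" for r c
  proof (cases "(r, c) \<in> diagram lam")
    case True
    then show ?thesis
      using iff [OF True] GT_top [OF g, of n r] by (simp add: diagram_def)
  qed (simp add: tab_of_def)
  show ?thesis
    unfolding tableaux_def SSYT_def using pos row col le_n by (auto simp: tab_of_def [of _ _ _ _])
qed

lemma bij_gt_of:
  assumes lam: "lam \<in> partitions"
  shows "bij_betw (gt_of lam) (tableaux n lam) (gt_patterns n lam)"
proof (rule bij_betw_byWitness [where f' = "tab_of lam"])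
  show "gt_of lam ` tableaux n lam \<subseteq> gt_patterns n lam"
    using gt_of_in_GT [OF lam] by blast
  show "tab_of lam ` gt_patterns n lam \<subseteq> tableaux n lam"
    using tab_of_in_tableaux by blast
  show "\<forall>b\<in>tableaux n lam. tab_of lam (gt_of lam b) = b"
  proof (intro ballI ext)
    fix b r c assume b: "b \<in> tableaux n lam"
    then have B: "b \<in> SSYT lam"
      by (simp add: tableaux_def)
    show "tab_of lam (gt_of lam b) r c = b r c"
    proof (cases "(r, c) \<in> diagram lam")
      case True
      then have "tab_of lam (gt_of lam b) r c \<le> k \<longleftrightarrow> b r c \<le> k" for k
        using tab_of_le_iff [OF gt_of_in_GT [OF lam b]] gt_of_le_iff [OF B] by simp
      then show ?thesis
        by (meson antisym order_refl)
    qed (simp add: tab_of_def SSYT_outside [OF B])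
  qed
  show "\<forall>g\<in>gt_patterns n lam. gt_of lam (tab_of lam g) = g"
  proof (intro ballI ext)
    fix g k r assume g: "g \<in> gt_patterns n lam"
    show "gt_of lam (tab_of lam g) k r = g k r"
    proof (cases "r = 0")
      case False
      have "g k r \<le> g (n + k) r"
        by (intro GT_level_mono [OF g]) simp
      also have "\<dots> = lookup lam r"
        using GT_top [OF g, of "n + k" r] False by simp
      finally have le: "g k r \<le> lookup lam r" .
      have "{c. (r, c) \<in> diagram lam \<and> tab_of lam g r c \<le> k} = {c. (r, c) \<in> diagram lam \<and> c \<le> g k r}"
        using tab_of_le_iff [OF g, of r] by blast
      also have "\<dots> = {1..g k r}"
        using le False by (auto simp: diagram_def)
      finally show ?thesis
        using False by (simp add: gt_of_def)
    qed (simp add: gt_of_def GT_row0 [OF g])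
  qed
qed

lemma finite_tableaux: "lam \<in> partitions \<Longrightarrow> finite (tableaux n lam)"
  using bij_gt_of [of lam n] finite_GT bij_betw_finite by blast

section \<open>Letter counts and coefficients of Schur functions\<close>

definition letter_count :: "(nat \<Rightarrow>\<^sub>0 nat) \<Rightarrow> (nat \<Rightarrow> nat \<Rightarrow> nat) \<Rightarrow> nat \<Rightarrow> nat \<Rightarrow> nat" where
  "letter_count lam b k m = card {(r, c) \<in> diagram lam. m < c \<and> b r c = k}"

text \<open>In row r the letter k occupies the columns after g (k - 1) r up to g k r, where g is the
  pattern of b; the cut at m only raises the lower end.\<close>

lemma letters_gt_of:
  assumes lam: "lam \<in> partitions" and b: "b \<in> tableaux n lam" and k: "1 \<le> k"
  shows "letters n (gt_of lam b) k m = letter_count lam b k m"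
proof -
  let ?g = "gt_of lam b"
  have B: "b \<in> SSYT lam"
    using b by (simp add: tableaux_def)
  have G: "?g \<in> gt_patterns n lam"
    by (rule gt_of_in_GT [OF lam b])
  have cell: "(r, c) \<in> diagram lam \<and> m < c \<and> b r c = k \<longleftrightarrow> r \<in> {1..n} \<and> c \<in> {max m (?g (k - 1) r)<..?g k r}"
    for r c
  proof (cases "(r, c) \<in> diagram lam")
    case True
    then have "b r c = k \<longleftrightarrow> c \<le> ?g k r \<and> ?g (k - 1) r < c"
      using gt_of_le_iff [OF B True, of k] gt_of_le_iff [OF B True, of "k - 1"] k by linarith
    moreover have "r \<le> n"
      using GT_lam_zero [OF G, of r] True by (cases "r \<le> n") (auto simp: diagram_def)
    ultimately show ?thesis
      using True by (auto simp: diagram_def)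
  next
    case False
    then have "\<not> (r \<in> {1..n} \<and> c \<in> {max m (?g (k - 1) r)<..?g k r})"
      using gt_of_le [OF _ B, of r k] by (auto simp: diagram_def)
    with False show ?thesis by simp
  qed
  have "{(r, c) \<in> diagram lam. m < c \<and> b r c = k} = Sigma {1..n} (\<lambda>r. {max m (?g (k - 1) r)<..?g k r})"
    using cell by auto
  then have "letter_count lam b k m = (\<Sum>r = 1..n. ?g k r - max m (?g (k - 1) r))"
    by (simp add: letter_count_def)
  also have "\<dots> = letters n ?g k m"
    unfolding letters_def by (intro sum.cong) auto
  finally show ?thesis ..
qed

lemma lookup_content: "lookup (content lam b) k = letter_count lam b k 0"
proof -
  have "lookup (content lam b) k = (\<Sum>(r, c)\<in>diagram lam. if b r c = k then 1 else 0)"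
    by (simp add: content_def lookup_sum split_beta lookup_single when_def del: One_nat_def)
  also have "\<dots> = card {(r, c) \<in> diagram lam. b r c = k}"
    by (simp add: finite_diagram split_beta sum.If_cases Int_def) (simp add: case_prod_unfold)
  also have "{(r, c) \<in> diagram lam. b r c = k} = {(r, c) \<in> diagram lam. 0 < c \<and> b r c = k}"
    by (auto simp: diagram_def)
  finally show ?thesis
    by (simp add: letter_count_def)
qed

lemma letter_count_eq_0_iff: "letter_count lam b k m = 0 \<longleftrightarrow> (\<forall>(r, c)\<in>diagram lam. m < c \<longrightarrow> b r c \<noteq> k)"
proof -
  have "finite {(r, c) \<in> diagram lam. m < c \<and> b r c = k}"
    by (rule finite_subset [OF _ finite_diagram]) auto
  then show ?thesis
    by (auto simp: letter_count_def)
qed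

lemma content_0: "b \<in> SSYT lam \<Longrightarrow> lookup (content lam b) 0 = 0"
  using SSYT_pos by (fastforce simp: lookup_content letter_count_eq_0_iff)

lemma content_beyond: "b \<in> tableaux n lam \<Longrightarrow> n < k \<Longrightarrow> letter_count lam b k m = 0"
proof -
  assume "b \<in> tableaux n lam" and k: "n < k"
  then have "b r c \<le> n" for r c
    by (simp add: tableaux_def)
  with k have "b r c \<noteq> k" for r c
    by (metis not_le)
  then show ?thesis
    by (simp add: letter_count_eq_0_iff)
qed

lemma tableaux_if_keys_content:
  assumes "b \<in> SSYT lam" "keys (content lam b) \<subseteq> {..n}"
  shows "b \<in> tableaux n lam"
proof -
  have "b r c \<le> n" for r c
  proof (cases "(r, c) \<in> diagram lam")
    case True
    then have "lookup (content lam b) (b r c) \<noteq> 0"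
      by (auto simp: lookup_content letter_count_eq_0_iff diagram_def)
    then have "b r c \<in> keys (content lam b)"
      by (simp add: in_keys_iff)
    with assms(2) show ?thesis
      by auto
  qed (simp add: SSYT_outside [OF assms(1)])
  with assms(1) show ?thesis
    by (simp add: tableaux_def)
qed

lemma keys_content: "b \<in> tableaux n lam \<Longrightarrow> keys (content lam b) \<subseteq> {..n}"
proof
  fix k assume b: "b \<in> tableaux n lam" and "k \<in> keys (content lam b)"
  then have "letter_count lam b k 0 \<noteq> 0"
    by (simp add: in_keys_iff lookup_content)
  then show "k \<in> {..n}"
    using content_beyond [OF b, of k 0] by (cases "n < k") simp_all
qed

lemma exp_vec_letters:
  assumes lam: "lam \<in> partitions" and b: "b \<in> tableaux n lam" and dl: "dl \<in> partitions" "keys dl \<subseteq> {..n}"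
  shows "exp_vec n (\<lambda>i. lookup dl i + letters n (gt_of lam b) i 0) = dl + content lam b"
proof (rule poly_mapping_eqI)
  fix i
  have B: "b \<in> SSYT lam"
    using b by (simp add: tableaux_def)
  consider "i \<in> {1..n}" | "i = 0" | "n < i"
    by (cases "i = 0"; cases "n < i") auto
  then show "lookup (exp_vec n (\<lambda>i. lookup dl i + letters n (gt_of lam b) i 0)) i = lookup (dl + content lam b) i"
  proof cases
    case 1
    then show ?thesis
      by (simp add: lookup_exp_vec lookup_add lookup_content letters_gt_of [OF lam b])
  next
    case 2
    then show ?thesis
      using dl content_0 [OF B] by (simp add: lookup_exp_vec lookup_add partitions_def)
  next
    case 3
    then have "lookup dl i = 0"
      using dl by (auto simp: in_keys_iff)
    then show ?thesis
      using 3 content_beyond [OF b 3] by (simp add: lookup_exp_vec lookup_add lookup_content)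
  qed
qed

lemma gt_poly_eq_sum:
  assumes lam: "lam \<in> partitions"
  shows "gt_poly n lam = (\<Sum>b\<in>tableaux n lam. Poly_Mapping.single (content lam b) 1)"
proof -
  have "gt_poly n lam = (\<Sum>b\<in>tableaux n lam. xpow n (\<lambda>i. letters n (gt_of lam b) i 0))"
    unfolding gt_poly_def by (rule sum.reindex_bij_betw [OF bij_gt_of [OF lam], symmetric])
  also have "\<dots> = (\<Sum>b\<in>tableaux n lam. Poly_Mapping.single (content lam b) 1)"
    using exp_vec_letters [OF lam, of _ n 0] by (simp add: xpow_def partitions_def)
  finally show ?thesis .
qed

text \<open>A tableau has entries at most n exactly when its content is supported there, so
  restricting the entries amounts to restricting the variables.\<close>

lemma lookup_gt_poly:
  assumes lam: "lam \<in> partitions"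
  shows "lookup (gt_poly n lam) \<alpha> = (if keys \<alpha> \<subseteq> {..n} then mcoeff (schur lam) \<alpha> else 0)"
proof -
  have "lookup (gt_poly n lam) \<alpha> = int (card {b \<in> tableaux n lam. content lam b = \<alpha>})"
    using finite_tableaux [OF lam, of n]
    by (simp add: gt_poly_eq_sum [OF lam] lookup_sum lookup_single when_def sum.If_cases Int_def eq_commute [of \<alpha>])
  also have "\<dots> = (if keys \<alpha> \<subseteq> {..n} then mcoeff (schur lam) \<alpha> else 0)"
  proof (cases "keys \<alpha> \<subseteq> {..n}")
    case True
    then have "{b \<in> tableaux n lam. content lam b = \<alpha>} = {b \<in> SSYT lam. content lam b = \<alpha>}"
      using tableaux_if_keys_content by (auto simp: tableaux_def)
    then show ?thesis
      using True by (simp add: schur_def)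
  next
    case False
    then have "{b \<in> tableaux n lam. content lam b = \<alpha>} = {}"
      using keys_content by blast
    then have "card {b \<in> tableaux n lam. content lam b = \<alpha>} = 0"
      by (simp only: card.empty)
    with False show ?thesis by simp
  qed
  finally show ?thesis .
qed

lemma sum_single_lookup: "(\<Sum>\<alpha>\<in>keys p. Poly_Mapping.single \<alpha> (lookup p \<alpha>)) = p"
  by (rule poly_mapping_eqI) (simp add: lookup_sum lookup_single when_def in_keys_iff)

lemma lookup_times_splits:
  fixes p q :: int_mpoly
  shows "lookup (p * q) \<gamma> = (\<Sum>(\<alpha>, \<beta>)\<in>splits \<gamma>. lookup p \<alpha> * lookup q \<beta>)"
proof -
  let ?K = "keys p \<times> keys q"
  have "p * q = (\<Sum>\<alpha>\<in>keys p. Poly_Mapping.single \<alpha> (lookup p \<alpha>)) * (\<Sum>\<beta>\<in>keys q. Poly_Mapping.single \<beta> (lookup q \<beta>))"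
    by (simp only: sum_single_lookup)
  also have "\<dots> = (\<Sum>(\<alpha>, \<beta>)\<in>?K. Poly_Mapping.single (\<alpha> + \<beta>) (lookup p \<alpha> * lookup q \<beta>))"
    by (simp add: sum_product mult_single sum.cartesian_product)
  finally have "lookup (p * q) \<gamma> = (\<Sum>(\<alpha>, \<beta>)\<in>?K. if \<alpha> + \<beta> = \<gamma> then lookup p \<alpha> * lookup q \<beta> else 0)"
    by (simp add: lookup_sum split_beta lookup_single when_def)
  also have "\<dots> = (\<Sum>(\<alpha>, \<beta>)\<in>?K \<inter> splits \<gamma>. lookup p \<alpha> * lookup q \<beta>)"
    by (simp add: split_beta sum.If_cases Int_def)
  also have "\<dots> = (\<Sum>(\<alpha>, \<beta>)\<in>splits \<gamma>. lookup p \<alpha> * lookup q \<beta>)"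
    by (rule sum.mono_neutral_left) (auto simp: finite_splits in_keys_iff)
  finally show ?thesis .
qed

text \<open>Every factor of a monomial in the variables up to n is again one, so the convolution
  stays within n variables.\<close>

lemma mcoeff_schur_mult:
  assumes "lam \<in> partitions" "dl \<in> partitions" "keys \<alpha> \<subseteq> {..n}"
  shows "mcoeff (schur lam * schur dl) \<alpha> = lookup (gt_poly n lam * gt_poly n dl) \<alpha>"
proof -
  have "keys \<beta> \<subseteq> {..n} \<and> keys \<gamma> \<subseteq> {..n}" if "(\<beta>, \<gamma>) \<in> splits \<alpha>" for \<beta> \<gamma>
  proof -
    have "lookup \<alpha> i = lookup \<beta> i + lookup \<gamma> i" for i
      using that by (auto simp: lookup_add)
    then have "keys \<beta> \<subseteq> keys \<alpha>" "keys \<gamma> \<subseteq> keys \<alpha>"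
      by (auto simp: in_keys_iff)
    with assms(3) show ?thesis by blast
  qed
  then show ?thesis
    unfolding times_mseries_def mcoeff_MSeries lookup_times_splits
    by (intro sum.cong) (auto simp: lookup_gt_poly assms)
qed

section \<open>The Littlewood--Richardson rule\<close>

text \<open>The condition of \<open>yamanouchi\<close> freed from n, on the tableau itself.\<close>

definition lattice_tableaux :: "(nat \<Rightarrow>\<^sub>0 nat) \<Rightarrow> (nat \<Rightarrow>\<^sub>0 nat) \<Rightarrow> (nat \<Rightarrow> nat \<Rightarrow> nat) set" where
  "lattice_tableaux lam dl = {b \<in> SSYT lam. \<forall>m k. 1 \<le> k \<longrightarrow>
     lookup dl (Suc k) + letter_count lam b (Suc k) m \<le> lookup dl k + letter_count lam b k m}"

lemma lattice_add_content_in_partitions: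
  "dl \<in> partitions \<Longrightarrow> b \<in> lattice_tableaux lam dl \<Longrightarrow> dl + content lam b \<in> partitions"
  using content_0 [of b lam]
  by (auto simp: partitions_def lattice_tableaux_def lookup_add lookup_content)

text \<open>\<delta> plus content is a partition, so an entry above l forces every letter from l + 1
  up to it to occur, and there are no more distinct letters than cells.\<close>

lemma lattice_tableaux_bounded:
  assumes dl: "dl \<in> partitions" "keys dl \<subseteq> {..l}" and b: "b \<in> lattice_tableaux lam dl"
  shows "b \<in> tableaux (l + card (diagram lam)) lam"
proof -
  have B: "b \<in> SSYT lam"
    using b by (simp add: lattice_tableaux_def)
  let ?nu = "dl + content lam b"
  have "b r c \<le> l + card (diagram lam)" if rc: "(r, c) \<in> diagram lam" for r c
  proof -
    have "lookup (content lam b) (b r c) \<noteq> 0"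
      using rc by (auto simp: lookup_content letter_count_eq_0_iff diagram_def)
    then have pos: "0 < lookup ?nu (b r c)"
      by (simp add: lookup_add)
    have "k \<in> (\<lambda>(r, c). b r c) ` diagram lam" if k: "k \<in> {Suc l..b r c}" for k
    proof -
      have "lookup ?nu (b r c) \<le> lookup ?nu k"
        using k by (intro partitions_antimono [OF lattice_add_content_in_partitions [OF dl(1) b]]) auto
      moreover have "lookup dl k = 0"
        using k dl(2) by (metis Suc_n_not_le_n atLeastAtMost_iff atMost_iff in_keys_iff order_trans subsetD)
      ultimately have "letter_count lam b k 0 \<noteq> 0"
        using pos unfolding lookup_add lookup_content by linarith
      then obtain r' c' where "(r', c') \<in> diagram lam" "b r' c' = k"
        unfolding letter_count_eq_0_iff by auto
      then show ?thesis
        by force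
    qed
    then have "{Suc l..b r c} \<subseteq> (\<lambda>(r, c). b r c) ` diagram lam"
      by blast
    then have "card {Suc l..b r c} \<le> card (diagram lam)"
      using surj_card_le [OF finite_diagram] by blast
    then show ?thesis by simp
  qed
  moreover have "b r c \<le> l + card (diagram lam)" if "(r, c) \<notin> diagram lam" for r c
    using SSYT_outside [OF B that] by simp
  ultimately show ?thesis
    using B by (auto simp: tableaux_def)
qed

lemma ex_keys_bound: "finite K \<Longrightarrow> \<exists>n. \<forall>\<kappa>\<in>K. keys (\<kappa> :: nat \<Rightarrow>\<^sub>0 nat) \<subseteq> {..n}"
proof -
  assume "finite K"
  then have "finite (\<Union>\<kappa>\<in>K. keys \<kappa>)" by simp
  then obtain n where "\<forall>i\<in>(\<Union>\<kappa>\<in>K. keys \<kappa>). i \<le> n"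
    using finite_nat_set_iff_bounded_le by blast
  then show ?thesis
    by (intro exI [of _ n]) auto
qed

lemma finite_lattice_tableaux:
  assumes "lam \<in> partitions" "dl \<in> partitions"
  shows "finite (lattice_tableaux lam dl)"
proof -
  obtain l where "keys dl \<subseteq> {..l}"
    using ex_keys_bound [of "{dl}"] by auto
  then have "lattice_tableaux lam dl \<subseteq> tableaux (l + card (diagram lam)) lam"
    using lattice_tableaux_bounded [OF assms(2)] by blast
  then show ?thesis
    using finite_tableaux [OF assms(1)] finite_subset by blast
qed

text \<open>From k = n on the left side of the inequality is 0, so bounding k loses nothing.\<close>

lemma lattice_iff_yamanouchi:
  assumes lam: "lam \<in> partitions" and b: "b \<in> tableaux n lam" and dl: "keys dl \<subseteq> {..n}"
  shows "b \<in> lattice_tableaux lam dl \<longleftrightarrow> yamanouchi n (lookup dl) (gt_of lam b)"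
proof -
  have B: "b \<in> SSYT lam"
    using b by (simp add: tableaux_def)
  have beyond: "lookup dl (Suc k) + letter_count lam b (Suc k) m = 0" if "n \<le> k" for k m
    using content_beyond [OF b, of "Suc k" m] dl that by (auto simp: in_keys_iff dest!: subsetD [of _ _ "Suc k"])
  show ?thesis
  proof
    assume "b \<in> lattice_tableaux lam dl"
    then show "yamanouchi n (lookup dl) (gt_of lam b)"
      by (simp add: lattice_tableaux_def yamanouchi_def letters_gt_of [OF lam b])
  next
    assume yam: "yamanouchi n (lookup dl) (gt_of lam b)"
    have "lookup dl (Suc k) + letter_count lam b (Suc k) m \<le> lookup dl k + letter_count lam b k m" if "1 \<le> k" for k m
    proof (cases "k < n")
      case True
      then show ?thesis
        using yam that by (simp add: yamanouchi_def letters_gt_of [OF lam b])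
    next
      case False
      then show ?thesis
        using beyond [of k m] by simp
    qed
    then show "b \<in> lattice_tableaux lam dl"
      using B by (simp add: lattice_tableaux_def)
  qed
qed

lemma mcoeff_add: "mcoeff (F + G) \<alpha> = mcoeff F \<alpha> + mcoeff G \<alpha>"
  and mcoeff_diff: "mcoeff (F - G) \<alpha> = mcoeff F \<alpha> - mcoeff G \<alpha>"
  and mcoeff_0: "mcoeff 0 \<alpha> = 0"
  and mcoeff_1: "mcoeff 1 \<alpha> = (if \<alpha> = 0 then 1 else 0)"
  and mcoeff_mult: "mcoeff (F * G) \<alpha> = (\<Sum>(\<beta>, \<gamma>)\<in>splits \<alpha>. mcoeff F \<beta> * mcoeff G \<gamma>)"
  by (simp_all add: mseries_ops)

lemma mcoeff_sum: "mcoeff (\<Sum>x\<in>X. F x) \<alpha> = (\<Sum>x\<in>X. mcoeff (F x) \<alpha>)"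
  by (induction X rule: infinite_finite_induct) (simp_all add: mcoeff_0 mcoeff_add)

lemma additive_of_int_mult:
  fixes \<phi> :: "'a::ring_1 \<Rightarrow> int"
  assumes add: "\<And>x y. \<phi> (x + y) = \<phi> x + \<phi> y"
  shows "\<phi> (of_int z * x) = z * \<phi> x"
proof -
  have zero: "\<phi> 0 = 0"
    using add [of 0 0] by simp
  then have minus: "\<phi> (- y) = - \<phi> y" for y
    using add [of y "- y"] by simp
  have nat: "\<phi> (of_nat n * x) = int n * \<phi> x" for n
    by (induction n) (simp_all add: zero add algebra_simps)
  show ?thesis
    by (cases z) (use nat minus in \<open>simp_all flip: of_nat_Suc\<close>)
qed

lemma mcoeff_of_int_mult: "mcoeff (of_int z * F) \<alpha> = z * mcoeff F \<alpha>"
  by (rule additive_of_int_mult) (rule mcoeff_add)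

lemma lookup_of_int_mult: "lookup (of_int z * p) \<alpha> = z * lookup p \<alpha>" for p :: int_mpoly
  by (rule additive_of_int_mult [of "\<lambda>p. lookup p \<alpha>"]) (rule lookup_add)

theorem schur_mult:
  assumes lam: "lam \<in> partitions" and dl: "dl \<in> partitions"
  shows "schur lam * schur dl = (\<Sum>b\<in>lattice_tableaux lam dl. schur (dl + content lam b))"
proof (rule mseries_eqI)
  fix \<alpha> :: "nat \<Rightarrow>\<^sub>0 nat"
  obtain l where l: "keys dl \<subseteq> {..l}" "keys \<alpha> \<subseteq> {..l}"
    using ex_keys_bound [of "{dl, \<alpha>}"] by auto
  \<comment> \<open>l covers \<delta> and \<alpha>; the size of the diagram is added so that every
    lattice tableau has entries at most n.\<close>
  define n where "n = l + card (diagram lam)"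
  have n: "keys dl \<subseteq> {..n}" "keys \<alpha> \<subseteq> {..n}"
    using l by (auto simp: n_def)
  let ?Y = "{g. g \<in> gt_patterns n lam \<and> yamanouchi n (lookup dl) g}"
  have sub: "lattice_tableaux lam dl \<subseteq> tableaux n lam"
    using lattice_tableaux_bounded [OF dl l(1)] by (auto simp: n_def)
  have bij: "bij_betw (gt_of lam) (lattice_tableaux lam dl) ?Y"
  proof (rule bij_betw_subset [OF bij_gt_of [OF lam, of n] sub])
    show "gt_of lam ` lattice_tableaux lam dl = ?Y"
    proof
      show "gt_of lam ` lattice_tableaux lam dl \<subseteq> ?Y"
      proof (rule image_subsetI)
        fix b assume lat: "b \<in> lattice_tableaux lam dl"
        with sub have b: "b \<in> tableaux n lam" by blast
        then show "gt_of lam b \<in> ?Y"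
          using lat gt_of_in_GT [OF lam b] lattice_iff_yamanouchi [OF lam b n(1)] by simp
      qed
      show "?Y \<subseteq> gt_of lam ` lattice_tableaux lam dl"
      proof
        fix g assume g: "g \<in> ?Y"
        then obtain b where b: "b \<in> tableaux n lam" "g = gt_of lam b"
          using bij_gt_of [OF lam, of n] unfolding bij_betw_def by blast
        then show "g \<in> gt_of lam ` lattice_tableaux lam dl"
          using g lattice_iff_yamanouchi [OF lam b(1) n(1)] by simp
      qed
    qed
  qed
  have "mcoeff (schur lam * schur dl) \<alpha> = lookup (gt_poly n lam * gt_poly n dl) \<alpha>"
    by (rule mcoeff_schur_mult [OF lam dl n(2)])
  also have "gt_poly n lam * gt_poly n dl =
      (\<Sum>g\<in>?Y. gt_poly n (exp_vec n (\<lambda>i. lookup dl i + letters n g i 0)))"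
    by (rule gt_poly_mult [OF dl n(1)])
  also have "\<dots> = (\<Sum>b\<in>lattice_tableaux lam dl.
      gt_poly n (exp_vec n (\<lambda>i. lookup dl i + letters n (gt_of lam b) i 0)))"
    by (rule sum.reindex_bij_betw [OF bij, symmetric])
  also have "\<dots> = (\<Sum>b\<in>lattice_tableaux lam dl. gt_poly n (dl + content lam b))"
    using sub exp_vec_letters [OF lam _ dl n(1)] by (intro sum.cong) auto
  also have "lookup \<dots> \<alpha> = (\<Sum>b\<in>lattice_tableaux lam dl. mcoeff (schur (dl + content lam b)) \<alpha>)"
    unfolding lookup_sum
    using n(2) by (intro sum.cong) (simp_all add: lookup_gt_poly lattice_add_content_in_partitions [OF dl])
  finally show "mcoeff (schur lam * schur dl) \<alpha> = mcoeff (\<Sum>b\<in>lattice_tableaux lam dl. schur (dl + content lam b)) \<alpha>"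
    by (simp add: mcoeff_sum)
qed

text \<open>In n variables, multiplication by the denominator turns the relation into one between
  alternants with strictly decreasing exponents, and the leading coefficient for \<mu> isolates d
  \<mu>. This yields the uniqueness behind \<open>LR\<close>.\<close>

lemma schur_independent:
  assumes K: "finite K" "K \<subseteq> partitions" and zero: "(\<Sum>\<kappa>\<in>K. of_int (d \<kappa>) * schur \<kappa>) = 0"
    and \<mu>: "\<mu> \<in> K"
  shows "d \<mu> = 0"
proof -
  obtain n where n: "\<forall>\<kappa>\<in>K. keys \<kappa> \<subseteq> {..n}"
    using ex_keys_bound [OF K(1)] by blast
  have "(\<Sum>\<kappa>\<in>K. of_int (d \<kappa>) * gt_poly n \<kappa>) = 0"
  proof (rule poly_mapping_eqI)
    fix \<alpha>
    have "lookup (gt_poly n \<kappa>) \<alpha> = (if keys \<alpha> \<subseteq> {..n} then mcoeff (schur \<kappa>) \<alpha> else 0)" if "\<kappa> \<in> K" for \<kappa>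
      using K(2) that by (intro lookup_gt_poly) blast
    then have "lookup (\<Sum>\<kappa>\<in>K. of_int (d \<kappa>) * gt_poly n \<kappa>) \<alpha> =
        (if keys \<alpha> \<subseteq> {..n} then mcoeff (\<Sum>\<kappa>\<in>K. of_int (d \<kappa>) * schur \<kappa>) \<alpha> else 0)"
      by (simp add: lookup_sum mcoeff_sum lookup_of_int_mult mcoeff_of_int_mult)
    then show "lookup (\<Sum>\<kappa>\<in>K. of_int (d \<kappa>) * gt_poly n \<kappa>) \<alpha> = lookup 0 \<alpha>"
      by (simp add: zero mcoeff_0)
  qed
  then have "0 = alternant n (\<lambda>i. n - i) * (\<Sum>\<kappa>\<in>K. of_int (d \<kappa>) * gt_poly n \<kappa>)"
    by simp
  also have "\<dots> = (\<Sum>\<kappa>\<in>K. of_int (d \<kappa>) * alternant n (\<lambda>i. lookup \<kappa> i + (n - i)))"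
    unfolding sum_distrib_left
    using K n by (intro sum.cong) (auto simp: alternant_mult_gt_poly_0 [symmetric] mult_ac)
  finally have "0 = (\<Sum>\<kappa>\<in>K. d \<kappa> * lookup (alternant n (\<lambda>i. lookup \<kappa> i + (n - i))) (exp_vec n (\<lambda>i. lookup \<mu> i + (n - i))))"
    by (metis (no_types, lifting) lookup_of_int_mult lookup_sum lookup_zero sum.cong)
  also have "\<dots> = (\<Sum>\<kappa>\<in>K. if \<kappa> = \<mu> then d \<mu> else 0)"
  proof (rule sum.cong)
    fix \<kappa> assume \<kappa>: "\<kappa> \<in> K"
    have strict: "lookup \<nu> j + (n - j) < lookup \<nu> i + (n - i)"
      if "\<nu> \<in> K" "i \<in> {1..n}" "j \<in> {1..n}" "i < j" for \<nu> i j
      using partitions_antimono [of \<nu> i j] K that by auto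
    have "(\<forall>i\<in>{1..n}. lookup \<kappa> i + (n - i) = lookup \<mu> i + (n - i)) \<longleftrightarrow> \<kappa> = \<mu>"
    proof
      assume eq: "\<forall>i\<in>{1..n}. lookup \<kappa> i + (n - i) = lookup \<mu> i + (n - i)"
      show "\<kappa> = \<mu>"
      proof (rule poly_mapping_eqI)
        fix i
        consider "i \<in> {1..n}" | "i = 0" | "n < i"
          by (cases "i = 0"; cases "n < i") auto
        then show "lookup \<kappa> i = lookup \<mu> i"
        proof cases
          case 1
          then show ?thesis
            using bspec [OF eq 1] by linarith
        next
          case 2
          then show ?thesis
            using subsetD [OF K(2) \<kappa>] subsetD [OF K(2) \<mu>] by (simp add: partitions_def)
        next
          case 3
          then have "i \<notin> keys \<kappa>" "i \<notin> keys \<mu>"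
            using n \<kappa> \<mu> by (meson atMost_iff leD subsetD)+
          then show ?thesis
            by (simp add: in_keys_iff)
        qed
      qed
    qed simp
    then show "d \<kappa> * lookup (alternant n (\<lambda>i. lookup \<kappa> i + (n - i))) (exp_vec n (\<lambda>i. lookup \<mu> i + (n - i))) =
        (if \<kappa> = \<mu> then d \<mu> else 0)"
      using strict \<kappa> \<mu> by (subst lookup_alternant_strict) auto
  qed simp
  also have "\<dots> = d \<mu>"
    using K \<mu> by simp
  finally show ?thesis by simp
qed

theorem LR_eq_card:
  assumes lam: "lam \<in> partitions" and dl: "dl \<in> partitions"
  shows "LR lam dl \<nu> = int (card {b \<in> lattice_tableaux lam dl. dl + content lam b = \<nu>})"
proof -
  let ?X = "lattice_tableaux lam dl"
  let ?nu = "\<lambda>b. dl + content lam b"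
  define c where "c = (\<Sum>b\<in>?X. Poly_Mapping.single (?nu b) (1 :: int))"
  have fin: "finite ?X"
    by (rule finite_lattice_tableaux [OF lam dl])
  have lookup_c: "lookup c \<kappa> = int (card {b \<in> ?X. ?nu b = \<kappa>})" for \<kappa>
    using fin by (simp add: c_def lookup_sum lookup_single when_def sum.If_cases Int_def eq_commute [of \<kappa>])
  have keys_c: "keys c = ?nu ` ?X"
    using fin by (auto simp: in_keys_iff lookup_c card_eq_0_iff)
  have prod: "schur lam * schur dl = (\<Sum>\<kappa>\<in>keys c. of_int (lookup c \<kappa>) * schur \<kappa>)"
  proof -
    have "schur lam * schur dl = (\<Sum>b\<in>?X. schur (?nu b))"
      by (rule schur_mult [OF lam dl])
    also have "\<dots> = (\<Sum>\<kappa>\<in>?nu ` ?X. \<Sum>b\<in>{b \<in> ?X. ?nu b = \<kappa>}. schur (?nu b))"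
      by (rule sum.image_gen [OF fin])
    also have "\<dots> = (\<Sum>\<kappa>\<in>keys c. of_int (lookup c \<kappa>) * schur \<kappa>)"
      unfolding keys_c by (intro sum.cong) (simp_all add: lookup_c)
    finally show ?thesis .
  qed
  have "(THE c. keys c \<subseteq> partitions \<and>
     schur lam * schur dl = (\<Sum>\<kappa>\<in>keys c. of_int (lookup c \<kappa>) * schur \<kappa>)) = c"
  proof (rule the_equality)
    show "keys c \<subseteq> partitions \<and> schur lam * schur dl = (\<Sum>\<kappa>\<in>keys c. of_int (lookup c \<kappa>) * schur \<kappa>)"
      using prod lattice_add_content_in_partitions [OF dl] by (auto simp: keys_c)
    fix c' :: "(nat \<Rightarrow>\<^sub>0 nat) \<Rightarrow>\<^sub>0 int"
    assume c': "keys c' \<subseteq> partitions \<and> schur lam * schur dl = (\<Sum>\<kappa>\<in>keys c'. of_int (lookup c' \<kappa>) * schur \<kappa>)"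
    \<comment> \<open>Both expansions are extended by 0 to the union of their supports, so that
      independence applies to the difference.\<close>
    let ?K = "keys c \<union> keys c'"
    have ext: "(\<Sum>\<kappa>\<in>keys p. of_int (lookup p \<kappa>) * schur \<kappa>) = (\<Sum>\<kappa>\<in>?K. of_int (lookup p \<kappa>) * schur \<kappa>)"
      if "keys p \<subseteq> ?K" for p :: "(nat \<Rightarrow>\<^sub>0 nat) \<Rightarrow>\<^sub>0 int"
      using that by (intro sum.mono_neutral_left) (auto simp: in_keys_iff)
    have "(\<Sum>\<kappa>\<in>?K. of_int (lookup c' \<kappa> - lookup c \<kappa>) * schur \<kappa>) = 0"
      using prod c' ext [of c] ext [of c'] by (simp add: sum_subtractf left_diff_distrib)
    moreover have "?K \<subseteq> partitions"
      using c' lattice_add_content_in_partitions [OF dl] by (auto simp: keys_c)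
    ultimately have "lookup c' \<kappa> - lookup c \<kappa> = 0" if "\<kappa> \<in> ?K" for \<kappa>
      using schur_independent [of ?K "\<lambda>\<kappa>. lookup c' \<kappa> - lookup c \<kappa>"] that by simp
    then show "c' = c"
      by (intro poly_mapping_eqI) (metis UnCI eq_iff_diff_eq_0 in_keys_iff)
  qed
  then show ?thesis
    by (simp add: LR_def lookup_c)
qed

section \<open>Signatures\<close>

text \<open>The exponents \<open>(p, q)\<close> of the reduced word, computed letter by letter.\<close>

definition push :: "nat \<times> nat \<Rightarrow> sign \<Rightarrow> nat \<times> nat" where
  "push x s = (case s of Plus \<Rightarrow> (fst x, Suc (snd x))
     | Minus \<Rightarrow> if snd x = 0 then (Suc (fst x), 0) else (fst x, snd x - 1))"

definition reduce :: "sign list \<Rightarrow> nat \<times> nat" where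
  "reduce w = foldl push (0, 0) w"

lemma reduce_snoc: "reduce (w @ [s]) = push (reduce w) s"
  by (simp add: reduce_def)

text \<open>Pushing \<open>Plus\<close> and then \<open>Minus\<close> restores the state. The
  resulting invariant gives uniqueness of the reduced word, in place of a confluence
  argument.\<close>

lemma reduce_cancel: "cancel u v \<Longrightarrow> reduce u = reduce v"
  by (induction rule: cancel.induct) (simp add: reduce_def push_def)

lemma reduce_cancels: "cancel\<^sup>*\<^sup>* u v \<Longrightarrow> reduce u = reduce v"
  by (induction rule: rtranclp_induct) (auto dest: reduce_cancel)

lemma reduce_normal: "reduce (replicate p Minus @ replicate q Plus) = (p, q)"
proof (induction q)
  case 0
  show ?case
  proof (induction p)
    case (Suc p)
    then show ?case
      using reduce_snoc [of "replicate p Minus" Minus] by (simp add: push_def flip: replicate_append_same)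
  qed (simp add: reduce_def)
next
  case (Suc q)
  then show ?case
    using reduce_snoc [of "replicate p Minus @ replicate q Plus" Plus]
    by (simp add: push_def flip: replicate_append_same)
qed

lemma cancel_append: "cancel u v \<Longrightarrow> cancel (u @ w) (v @ w)"
  by (induction rule: cancel.induct) (use cancel.intros in fastforce)

lemma cancels_append: "cancel\<^sup>*\<^sup>* u v \<Longrightarrow> cancel\<^sup>*\<^sup>* (u @ w) (v @ w)"
  by (induction rule: rtranclp_induct) (auto intro: rtranclp.rtrancl_into_rtrancl cancel_append)

text \<open>Existence of the reduced word: a new \<open>Minus\<close> cancels against the last
  surviving \<open>Plus\<close>, or joins the block of \<open>Minus\<close> if none
  survives.\<close>

lemma cancels_reduce:
  "cancel\<^sup>*\<^sup>* w (replicate (fst (reduce w)) Minus @ replicate (snd (reduce w)) Plus)"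
proof (induction w rule: rev_induct)
  case Nil
  show ?case by (simp add: reduce_def)
next
  case (snoc s w)
  obtain p q where pq: "reduce w = (p, q)" by fastforce
  have *: "cancel\<^sup>*\<^sup>* (w @ [s]) (replicate p Minus @ replicate q Plus @ [s])"
    using cancels_append [OF snoc, of "[s]"] by (simp add: pq)
  show ?case
  proof (cases s)
    case Plus
    with * show ?thesis
      by (simp add: reduce_snoc pq push_def replicate_append_same)
  next
    case Minus
    show ?thesis
    proof (cases q)
      case 0
      with * Minus show ?thesis
        by (simp add: reduce_snoc pq push_def replicate_append_same)
    next
      case (Suc q')
      have "cancel ((replicate p Minus @ replicate q' Plus) @ [Plus, Minus] @ []) ((replicate p Minus @ replicate q' Plus) @ [])"
        by (rule cancel.intros)
      moreover have "replicate p Minus @ replicate q Plus @ [s] = (replicate p Minus @ replicate q' Plus) @ [Plus, Minus] @ []"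
        using Suc Minus by (simp add: replicate_append_same [symmetric])
      ultimately have "cancel\<^sup>*\<^sup>* (w @ [s]) (replicate p Minus @ replicate q' Plus)"
        using * by (simp add: rtranclp.rtrancl_into_rtrancl)
      then show ?thesis
        using Suc Minus by (simp add: reduce_snoc pq push_def)
    qed
  qed
qed

lemma eps_i_eq_reduce: "eps_i lam b i = fst (reduce (sign_word lam b i))"
  unfolding eps_i_def
  by (rule the_equality) (use cancels_reduce in blast, use reduce_cancels reduce_normal in fastforce)

lemma phi_i_eq_reduce: "phi_i lam b i = snd (reduce (sign_word lam b i))"
  unfolding phi_i_def
  by (rule the_equality) (use cancels_reduce in blast, use reduce_cancels reduce_normal in fastforce)

lemma reduce_balance: "fst (reduce w) + count_list w Plus = snd (reduce w) + count_list w Minus"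
proof (induction w rule: rev_induct)
  case (snoc s w)
  then show ?case
    by (cases s) (auto simp: reduce_snoc push_def)
qed (simp add: reduce_def)

text \<open>The first exponent is the largest excess of \<open>Minus\<close> over
  \<open>Plus\<close> in a prefix. An appended \<open>Minus\<close> raises it only if no
  \<open>Plus\<close> survives, and then by \<open>reduce_balance\<close> it equals the excess of
  the word read so far.\<close>

lemma fst_reduce_le_iff:
  "fst (reduce w) \<le> d \<longleftrightarrow> (\<forall>u v. w = u @ v \<longrightarrow> count_list u Minus \<le> count_list u Plus + d)"
proof (induction w rule: rev_induct)
  case Nil
  show ?case by (simp add: reduce_def)
next
  case (snoc s w)
  have prefix: "w @ [s] = u @ v \<longleftrightarrow> (\<exists>v'. w = u @ v' \<and> v = v' @ [s]) \<or> (u = w @ [s] \<and> v = [])" for u v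
    by (cases v rule: rev_cases) auto
  have "(\<forall>u v. w @ [s] = u @ v \<longrightarrow> count_list u Minus \<le> count_list u Plus + d) \<longleftrightarrow>
      (\<forall>u v. w = u @ v \<longrightarrow> count_list u Minus \<le> count_list u Plus + d) \<and>
      count_list (w @ [s]) Minus \<le> count_list (w @ [s]) Plus + d"
    unfolding prefix by blast
  also have "\<dots> \<longleftrightarrow> fst (reduce w) \<le> d \<and> count_list (w @ [s]) Minus \<le> count_list (w @ [s]) Plus + d"
    by (simp only: snoc)
  also have "\<dots> \<longleftrightarrow> fst (reduce (w @ [s])) \<le> d"
    using reduce_balance [of w] by (cases s) (auto simp: reduce_snoc push_def)
  finally show ?case by blast
qed

definition sign_list :: "nat \<Rightarrow> nat list \<Rightarrow> sign list" where
  "sign_list i xs = map (\<lambda>x. if x = i then Plus else Minus) (filter (\<lambda>x. x = i \<or> x = Suc i) xs)"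

lemma sign_list_append: "sign_list i (xs @ ys) = sign_list i xs @ sign_list i ys"
  by (simp add: sign_list_def)

lemma count_list_sign_list:
  "count_list (sign_list i xs) Plus = count_list xs i"
  "count_list (sign_list i xs) Minus = count_list xs (Suc i)"
  by (induction xs) (auto simp: sign_list_def)

text \<open>Prefixes of the filtered word lift to prefixes of the word itself, which moves the
  prefix condition to the reading word.\<close>

lemma sign_list_eq_append:
  assumes "sign_list i xs = u @ v"
  shows "\<exists>ys zs. xs = ys @ zs \<and> u = sign_list i ys"
  using assms
proof (induction xs arbitrary: u)
  case Nil
  then show ?case by (simp add: sign_list_def)
next
  case (Cons x xs)
  show ?case
  proof (cases "x = i \<or> x = Suc i")
    case True
    then have "sign_list i (x # ys) = (if x = i then Plus else Minus) # sign_list i ys" for ys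
      by (simp add: sign_list_def)
    note step = this
    show ?thesis
    proof (cases u)
      case Nil
      then show ?thesis
        by (intro exI [of _ "[]"] exI [of _ "x # xs"]) (simp add: sign_list_def)
    next
      case u: (Cons s u')
      then have s: "s = (if x = i then Plus else Minus)" "sign_list i xs = u' @ v"
        using Cons.prems step [of xs] by simp_all
      then obtain ys zs where "xs = ys @ zs" "u' = sign_list i ys"
        using Cons.IH [of u'] by blast
      then show ?thesis
        using u s(1) step by (intro exI [of _ "x # ys"] exI [of _ zs]) simp
    qed
  next
    case False
    then have skip: "sign_list i (x # ys) = sign_list i ys" for ys
      by (simp add: sign_list_def)
    then obtain ys zs where "xs = ys @ zs" "u = sign_list i ys"
      using Cons.IH [of u] Cons.prems by auto
    then show ?thesis
      by (intro exI [of _ "x # ys"] exI [of _ zs]) (simp add: skip)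
  qed
qed

lemma eps_i_le_iff_reading:
  "eps_i lam b i \<le> d \<longleftrightarrow>
    (\<forall>xs ys. reading lam b = xs @ ys \<longrightarrow> count_list xs (Suc i) \<le> count_list xs i + d)"
proof -
  have sw: "sign_word lam b i = sign_list i (reading lam b)"
    by (simp add: sign_word_def sign_list_def)
  have "(\<forall>u v. sign_word lam b i = u @ v \<longrightarrow> count_list u Minus \<le> count_list u Plus + d) \<longleftrightarrow>
      (\<forall>xs ys. reading lam b = xs @ ys \<longrightarrow> count_list xs (Suc i) \<le> count_list xs i + d)"
    (is "?L \<longleftrightarrow> ?R")
  proof
    assume L: ?L
    show ?R
    proof (intro allI impI)
      fix xs ys assume "reading lam b = xs @ ys"
      then have "sign_word lam b i = sign_list i xs @ sign_list i ys"
        by (simp only: sw sign_list_append)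
      with L have "count_list (sign_list i xs) Minus \<le> count_list (sign_list i xs) Plus + d"
        by blast
      then show "count_list xs (Suc i) \<le> count_list xs i + d"
        by (simp only: count_list_sign_list)
    qed
  next
    assume R: ?R
    show ?L
    proof (intro allI impI)
      fix u v assume "sign_word lam b i = u @ v"
      then obtain xs ys where "reading lam b = xs @ ys" "u = sign_list i xs"
        using sign_list_eq_append [of i "reading lam b" u v] sw by auto
      with R show "count_list u Minus \<le> count_list u Plus + d"
        by (simp only: count_list_sign_list)
    qed
  qed
  then show ?thesis
    by (simp add: eps_i_eq_reduce fst_reduce_le_iff)
qed

section \<open>The reading word cut at columns\<close>

lemma length_filter_eq_count_list_map: "count_list (map f xs) k = length (filter (\<lambda>x. f x = k) xs)"
  by (induction xs) auto

definition column :: "(nat \<Rightarrow>\<^sub>0 nat) \<Rightarrow> (nat \<Rightarrow> nat \<Rightarrow> nat) \<Rightarrow> nat \<Rightarrow> nat list" where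
  "column lam b c = map (\<lambda>r. b r c) [1..<Suc (column_height lam c)]"

lemma reading_eq_columns: "reading lam b = concat (map (column lam b) (rev [1..<Suc (lookup lam 1)]))"
proof -
  have "column lam b = (\<lambda>c. map (\<lambda>r. b r c) [1..<Suc (column_height lam c)])"
    by (rule ext) (rule column_def)
  then show ?thesis
    by (simp only: reading_def)
qed

context
  fixes lam :: "nat \<Rightarrow>\<^sub>0 nat" and b :: "nat \<Rightarrow> nat \<Rightarrow> nat"
  assumes lam: "lam \<in> partitions" and b: "b \<in> SSYT lam"
begin

lemma mem_diagram_iff_height: "(r, c) \<in> diagram lam \<longleftrightarrow> 1 \<le> c \<and> r \<in> {1..column_height lam c}" 
proof (cases "1 \<le> c")
  case True
  let ?S = "{r. (r, c) \<in> diagram lam}"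
  have "?S = {1..card ?S}"
  proof (rule down_closed_eq_interval)
    have "?S \<subseteq> fst ` diagram lam"
      by force
    then show "finite ?S"
      by (rule finite_subset) (simp add: finite_diagram)
    show "0 \<notin> ?S"
      by (simp add: diagram_def)
    show "r \<in> ?S" if "r' \<in> ?S" "1 \<le> r" "r \<le> r'" for r r'
      using that diagram_up [OF lam] by blast
  qed
  then show ?thesis
    using True by (auto simp: column_height_def)
qed (simp add: diagram_def)

lemma column_sorted: "1 \<le> c \<Longrightarrow> sorted_wrt (<) (column lam b c)"
  unfolding column_def sorted_wrt_map
proof (rule sorted_wrt_mono_rel [OF _ sorted_wrt_upt])
  fix r r' assume "1 \<le> c" "r \<in> set [1..<Suc (column_height lam c)]" "r' \<in> set [1..<Suc (column_height lam c)]" "r < r'"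
  then show "b r c < b r' c"
    using mem_diagram_iff_height [of r' c] by (intro SSYT_col_strict_mono [OF lam b]) auto
qed

lemma count_list_column:
  assumes "1 \<le> c"
  shows "count_list (column lam b c) k = card {r. (r, c) \<in> diagram lam \<and> b r c = k}"
proof -
  have "count_list (column lam b c) k = card ({r. b r c = k} \<inter> set [1..<Suc (column_height lam c)])"
    unfolding column_def length_filter_eq_count_list_map by (rule distinct_length_filter) simp
  also have "{r. b r c = k} \<inter> set [1..<Suc (column_height lam c)] = {r. (r, c) \<in> diagram lam \<and> b r c = k}"
    using assms by (auto simp: mem_diagram_iff_height)
  finally show ?thesis .
qed

lemma letter_count_column:
  "letter_count lam b k m = letter_count lam b k (Suc m) + count_list (column lam b (Suc m)) k"
proof -
  let ?A = "{(r, c) \<in> diagram lam. Suc m < c \<and> b r c = k}"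
  let ?B = "(\<lambda>r. (r, Suc m)) ` {r. (r, Suc m) \<in> diagram lam \<and> b r (Suc m) = k}"
  have "{(r, c) \<in> diagram lam. m < c \<and> b r c = k} = ?A \<union> ?B"
  proof -
    have "m < c \<longleftrightarrow> Suc m < c \<or> c = Suc m" for c
      by auto
    then show ?thesis
      by (auto simp: image_iff)
  qed
  moreover have "finite ?A" "finite ?B"
    by (rule finite_subset [OF _ finite_diagram]; force)+
  moreover have "card ?B = count_list (column lam b (Suc m)) k"
    by (simp add: count_list_column card_image inj_on_def)
  moreover have "?A \<inter> ?B = {}"
    by auto
  ultimately show ?thesis
    unfolding letter_count_def by (simp only: card_Un_disjoint)
qed

lemma letter_count_beyond: "lookup lam 1 \<le> m \<Longrightarrow> letter_count lam b k m = 0"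
  using partitions_antimono [OF lam, of 1] by (fastforce simp: letter_count_eq_0_iff diagram_def)

text \<open>The prefix of the reading word that consists of the complete columns beyond m.\<close>

definition columns :: "nat \<Rightarrow> nat list" where
  "columns m = concat (map (column lam b) (rev [Suc m..<Suc (lookup lam 1)]))"

lemma count_list_columns:
  "m \<le> lookup lam 1 \<Longrightarrow> count_list (columns m) k = letter_count lam b k m"
proof (induction m rule: inc_induct)
  case base
  show ?case
    by (simp add: columns_def letter_count_beyond)
next
  case (step m)
  then have "columns m = columns (Suc m) @ column lam b (Suc m)"
    by (simp add: columns_def upt_conv_Cons del: upt_Suc)
  then show ?case
    using step by (simp add: letter_count_column [of k m])
qed

lemma prefix_reading:
  assumes "reading lam b = xs @ ys"
  shows "xs = [] \<or> (\<exists>m zs ws. m < lookup lam 1 \<and> xs = columns (Suc m) @ zs \<and> column lam b (Suc m) = zs @ ws)"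
proof (cases "lookup lam 1 = 0")
  case True
  then show ?thesis
    using assms by (simp add: reading_def)
next
  case False
  let ?N = "lookup lam 1"
  let ?cs = "rev [1..<Suc ?N]"
  have "concat (map (column lam b) ?cs) = xs @ ys"
    using assms by (simp only: reading_eq_columns)
  moreover have "map (column lam b) ?cs \<noteq> []"
    using False by simp
  ultimately obtain xss zs ws yss where split: "map (column lam b) ?cs = xss @ (zs @ ws) # yss"
    and xs: "xs = concat xss @ zs"
    unfolding concat_eq_append_conv by auto
  obtain cs c ds where cs: "?cs = cs @ c # ds" "xss = map (column lam b) cs" "zs @ ws = column lam b c"
    using split by (auto simp: map_eq_append_conv map_eq_Cons_conv)
  have len: "length cs < ?N"
    using arg_cong [OF cs(1), of length] by (simp del: upt_Suc)
  have "c = ?cs ! length cs"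
    by (simp only: cs(1) nth_append_length)
  also have "\<dots> = ?N - length cs"
    using len by (simp add: rev_nth del: upt_Suc)
  finally have c: "c = ?N - length cs" .
  have "cs = take (length cs) ?cs"
    by (simp only: cs(1)) simp
  also have "\<dots> = rev [Suc c..<Suc ?N]"
    using len by (simp add: take_rev c del: upt_Suc)
  finally have xs_eq: "xs = columns c @ zs"
    using xs cs(2) by (simp add: columns_def)
  define m where "m = c - 1"
  have m: "c = Suc m" "m < ?N"
    using c len by (simp_all add: m_def)
  then show ?thesis
    using xs_eq cs(3) by (intro disjI2 exI [of _ m] exI [of _ zs] exI [of _ ws]) simp
qed

lemma columns_prefix_reading: "m \<le> lookup lam 1 \<Longrightarrow> \<exists>ys. reading lam b = columns m @ ys"
proof -
  assume "m \<le> lookup lam 1"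
  then have "[1..<Suc (lookup lam 1)] = [1..<Suc m] @ [Suc m..<Suc (lookup lam 1)]"
    using upt_add_eq_append [of 1 "Suc m" "lookup lam 1 - m"] by (simp del: upt_Suc)
  then show ?thesis
    by (simp add: reading_eq_columns columns_def del: upt_Suc)
qed

text \<open>Within a column the letter \<open>i\<close> is read before \<open>i + 1\<close>, so the excess of \<open>i + 1\<close> over \<open>i\<close> is
  maximal at the end of a column.\<close>

theorem eps_i_le_iff:
  "eps_i lam b i \<le> d \<longleftrightarrow> (\<forall>m. letter_count lam b (Suc i) m \<le> letter_count lam b i m + d)"
  unfolding eps_i_le_iff_reading
proof
  assume *: "\<forall>xs ys. reading lam b = xs @ ys \<longrightarrow> count_list xs (Suc i) \<le> count_list xs i + d"
  show "\<forall>m. letter_count lam b (Suc i) m \<le> letter_count lam b i m + d"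
  proof
    fix m
    show "letter_count lam b (Suc i) m \<le> letter_count lam b i m + d"
    proof (cases "m \<le> lookup lam 1")
      case True
      then show ?thesis
        using * columns_prefix_reading [OF True] by (metis count_list_columns)
    qed (simp add: letter_count_beyond)
  qed
next
  assume *: "\<forall>m. letter_count lam b (Suc i) m \<le> letter_count lam b i m + d"
  show "\<forall>xs ys. reading lam b = xs @ ys \<longrightarrow> count_list xs (Suc i) \<le> count_list xs i + d"
  proof (intro allI impI)
    fix xs ys assume "reading lam b = xs @ ys"
    from prefix_reading [OF this] consider "xs = []"
      | m zs ws where "m < lookup lam 1" "xs = columns (Suc m) @ zs" "column lam b (Suc m) = zs @ ws"
      by blast
    then show "count_list xs (Suc i) \<le> count_list xs i + d"
    proof cases
      case 2
      have count: "count_list xs k = letter_count lam b k (Suc m) + count_list zs k" for k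
        using 2 by (simp add: count_list_columns)
      show ?thesis
      \<comment> \<open>If i + 1 has been read in this column, the rest of the increasing column
        contains neither letter and the counts are those after the whole column. Otherwise the count
        of i + 1 is still that before the column.\<close>
      proof (cases "Suc i \<in> set zs")
        case False
        then have "count_list zs (Suc i) = 0"
          by (simp add: count_list_0_iff)
        then show ?thesis
          using count spec [OF *, of "Suc m"] by simp
      next
        case True
        have "sorted_wrt (<) (zs @ ws)"
          using column_sorted [of "Suc m"] 2 by simp
        then have "i \<notin> set ws" "Suc i \<notin> set ws"
          using True by (fastforce simp: sorted_wrt_append)+
        then have "count_list (column lam b (Suc m)) k = count_list zs k" if "k \<in> {i, Suc i}" for k
          using 2(3) that by (auto simp: count_list_0_iff)
        then have "count_list xs k = letter_count lam b k m" if "k \<in> {i, Suc i}" for k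
          using count [of k] letter_count_column [of k m] that by simp
        then show ?thesis
          using spec [OF *, of m] by simp
      qed
    qed simp
  qed
qed

text \<open>Each cancellation removes one i and one i + 1, so the difference of \<phi> and
  \<epsilon> is that of the letter counts.\<close>

lemma phi_i_balance: "phi_i lam b i + letter_count lam b (Suc i) 0 = eps_i lam b i + letter_count lam b i 0"
proof -
  have "sign_word lam b i = sign_list i (reading lam b)"
    by (simp add: sign_word_def sign_list_def)
  moreover have "reading lam b = columns 0"
    by (simp add: reading_eq_columns columns_def)
  ultimately show ?thesis
    using reduce_balance [of "sign_word lam b i"]
    by (simp add: phi_i_eq_reduce eps_i_eq_reduce count_list_sign_list count_list_columns)
qed

lemma letter_count_antimono: "letter_count lam b k m \<le> letter_count lam b k 0"
  unfolding letter_count_def by (rule card_mono) (auto intro: finite_subset [OF _ finite_diagram])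

lemma eps_i_le: "eps_i lam b i \<le> letter_count lam b (Suc i) 0"
  unfolding eps_i_le_iff using letter_count_antimono trans_le_add2 by blast

lemma phi_i_le: "phi_i lam b i \<le> letter_count lam b i 0"
  using phi_i_balance [of i] eps_i_le [of i] by simp

text \<open>Column-wise and letter-wise conditions meet here: over all m, the lattice inequality
  bounds \<epsilon> by the number of columns of height i in \<open>dl\<close>.\<close>

lemma mem_lattice_tableaux_iff:
  assumes dl: "dl \<in> partitions"
  shows "b \<in> lattice_tableaux lam dl \<longleftrightarrow> (\<forall>i\<ge>1. lookup dl (Suc i) + eps_i lam b i \<le> lookup dl i)"
proof -
  have "(\<forall>m. lookup dl (Suc i) + letter_count lam b (Suc i) m \<le> lookup dl i + letter_count lam b i m) \<longleftrightarrow>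
      lookup dl (Suc i) + eps_i lam b i \<le> lookup dl i" if "1 \<le> i" for i
  proof -
    have le: "lookup dl (Suc i) \<le> lookup dl i"
      using dl that by (simp add: partitions_def)
    then have "lookup dl (Suc i) + eps_i lam b i \<le> lookup dl i \<longleftrightarrow> eps_i lam b i \<le> lookup dl i - lookup dl (Suc i)"
      by linarith
    moreover have "lookup dl (Suc i) + x \<le> lookup dl i + y \<longleftrightarrow> x \<le> y + (lookup dl i - lookup dl (Suc i))" for x y
      using le by linarith
    ultimately show ?thesis
      by (simp only: eps_i_le_iff)
  qed
  then show ?thesis
    using b unfolding lattice_tableaux_def by blast
qed

end

section \<open>Distinguished tableaux\<close>

lemma lookup_omega: "lookup (omega i) j = (if 1 \<le> j \<and> j \<le> i then 1 else 0)"
  by (auto simp: omega_def lookup_sum lookup_single when_def)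

lemma lookup_cmul: "lookup (k \<cdot> \<kappa>) j = k * lookup \<kappa> j"
  by (simp add: cmul_def Poly_Mapping.map.rep_eq when_def)

lemma lookup_half: "lookup (half \<kappa>) j = lookup \<kappa> j div 2"
  by (simp add: half_def Poly_Mapping.map.rep_eq when_def)

lemma lookup_omega_coords:
  "lookup (omega_coords \<kappa>) i = lookup \<kappa> i - lookup \<kappa> (Suc i)"
  by (auto simp: omega_coords_def lookup_sum lookup_single when_def in_keys_iff)

lemma eventually_lookup_0: "\<exists>n. \<forall>j\<ge>n. lookup (\<kappa> :: nat \<Rightarrow>\<^sub>0 nat) j = 0"
proof -
  obtain n where "keys \<kappa> \<subseteq> {..n}"
    using ex_keys_bound [of "{\<kappa>}"] by auto
  then show ?thesis
    by (intro exI [of _ "Suc n"]) (metis Suc_n_not_le_n atMost_iff in_keys_iff order_trans subsetD)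
qed

text \<open>Finite support gives a common index beyond which both vanish; equality propagates down
  from there.\<close>

lemma eq_by_differences:
  fixes \<kappa> \<rho> :: "nat \<Rightarrow>\<^sub>0 nat"
  assumes zero: "lookup \<kappa> 0 = lookup \<rho> 0"
    and step: "\<And>j. 1 \<le> j \<Longrightarrow> lookup \<kappa> j + lookup \<rho> (Suc j) = lookup \<rho> j + lookup \<kappa> (Suc j)"
  shows "\<kappa> = \<rho>"
proof (rule poly_mapping_eqI)
  fix j
  obtain n m where n: "\<forall>i\<ge>n. lookup \<kappa> i = 0" and m: "\<forall>i\<ge>m. lookup \<rho> i = 0"
    using eventually_lookup_0 by metis
  have "lookup \<kappa> j = lookup \<rho> j" if j: "1 \<le> j" for j
  proof (cases "j \<le> n + m")
    case True
    then show ?thesis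
      using j
    proof (induction j rule: inc_induct)
      case base
      then show ?case using n m by simp
    next
      case (step i)
      then show ?case
        using assms(2) [of i] by simp
    qed
  next
    case False
    then show ?thesis using n m by simp
  qed
  with zero show "lookup \<kappa> j = lookup \<rho> j"
    by (cases "j = 0") simp_all
qed

text \<open>Rows j and j + 1 differ by the columns of height j. The map g lets one statement serve
  both \<open>P2\<close> and \<open>P11\<close>.\<close>

lemma lookup_sum_omega:
  assumes "finite K" "1 \<le> j"
  shows "lookup (\<Sum>i\<in>K. f i \<cdot> omega (g i)) j =
    lookup (\<Sum>i\<in>K. f i \<cdot> omega (g i)) (Suc j) + (\<Sum>i | i \<in> K \<and> g i = j. f i)"
proof -
  have "(\<Sum>i | i \<in> K \<and> g i = j. f i) = (\<Sum>i\<in>K. if g i = j then f i else 0)"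
    using assms(1) by (simp add: sum.inter_filter)
  moreover have "lookup (f i \<cdot> omega (g i)) j = lookup (f i \<cdot> omega (g i)) (Suc j) + (if g i = j then f i else 0)" for i
    using assms(2) by (auto simp: lookup_cmul lookup_omega)
  then have "(\<Sum>i\<in>K. lookup (f i \<cdot> omega (g i)) j) =
      (\<Sum>i\<in>K. lookup (f i \<cdot> omega (g i)) (Suc j) + (if g i = j then f i else 0))"
    by (rule sum.cong [OF refl])
  ultimately show ?thesis
    by (simp only: lookup_sum sum.distrib)
qed

lemma lookup_sum_omega_0: "lookup (\<Sum>i\<in>K. f i \<cdot> omega (g i)) 0 = 0"
  by (simp add: lookup_sum lookup_cmul lookup_omega)

lemma sum_omega_in_partitions: "finite K \<Longrightarrow> (\<Sum>i\<in>K. f i \<cdot> omega (g i)) \<in> partitions"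
proof -
  assume K: "finite K"
  let ?s = "\<Sum>i\<in>K. f i \<cdot> omega (g i)"
  have "lookup ?s (Suc i) \<le> lookup ?s i" if "1 \<le> i" for i
    using lookup_sum_omega [OF K that, of f g] by linarith
  then show ?thesis
    using lookup_sum_omega_0 [of f g K] unfolding partitions_def by blast
qed

lemma sum_restrict_singleton:
  fixes f :: "'a \<Rightarrow> nat"
  assumes "j \<notin> K \<Longrightarrow> f j = 0"
  shows "(\<Sum>i | i \<in> K \<and> i = j. f i) = f j"
proof -
  have "{i. i \<in> K \<and> i = j} = (if j \<in> K then {j} else {})"
    by auto
  then show ?thesis
    using assms by simp
qed

text \<open>Right inverse of \<open>omega_coords\<close> on indices from 1 on; a value at 0 is lost
  because \<open>omega 0\<close> is 0.\<close>

definition of_coords :: "(nat \<Rightarrow>\<^sub>0 nat) \<Rightarrow> (nat \<Rightarrow>\<^sub>0 nat)" where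
  "of_coords a = (\<Sum>i\<in>keys a. lookup a i \<cdot> omega i)"

lemma of_coords_in_partitions: "of_coords a \<in> partitions"
  unfolding of_coords_def by (rule sum_omega_in_partitions) simp

lemma lookup_of_coords_step: "1 \<le> j \<Longrightarrow> lookup (of_coords a) j = lookup (of_coords a) (Suc j) + lookup a j"
proof -
  assume "1 \<le> j"
  moreover have "(\<Sum>i | i \<in> keys a \<and> i = j. lookup a i) = lookup a j"
    by (rule sum_restrict_singleton) (simp add: in_keys_iff)
  ultimately show ?thesis
    using lookup_sum_omega [of "keys a" j "lookup a" "\<lambda>i. i"] by (simp add: of_coords_def)
qed

lemma partitions_step: "\<kappa> \<in> partitions \<Longrightarrow> 1 \<le> j \<Longrightarrow> lookup \<kappa> j = lookup \<kappa> (Suc j) + lookup (omega_coords \<kappa>) j"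
  by (simp add: lookup_omega_coords partitions_def)

lemma partitions_eqI:
  assumes "\<kappa> \<in> partitions" "\<rho> \<in> partitions"
    and "\<And>j. 1 \<le> j \<Longrightarrow> lookup (omega_coords \<kappa>) j = lookup (omega_coords \<rho>) j"
  shows "\<kappa> = \<rho>"
proof (rule eq_by_differences)
  show "lookup \<kappa> 0 = lookup \<rho> 0"
    using assms by (simp add: partitions_def)
  fix j :: nat assume "1 \<le> j"
  then show "lookup \<kappa> j + lookup \<rho> (Suc j) = lookup \<rho> j + lookup \<kappa> (Suc j)"
    using partitions_step [of \<kappa> j] partitions_step [of \<rho> j] assms by simp
qed

lemma omega_coords_of_coords: "1 \<le> j \<Longrightarrow> lookup (omega_coords (of_coords a)) j = lookup a j"
  using lookup_of_coords_step [of j a] by (simp add: lookup_omega_coords)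

lemma partitions_add: "\<kappa> \<in> partitions \<Longrightarrow> \<rho> \<in> partitions \<Longrightarrow> \<kappa> + \<rho> \<in> partitions"
  by (simp add: partitions_def lookup_add add_mono)

lemma omega_coords_add:
  "\<kappa> \<in> partitions \<Longrightarrow> \<rho> \<in> partitions \<Longrightarrow> 1 \<le> j \<Longrightarrow>
    lookup (omega_coords (\<kappa> + \<rho>)) j = lookup (omega_coords \<kappa>) j + lookup (omega_coords \<rho>) j"
  by (simp add: lookup_omega_coords lookup_add partitions_def)

lemma P2_iff: "\<kappa> \<in> P2 \<longleftrightarrow> \<kappa> \<in> partitions \<and> (\<forall>j\<ge>1. even (lookup (omega_coords \<kappa>) j))"
proof
  assume "\<kappa> \<in> P2"
  then obtain a where a: "\<kappa> = (\<Sum>i\<in>keys a. (2 * lookup a i) \<cdot> omega i)"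
    by (auto simp: P2_def)
  have "lookup (omega_coords \<kappa>) j = 2 * (\<Sum>i | i \<in> keys a \<and> i = j. lookup a i)" if "1 \<le> j" for j
    using lookup_sum_omega [of "keys a" j "\<lambda>i. 2 * lookup a i" "\<lambda>i. i"] that
    by (simp add: lookup_omega_coords a sum_distrib_left)
  then show "\<kappa> \<in> partitions \<and> (\<forall>j\<ge>1. even (lookup (omega_coords \<kappa>) j))"
    using sum_omega_in_partitions [of "keys a" "\<lambda>i. 2 * lookup a i" "\<lambda>i. i"] by (simp add: a)
next
  assume \<kappa>: "\<kappa> \<in> partitions \<and> (\<forall>j\<ge>1. even (lookup (omega_coords \<kappa>) j))"
  define a where "a = half (omega_coords \<kappa>)"
  let ?s = "\<Sum>i\<in>keys a. (2 * lookup a i) \<cdot> omega i"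
  have "\<kappa> = ?s"
  proof (rule partitions_eqI)
    show "?s \<in> partitions"
      by (rule sum_omega_in_partitions) simp
    fix j :: nat assume j: "1 \<le> j"
    have "lookup (omega_coords ?s) j = (\<Sum>i | i \<in> keys a \<and> i = j. 2 * lookup a i)"
      using lookup_sum_omega [of "keys a" j "\<lambda>i. 2 * lookup a i" "\<lambda>i. i"] j
      by (simp add: lookup_omega_coords)
    also have "\<dots> = 2 * lookup a j"
      by (rule sum_restrict_singleton) (simp add: in_keys_iff)
    finally show "lookup (omega_coords \<kappa>) j = lookup (omega_coords ?s) j"
      using \<kappa> j by (simp add: a_def lookup_half)
  qed (use \<kappa> in simp)
  then show "\<kappa> \<in> P2"
    unfolding P2_def by blast
qed

lemma P11_iff: "\<kappa> \<in> P11 \<longleftrightarrow> \<kappa> \<in> partitions \<and> (\<forall>j\<ge>1. odd j \<longrightarrow> lookup (omega_coords \<kappa>) j = 0)"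
proof
  assume "\<kappa> \<in> P11"
  then obtain a where a: "\<kappa> = (\<Sum>i\<in>keys a. lookup a i \<cdot> omega (2 * i))"
    by (auto simp: P11_def)
  have "lookup (omega_coords \<kappa>) j = 0" if "1 \<le> j" "odd j" for j
  proof -
    have none: "{i. i \<in> keys a \<and> 2 * i = j} = {}"
      using that(2) by auto
    show ?thesis
      using lookup_sum_omega [of "keys a" j "lookup a" "\<lambda>i. 2 * i"] that(1)
      unfolding none by (simp add: lookup_omega_coords a)
  qed
  then show "\<kappa> \<in> partitions \<and> (\<forall>j\<ge>1. odd j \<longrightarrow> lookup (omega_coords \<kappa>) j = 0)"
    using sum_omega_in_partitions [of "keys a" "lookup a" "\<lambda>i. 2 * i"] by (simp add: a)
next
  assume \<kappa>: "\<kappa> \<in> partitions \<and> (\<forall>j\<ge>1. odd j \<longrightarrow> lookup (omega_coords \<kappa>) j = 0)"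
  \<comment> \<open>Reads the coordinate at 2 i as the multiplicity of
    \<open>omega (2 * i)\<close>.\<close>
  define a where "a = Poly_Mapping.map_key ((*) 2) (omega_coords \<kappa>)"
  have lookup_a: "lookup a i = lookup (omega_coords \<kappa>) (2 * i)" for i
    by (simp add: a_def map_key.rep_eq inj_on_def)
  let ?s = "\<Sum>i\<in>keys a. lookup a i \<cdot> omega (2 * i)"
  have "\<kappa> = ?s"
  proof (rule partitions_eqI)
    show "?s \<in> partitions"
      by (rule sum_omega_in_partitions) simp
    fix j :: nat assume j: "1 \<le> j"
    have coord: "lookup (omega_coords ?s) j = (\<Sum>i | i \<in> keys a \<and> 2 * i = j. lookup a i)"
      using lookup_sum_omega [of "keys a" j "lookup a" "\<lambda>i. 2 * i"] j
      by (simp add: lookup_omega_coords)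
    show "lookup (omega_coords \<kappa>) j = lookup (omega_coords ?s) j"
    proof (cases "even j")
      case True
      then obtain l where l: "j = 2 * l" by blast
      have "{i. i \<in> keys a \<and> 2 * i = j} = (if l \<in> keys a then {l} else {})"
        using l by auto
      then show ?thesis
        unfolding coord by (auto simp: lookup_a l in_keys_iff)
    next
      case False
      then have none: "{i. i \<in> keys a \<and> 2 * i = j} = {}"
        by auto
      show ?thesis
        unfolding coord none using \<kappa> j False by simp
    qed
  qed (use \<kappa> in simp)
  then show "\<kappa> \<in> P11"
    unfolding P11_def by blast
qed

text \<open>Every row of an element of \<open>P2\<close> has even length, so \<open>div 2\<close>
  commutes with taking differences.\<close>

lemma half_coords: "\<kappa> \<in> P2 \<Longrightarrow> 1 \<le> j \<Longrightarrow> 2 * lookup (omega_coords (half \<kappa>)) j = lookup (omega_coords \<kappa>) j"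
proof -
  assume \<kappa>: "\<kappa> \<in> P2" and j: "1 \<le> j"
  from \<kappa> obtain a where a: "\<kappa> = (\<Sum>i\<in>keys a. (2 * lookup a i) \<cdot> omega i)"
    by (auto simp: P2_def)
  have ev: "even (lookup \<kappa> i)" for i
    unfolding a lookup_sum by (rule dvd_sum) (simp add: lookup_cmul)
  then obtain x y where "lookup \<kappa> j = 2 * x" "lookup \<kappa> (Suc j) = 2 * y"
    by (metis dvdE)
  then show ?thesis
    by (simp add: lookup_omega_coords lookup_half diff_mult_distrib2)
qed

lemma half_coords_0: "\<kappa> \<in> partitions \<Longrightarrow> lookup (omega_coords (half \<kappa>)) 0 = 0"
  by (simp add: lookup_omega_coords lookup_half partitions_def)

section \<open>The admissible \<mu> of a fixed tableau\<close>

context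
  fixes lam :: "nat \<Rightarrow>\<^sub>0 nat"
  assumes lam: "lam \<in> partitions"
begin

context
  fixes b :: "nat \<Rightarrow> nat \<Rightarrow> nat"
  assumes b: "b \<in> SSYT lam"
begin

lemma phi_in_partitions: "phi lam b \<in> partitions"
  and phi_coords: "1 \<le> j \<Longrightarrow> lookup (omega_coords (phi lam b)) j = phi_i lam b j"
proof -
  let ?K = "{i. 1 \<le> i \<and> phi_i lam b i \<noteq> 0}"
  have "?K \<subseteq> keys (content lam b)"
  proof
    fix i assume "i \<in> ?K"
    then have "letter_count lam b i 0 \<noteq> 0"
      using phi_i_le [OF lam b, of i] by simp
    then show "i \<in> keys (content lam b)"
      by (simp add: in_keys_iff lookup_content)
  qed
  then have fin: "finite ?K"
    by (rule finite_subset) simp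
  show "phi lam b \<in> partitions"
    unfolding phi_def by (rule sum_omega_in_partitions [OF fin])
  assume j: "1 \<le> j"
  have "(\<Sum>i | i \<in> ?K \<and> i = j. phi_i lam b i) = phi_i lam b j"
    by (rule sum_restrict_singleton) (use j in simp)
  then show "lookup (omega_coords (phi lam b)) j = phi_i lam b j"
    using lookup_sum_omega [OF fin j, of "phi_i lam b" "\<lambda>i. i"] by (simp add: lookup_omega_coords phi_def)
qed

lemma eps_in_partitions: "eps lam b \<in> partitions"
  and eps_coords: "1 \<le> j \<Longrightarrow> lookup (omega_coords (eps lam b)) j = eps_i lam b j"
proof -
  let ?K = "{i. 1 \<le> i \<and> eps_i lam b i \<noteq> 0}"
  \<comment> \<open>A positive \<epsilon> at i requires a letter i + 1, hence the shift.\<close>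
  have "Suc ` ?K \<subseteq> keys (content lam b)"
  proof (rule image_subsetI)
    fix i assume "i \<in> ?K"
    then have "letter_count lam b (Suc i) 0 \<noteq> 0"
      using eps_i_le [OF lam b, of i] by simp
    then show "Suc i \<in> keys (content lam b)"
      by (simp add: in_keys_iff lookup_content)
  qed
  then have "finite (Suc ` ?K)"
    by (rule finite_subset) simp
  then have fin: "finite ?K"
    by (rule finite_imageD) simp
  show "eps lam b \<in> partitions"
    unfolding eps_def by (rule sum_omega_in_partitions [OF fin])
  assume j: "1 \<le> j"
  have "(\<Sum>i | i \<in> ?K \<and> i = j. eps_i lam b i) = eps_i lam b j"
    by (rule sum_restrict_singleton) (use j in simp)
  then show "lookup (omega_coords (eps lam b)) j = eps_i lam b j"
    using lookup_sum_omega [OF fin j, of "eps_i lam b" "\<lambda>i. i"] by (simp add: lookup_omega_coords eps_def)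
qed

lemma phi_eq_eps_add_content: "phi lam b = eps lam b + content lam b"
proof (rule eq_by_differences)
  show "lookup (phi lam b) 0 = lookup (eps lam b + content lam b) 0"
    using phi_in_partitions eps_in_partitions content_0 [OF b] by (simp add: partitions_def lookup_add)
  fix j :: nat assume j: "1 \<le> j"
  show "lookup (phi lam b) j + lookup (eps lam b + content lam b) (Suc j) =
      lookup (eps lam b + content lam b) j + lookup (phi lam b) (Suc j)"
    using partitions_step [OF phi_in_partitions j] partitions_step [OF eps_in_partitions j]
      phi_i_balance [OF lam b, of j] phi_coords [OF j] eps_coords [OF j]
    by (simp add: lookup_add lookup_content)
qed

lemma distinguished_iff:
  assumes \<mu>: "\<mu> \<in> partitions"
  shows "distinguished lam \<mu> b \<longleftrightarrow>
    (\<forall>j\<ge>1. even (phi_i lam b j + lookup (omega_coords \<mu>) j)) \<and>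
    (\<forall>j\<ge>1. odd j \<longrightarrow> eps_i lam b j = 0 \<and> lookup (omega_coords \<mu>) j = 0)"
proof -
  have "distinguished lam \<mu> b \<longleftrightarrow> phi lam b + \<mu> \<in> P2 \<and> eps lam b + \<mu> \<in> P11"
    by (auto simp: distinguished_def)
  then show ?thesis
    unfolding P2_iff P11_iff
    using partitions_add [OF phi_in_partitions \<mu>] partitions_add [OF eps_in_partitions \<mu>]
    by (simp add: omega_coords_add phi_in_partitions eps_in_partitions \<mu> phi_coords eps_coords)
qed

text \<open>The explicit form of \<^const>\<open>mu_min\<close>.\<close>

definition mu0 :: "nat \<Rightarrow>\<^sub>0 nat" where
  "mu0 = of_coords (\<Sum>j\<in>{j\<in>keys (omega_coords (phi lam b)). even j}. Poly_Mapping.single j (phi_i lam b j mod 2))"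

lemma mu0_in_partitions: "mu0 \<in> partitions"
  unfolding mu0_def by (rule of_coords_in_partitions)

lemma mu0_coords: "1 \<le> j \<Longrightarrow> lookup (omega_coords mu0) j = (if even j then phi_i lam b j mod 2 else 0)"
  using phi_coords [of j]
  by (auto simp: mu0_def omega_coords_of_coords lookup_sum lookup_single when_def in_keys_iff)

text \<open>An admissible \<mu> has zero odd coordinates and at even places the parity of \<phi>.
  Subtracting the residues leaves even numbers at even places and 0 at odd ones, an element of
  \<open>Pbox\<close>.\<close>

lemma distinguished_mu0:
  assumes \<mu>: "\<mu> \<in> partitions" "distinguished lam \<mu> b"
  shows "distinguished lam mu0 b" and "le_box mu0 \<mu>"
proof -
  have coords: "even (phi_i lam b j + lookup (omega_coords \<mu>) j)"
    "odd j \<Longrightarrow> eps_i lam b j = 0 \<and> lookup (omega_coords \<mu>) j = 0" if "1 \<le> j" for j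
    using \<mu> that by (simp_all add: distinguished_iff)
  then have "even (phi_i lam b j + lookup (omega_coords mu0) j)" if "1 \<le> j" for j
    using that by (cases "even j") (fastforce simp: mu0_coords)+
  then show "distinguished lam mu0 b"
    using coords by (simp add: distinguished_iff [OF mu0_in_partitions] mu0_coords)
  define \<rho> where "\<rho> = of_coords (omega_coords \<mu> - omega_coords mu0)"
  have \<rho>: "\<rho> \<in> partitions"
    unfolding \<rho>_def by (rule of_coords_in_partitions)
  have \<rho>_coords: "lookup (omega_coords \<rho>) j = lookup (omega_coords \<mu>) j - lookup (omega_coords mu0) j"
    if "1 \<le> j" for j
    using that by (simp add: \<rho>_def omega_coords_of_coords lookup_minus)
  have le: "lookup (omega_coords mu0) j \<le> lookup (omega_coords \<mu>) j"
    and ev: "even (lookup (omega_coords \<mu>) j - lookup (omega_coords mu0) j)" if "1 \<le> j" for j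
  proof -
    have parity: "p mod 2 \<le> q" "even (q - p mod 2)" if "even (p + q)" for p q :: nat
      using that by presburger+
    show "lookup (omega_coords mu0) j \<le> lookup (omega_coords \<mu>) j"
      and "even (lookup (omega_coords \<mu>) j - lookup (omega_coords mu0) j)"
      using parity [OF coords(1) [OF that]] coords(2) [OF that] that
      by (cases "even j"; simp add: mu0_coords)+
  qed
  have "\<mu> = mu0 + \<rho>"
    using \<mu>(1) le \<rho>
    by (intro partitions_eqI) (simp_all add: partitions_add mu0_in_partitions omega_coords_add \<rho>_coords)
  moreover have "\<rho> \<in> Pbox"
    using \<rho> ev coords(2) by (simp add: Pbox_def P2_iff P11_iff \<rho>_coords)
  ultimately show "le_box mu0 \<mu>"
    by (auto simp: le_box_def)
qed

text \<open>Elements of \<open>Pbox\<close> have even coordinates while those of \<open>mu0\<close>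
  are at most 1, so nothing admissible lies strictly below \<open>mu0\<close>. It lies below every
  admissible \<mu>, which gives uniqueness.\<close>

lemma mu_min_eq_mu0:
  assumes "b \<in> D lam"
  shows "mu_min lam b = mu0"
  unfolding mu_min_def
proof (rule the_equality)
  obtain \<mu> where \<mu>: "\<mu> \<in> partitions" "distinguished lam \<mu> b"
    using assms by (auto simp: D_def)
  have "\<mu>' = mu0" if \<mu>': "\<mu>' \<in> partitions" "distinguished lam \<mu>' b" "le_box \<mu>' mu0" for \<mu>'
  proof (rule partitions_eqI [OF \<mu>'(1) mu0_in_partitions])
    obtain \<rho> where \<rho>: "\<rho> \<in> Pbox" "mu0 = \<mu>' + \<rho>"
      using \<mu>'(3) by (auto simp: le_box_def)
    fix j :: nat assume j: "1 \<le> j"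
    have "\<rho> \<in> partitions" "even (lookup (omega_coords \<rho>) j)"
      using \<rho>(1) j by (simp_all add: Pbox_def P2_iff)
    moreover have "lookup (omega_coords mu0) j \<le> 1"
      using mod_less_divisor [of 2 "phi_i lam b j"] by (simp add: mu0_coords [OF j] del: mod_less_divisor)
    moreover have "lookup (omega_coords mu0) j = lookup (omega_coords \<mu>') j + lookup (omega_coords \<rho>) j"
      using calculation(1) \<mu>'(1) j by (simp add: \<rho>(2) omega_coords_add)
    ultimately show "lookup (omega_coords \<mu>') j = lookup (omega_coords mu0) j"
      by presburger
  qed
  then show "mu0 \<in> partitions \<and> distinguished lam mu0 b \<and>
      (\<forall>\<mu>'\<in>partitions. distinguished lam \<mu>' b \<and> le_box \<mu>' mu0 \<longrightarrow> \<mu>' = mu0)"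
    using mu0_in_partitions distinguished_mu0 [OF \<mu>] by blast
  fix \<mu>'
  assume "\<mu>' \<in> partitions \<and> distinguished lam \<mu>' b \<and>
      (\<forall>\<mu>''\<in>partitions. distinguished lam \<mu>'' b \<and> le_box \<mu>'' \<mu>' \<longrightarrow> \<mu>'' = \<mu>')"
  then show "\<mu>' = mu0"
    using mu0_in_partitions distinguished_mu0 by metis
qed

text \<open>Subtracting \<epsilon> from \<delta> in \<omega>-coordinates is possible exactly under
  the lattice condition, and \<phi> = \<epsilon> + content carries one equation to the
  other.\<close>

lemma LR_condition_iff:
  assumes \<nu>: "\<nu> \<in> P2"
  shows "(\<exists>dl\<in>P11. b \<in> lattice_tableaux lam dl \<and> dl + content lam b = \<nu>) \<longleftrightarrow>
    (\<exists>\<mu>\<in>partitions. distinguished lam \<mu> b \<and> phi lam b + \<mu> = \<nu>)"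
proof
  assume "\<exists>dl\<in>P11. b \<in> lattice_tableaux lam dl \<and> dl + content lam b = \<nu>"
  then obtain dl where dl: "dl \<in> P11" "b \<in> lattice_tableaux lam dl" "dl + content lam b = \<nu>"
    by blast
  have part: "dl \<in> partitions"
    using dl(1) by (simp add: P11_iff)
  define \<mu> where "\<mu> = of_coords (omega_coords dl - omega_coords (eps lam b))"
  have \<mu>: "\<mu> \<in> partitions"
    unfolding \<mu>_def by (rule of_coords_in_partitions)
  have "eps lam b + \<mu> = dl"
  proof (rule partitions_eqI)
    fix j :: nat assume j: "1 \<le> j"
    have "eps_i lam b j \<le> lookup (omega_coords dl) j"
      using dl(2) j partitions_step [OF part j] unfolding mem_lattice_tableaux_iff [OF lam b part]
      by (metis add_le_cancel_left)
    then show "lookup (omega_coords (eps lam b + \<mu>)) j = lookup (omega_coords dl) j"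
      using j by (simp add: omega_coords_add eps_in_partitions \<mu>)
        (simp add: \<mu>_def omega_coords_of_coords lookup_minus eps_coords)
  qed (simp_all add: partitions_add eps_in_partitions \<mu> part)
  moreover have "phi lam b + \<mu> = (eps lam b + \<mu>) + content lam b"
    by (simp add: phi_eq_eps_add_content add_ac)
  ultimately have "eps lam b + \<mu> = dl" "phi lam b + \<mu> = \<nu>"
    using dl(3) by simp_all
  then show "\<exists>\<mu>\<in>partitions. distinguished lam \<mu> b \<and> phi lam b + \<mu> = \<nu>"
    using \<mu> \<nu> dl(1) unfolding distinguished_def by blast
next
  assume "\<exists>\<mu>\<in>partitions. distinguished lam \<mu> b \<and> phi lam b + \<mu> = \<nu>"
  then obtain \<mu> where \<mu>: "\<mu> \<in> partitions" "distinguished lam \<mu> b" "phi lam b + \<mu> = \<nu>"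
    by blast
  let ?dl = "eps lam b + \<mu>"
  have "?dl \<in> P11"
    using \<mu>(2) by (auto simp: distinguished_def)
  moreover have "b \<in> lattice_tableaux lam ?dl"
  proof -
    have "?dl \<in> partitions"
      by (rule partitions_add [OF eps_in_partitions \<mu>(1)])
    moreover have "lookup ?dl (Suc i) + eps_i lam b i \<le> lookup ?dl i" if "1 \<le> i" for i
      using partitions_step [OF eps_in_partitions that] partitions_step [OF \<mu>(1) that] eps_coords [OF that]
      by (simp add: lookup_add)
    ultimately show ?thesis
      by (simp add: mem_lattice_tableaux_iff [OF lam b])
  qed
  moreover have "?dl + content lam b = \<nu>"
    using \<mu>(3) by (simp add: phi_eq_eps_add_content add_ac)
  ultimately show "\<exists>dl\<in>P11. b \<in> lattice_tableaux lam dl \<and> dl + content lam b = \<nu>"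
    by blast
qed

end

end

section \<open>Generating series\<close>

lemma mcoeff_monomial: "mcoeff (monomial \<beta>) \<alpha> = (if \<alpha> = \<beta> then 1 else 0)"
  by (simp add: monomial_def)

lemma sum_splits_if:
  fixes f :: "(nat \<Rightarrow>\<^sub>0 nat) \<Rightarrow> int"
  shows "(\<Sum>(\<beta>, \<gamma>)\<in>splits \<alpha>. if P \<beta> then f \<gamma> else 0) = (\<Sum>x | x \<in> splits \<alpha> \<and> P (fst x). f (snd x))"
proof -
  have "(\<Sum>(\<beta>, \<gamma>)\<in>splits \<alpha>. if P \<beta> then f \<gamma> else 0) = (\<Sum>x\<in>splits \<alpha>. if P (fst x) then f (snd x) else 0)"
    by (rule sum.cong) auto
  also have "\<dots> = (\<Sum>x | x \<in> splits \<alpha> \<and> P (fst x). f (snd x))"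
    by (rule sum.inter_filter [OF finite_splits, symmetric])
  finally show ?thesis .
qed

lemma mcoeff_tvar_mult:
  "mcoeff (tvar j * F) \<alpha> =
    (if lookup \<alpha> j = 0 then 0 else mcoeff F (\<alpha> - Poly_Mapping.single j 1))"
proof -
  let ?e = "Poly_Mapping.single j (1 :: nat)"
  have "mcoeff (tvar j * F) \<alpha> = (\<Sum>(\<beta>, \<gamma>)\<in>splits \<alpha>. if \<beta> = ?e then mcoeff F \<gamma> else 0)"
    by (auto simp: mcoeff_mult tvar_def mcoeff_monomial intro!: sum.cong)
  also have "\<dots> = (\<Sum>x\<in>{x \<in> splits \<alpha>. fst x = ?e}. mcoeff F (snd x))"
    by (rule sum_splits_if)
  also have "{x \<in> splits \<alpha>. fst x = ?e} = (if lookup \<alpha> j = 0 then {} else {(?e, \<alpha> - ?e)})"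
  proof (cases "lookup \<alpha> j = 0")
    case True
    then have "?e + \<gamma> \<noteq> \<alpha>" for \<gamma>
      by (auto simp: lookup_add)
    then show ?thesis
      using True by auto
  next
    case False
    have "?e + (\<alpha> - ?e) = \<alpha>"
      by (rule poly_mapping_eqI) (use False in \<open>auto simp: lookup_add lookup_minus lookup_single when_def\<close>)
    then show ?thesis
      using False by auto
  qed
  finally show ?thesis
    by simp
qed

section \<open>The infinite product and its inverse\<close>

definition even_tail :: "nat \<Rightarrow> (nat \<Rightarrow>\<^sub>0 nat) set" where
  "even_tail n = {\<alpha>. \<forall>i\<in>keys \<alpha>. even i \<and> 2 * n < i}"

text \<open>The product of the \<open>1 / (1 - t\<^sub>2\<^sub>i)\<close> with \<open>i > n\<close>.\<close>

definition geometric :: "nat \<Rightarrow> mseries" where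
  "geometric n = MSeries (\<lambda>\<alpha>. if \<alpha> \<in> even_tail n then 1 else 0)"

text \<open>If the variable of the factor is absent from \<alpha>, the shifted term vanishes and the
  two tail conditions agree. If it is present, lowering its exponent does not affect membership in
  \<open>even_tail n\<close>, and the two terms cancel.\<close>

lemma geometric_Suc: "(1 - tvar (2 * Suc n)) * geometric n = geometric (Suc n)"
proof (rule mseries_eqI)
  fix \<alpha>
  let ?j = "2 * Suc n"
  let ?e = "Poly_Mapping.single ?j (1 :: nat)"
  have "mcoeff ((1 - tvar ?j) * geometric n) \<alpha> = mcoeff (geometric n) \<alpha> - mcoeff (tvar ?j * geometric n) \<alpha>"
    by (simp add: left_diff_distrib mcoeff_diff)
  also have "\<dots> = mcoeff (geometric (Suc n)) \<alpha>"
  proof (cases "lookup \<alpha> ?j = 0")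
    case True
    have tail: "even i \<and> 2 * n < i \<longleftrightarrow> even i \<and> 2 * Suc n < i" if "i \<in> keys \<alpha>" for i
    proof -
      have "i \<noteq> ?j"
        using True that by (auto simp: in_keys_iff)
      then show ?thesis
        by presburger
    qed
    have "\<alpha> \<in> even_tail n \<longleftrightarrow> \<alpha> \<in> even_tail (Suc n)"
      unfolding even_tail_def mem_Collect_eq by (rule ball_cong [OF refl tail])
    then show ?thesis
      using True by (simp only: geometric_def mcoeff_MSeries mcoeff_tvar_mult) simp
  next
    case False
    then have "?j \<in> keys \<alpha>"
      by (simp add: in_keys_iff)
    then have "\<alpha> \<notin> even_tail (Suc n)"
      by (auto simp: even_tail_def)
    moreover have "\<alpha> \<in> even_tail n \<longleftrightarrow> \<alpha> - ?e \<in> even_tail n"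
    proof -
      have "keys \<alpha> - {?j} = keys (\<alpha> - ?e) - {?j}"
        by (auto simp: in_keys_iff lookup_minus lookup_single when_def)
      moreover have "\<beta> \<in> even_tail n \<longleftrightarrow> (\<forall>i\<in>keys \<beta> - {?j}. even i \<and> 2 * n < i)" for \<beta>
        by (auto simp: even_tail_def)
      ultimately show ?thesis
        by simp
    qed
    ultimately show ?thesis
      using False by (simp only: geometric_def mcoeff_MSeries mcoeff_tvar_mult) simp
  qed
  finally show "mcoeff ((1 - tvar ?j) * geometric n) \<alpha> = mcoeff (geometric (Suc n)) \<alpha>" .
qed

lemma prod_mult_geometric: "(\<Prod>i = 1..n. 1 - tvar (2 * i)) * geometric 0 = geometric n"
proof (induction n)
  case (Suc n)
  have "(\<Prod>i = 1..Suc n. 1 - tvar (2 * i)) * geometric 0 =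
      (1 - tvar (2 * Suc n)) * ((\<Prod>i = 1..n. 1 - tvar (2 * i)) * geometric 0)"
    by (simp add: prod.atLeast1_atMost_eq mult_ac)
  then show ?case
    by (simp only: Suc geometric_Suc)
qed simp

text \<open>A further factor changes only monomials that contain its variable, whose index exceeds
  m.\<close>

lemma mcoeff_prod_stable:
  assumes "keys \<alpha> \<subseteq> {..m}" "m \<le> n"
  shows "mcoeff (\<Prod>i = 1..n. 1 - tvar (2 * i)) \<alpha> = mcoeff (\<Prod>i = 1..m. 1 - tvar (2 * i)) \<alpha>"
  using assms(2)
proof (induction n rule: dec_induct)
  case (step n)
  let ?P = "\<Prod>i = 1..n. 1 - tvar (2 * i)"
  have "2 * Suc n \<notin> keys \<alpha>"
    using assms(1) step by auto
  then have "lookup \<alpha> (2 * Suc n) = 0"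
    by (simp only: in_keys_iff) simp
  then have "mcoeff (tvar (2 * Suc n) * ?P) \<alpha> = 0"
    by (simp only: mcoeff_tvar_mult simp_thms if_True)
  moreover have "(\<Prod>i = 1..Suc n. 1 - tvar (2 * i)) = ?P - tvar (2 * Suc n) * ?P"
    by (simp add: algebra_simps)
  ultimately show ?case
    using step by (simp only: mcoeff_diff diff_zero)
qed simp

lemma mcoeff_formal_prod:
  assumes "keys \<alpha> \<subseteq> {..m}"
  shows "mcoeff (formal_prod (\<lambda>i. 1 - tvar (2 * i))) \<alpha> = mcoeff (\<Prod>i = 1..m. 1 - tvar (2 * i)) \<alpha>"
proof -
  let ?c = "\<lambda>n. mcoeff (\<Prod>i = 1..n. 1 - tvar (2 * i)) \<alpha>"
  have ev: "eventually (\<lambda>n. ?c n = ?c m) sequentially"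
    unfolding eventually_sequentially using mcoeff_prod_stable [OF assms] by blast
  have "(THE c. eventually (\<lambda>n. ?c n = c) sequentially) = ?c m"
  proof (rule the_equality)
    show "eventually (\<lambda>n. ?c n = ?c m) sequentially"
      by (rule ev)
    fix c assume "eventually (\<lambda>n. ?c n = c) sequentially"
    with ev have "eventually (\<lambda>n. c = ?c m) sequentially"
      by eventually_elim simp
    then show "c = ?c m"
      by simp
  qed
  then show ?thesis
    by (simp add: formal_prod_def)
qed

text \<open>For \<alpha> in the variables up to n the product may be cut at n. What remains is
  \<open>geometric n\<close>, whose nonconstant monomials only use variables beyond 2 n.\<close>

lemma formal_prod_mult_geometric: "formal_prod (\<lambda>i. 1 - tvar (2 * i)) * geometric 0 = 1"
proof (rule mseries_eqI)
  fix \<alpha> :: "nat \<Rightarrow>\<^sub>0 nat"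
  obtain n where n: "keys \<alpha> \<subseteq> {..n}"
    using ex_keys_bound [of "{\<alpha>}"] by auto
  have "mcoeff (formal_prod (\<lambda>i. 1 - tvar (2 * i)) * geometric 0) \<alpha> =
      mcoeff ((\<Prod>i = 1..n. 1 - tvar (2 * i)) * geometric 0) \<alpha>"
    unfolding mcoeff_mult
  proof (rule sum.cong [OF refl], clarify)
    fix \<beta> \<gamma> assume "\<alpha> = \<beta> + \<gamma>"
    then have "keys \<beta> \<subseteq> keys \<alpha>"
      by (auto simp: in_keys_iff lookup_add)
    with n have "keys \<beta> \<subseteq> {..n}"
      by blast
    then show "mcoeff (formal_prod (\<lambda>i. 1 - tvar (2 * i))) \<beta> * mcoeff (geometric 0) \<gamma> =
        mcoeff (\<Prod>i = 1..n. 1 - tvar (2 * i)) \<beta> * mcoeff (geometric 0) \<gamma>"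
      by (simp only: mcoeff_formal_prod)
  qed
  also have "\<dots> = (if \<alpha> \<in> even_tail n then 1 else 0)"
    unfolding prod_mult_geometric by (simp add: geometric_def)
  also have "\<alpha> \<in> even_tail n \<longleftrightarrow> \<alpha> = 0"
  proof
    assume *: "\<alpha> \<in> even_tail n"
    have "keys \<alpha> = {}"
    proof (rule ccontr)
      assume "keys \<alpha> \<noteq> {}"
      then obtain i where i: "i \<in> keys \<alpha>" by blast
      then have "i \<le> n" "2 * n < i"
        using n * by (auto simp: even_tail_def)
      then show False by simp
    qed
    then show "\<alpha> = 0" by simp
  qed (simp add: even_tail_def)
  finally show "mcoeff (formal_prod (\<lambda>i. 1 - tvar (2 * i)) * geometric 0) \<alpha> = mcoeff 1 \<alpha>"
    by (simp add: mcoeff_1)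
qed

section \<open>Comparison of coefficients\<close>

lemma mcoeff_formal_sum: "mcoeff (formal_sum X F) \<alpha> = (\<Sum>x | x \<in> X \<and> mcoeff (F x) \<alpha> \<noteq> 0. mcoeff (F x) \<alpha>)"
  by (simp add: formal_sum_def)

lemma mcoeff_formal_sum_monomial:
  "mcoeff (formal_sum X (\<lambda>x. monomial (f x))) \<alpha> = int (card {x \<in> X. f x = \<alpha>})"
proof -
  have "{x. x \<in> X \<and> mcoeff (monomial (f x)) \<alpha> \<noteq> 0} = {x \<in> X. f x = \<alpha>}"
    by (auto simp: mcoeff_monomial)
  moreover have "(\<Sum>x\<in>{x \<in> X. f x = \<alpha>}. mcoeff (monomial (f x)) \<alpha>) = (\<Sum>x\<in>{x \<in> X. f x = \<alpha>}. 1)"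
    by (rule sum.cong) (auto simp: mcoeff_monomial)
  ultimately show ?thesis
    by (simp add: mcoeff_formal_sum)
qed

lemma finite_content_le:
  assumes lam: "lam \<in> partitions"
  shows "finite {b \<in> SSYT lam. \<exists>\<gamma>. content lam b + \<gamma> = \<nu>}"
proof -
  obtain n where n: "keys \<nu> \<subseteq> {..n}"
    using ex_keys_bound [of "{\<nu>}"] by auto
  have "{b \<in> SSYT lam. \<exists>\<gamma>. content lam b + \<gamma> = \<nu>} \<subseteq> tableaux n lam"
  proof clarify
    fix b \<gamma> assume b: "b \<in> SSYT lam" and \<nu>: "\<nu> = content lam b + \<gamma>"
    have "keys (content lam b) \<subseteq> keys \<nu>"
      by (auto simp: \<nu> in_keys_iff lookup_add)
    then show "b \<in> tableaux n lam"
      using n b by (intro tableaux_if_keys_content) auto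
  qed
  then show ?thesis
    using finite_tableaux [OF lam] finite_subset by blast
qed

lemma mcoeff_inner_sum:
  assumes lam: "lam \<in> partitions" and \<nu>: "\<nu> \<in> P2"
  shows "mcoeff (formal_sum P11 (\<lambda>\<delta>. t_pow (half \<nu>) * of_int (LR lam \<delta> \<nu>))) \<alpha> =
    (if omega_coords (half \<nu>) = \<alpha>
     then int (card {b \<in> SSYT lam. \<exists>\<mu>\<in>partitions. distinguished lam \<mu> b \<and> phi lam b + \<mu> = \<nu>}) else 0)"
proof -
  have coeff: "mcoeff (t_pow (half \<nu>) * of_int z) \<alpha> = (if omega_coords (half \<nu>) = \<alpha> then z else 0)" for z
    by (simp add: mult.commute [of _ "of_int z"] mcoeff_of_int_mult t_pow_def mcoeff_monomial)
  show ?thesis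
  proof (cases "omega_coords (half \<nu>) = \<alpha>")
    case False
    then show ?thesis
      by (simp add: mcoeff_formal_sum coeff)
  next
    case True
    let ?X = "\<lambda>\<delta>. {b \<in> lattice_tableaux lam \<delta>. \<delta> + content lam b = \<nu>}"
    let ?\<Delta> = "{\<delta>. \<delta> \<in> P11 \<and> LR lam \<delta> \<nu> \<noteq> 0}"
    have LR: "LR lam \<delta> \<nu> = int (card (?X \<delta>))" if "\<delta> \<in> P11" for \<delta>
      using that by (intro LR_eq_card [OF lam]) (simp add: P11_iff)
    have finX: "finite (?X \<delta>)" if "\<delta> \<in> P11" for \<delta>
      using finite_lattice_tableaux [OF lam, of \<delta>] that by (simp add: P11_iff)
    \<comment> \<open>A nonzero \<open>LR\<close> forces \<delta> to be a summand of \<nu>, so the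
      formal sum is finite.\<close>
    have "?\<Delta> \<subseteq> fst ` splits \<nu>"
    proof
      fix \<delta> assume \<delta>: "\<delta> \<in> ?\<Delta>"
      then have "?X \<delta> \<noteq> {}"
        using LR [of \<delta>] by (metis (mono_tags, lifting) card.empty mem_Collect_eq of_nat_0)
      then obtain b where "\<delta> + content lam b = \<nu>"
        by blast
      then show "\<delta> \<in> fst ` splits \<nu>"
        by force
    qed
    then have fin\<Delta>: "finite ?\<Delta>"
      by (rule finite_subset) (simp add: finite_splits)
    have "mcoeff (formal_sum P11 (\<lambda>\<delta>. t_pow (half \<nu>) * of_int (LR lam \<delta> \<nu>))) \<alpha> = (\<Sum>\<delta>\<in>?\<Delta>. LR lam \<delta> \<nu>)"
      using True by (simp add: mcoeff_formal_sum coeff)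
    also have "\<dots> = (\<Sum>\<delta>\<in>?\<Delta>. int (card (?X \<delta>)))"
      by (intro sum.cong) (simp_all add: LR)
    \<comment> \<open>The sets are disjoint because b and \<nu> determine \<delta>.\<close>
    also have "\<dots> = int (card (\<Union>\<delta>\<in>?\<Delta>. ?X \<delta>))"
      unfolding of_nat_sum [symmetric]
      by (subst card_UN_disjoint) (use fin\<Delta> finX in auto)
    also have "(\<Union>\<delta>\<in>?\<Delta>. ?X \<delta>) = (\<Union>\<delta>\<in>P11. ?X \<delta>)"
    proof -
      have "?X \<delta> = {}" if "\<delta> \<in> P11" "LR lam \<delta> \<nu> = 0" for \<delta>
        using LR [OF that(1)] that(2) finX [OF that(1)] by simp
      then show ?thesis by blast
    qed
    also have "\<dots> = {b \<in> SSYT lam. \<exists>\<delta>\<in>P11. b \<in> lattice_tableaux lam \<delta> \<and> \<delta> + content lam b = \<nu>}"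
      by (auto simp: lattice_tableaux_def)
    also have "\<dots> = {b \<in> SSYT lam. \<exists>\<mu>\<in>partitions. distinguished lam \<mu> b \<and> phi lam b + \<mu> = \<nu>}"
      using LR_condition_iff [OF lam _ \<nu>] by blast
    finally show ?thesis
      using True by simp
  qed
qed

text \<open>The only \<nu> in \<open>P2\<close> that can contribute to the coefficient at
  \<alpha>.\<close>

definition double_coords :: "(nat \<Rightarrow>\<^sub>0 nat) \<Rightarrow> (nat \<Rightarrow>\<^sub>0 nat)" where
  "double_coords \<alpha> = of_coords (\<alpha> + \<alpha>)"

lemma double_coords_coords: "1 \<le> j \<Longrightarrow> lookup (omega_coords (double_coords \<alpha>)) j = 2 * lookup \<alpha> j"
  by (simp add: double_coords_def omega_coords_of_coords lookup_add)

lemma double_coords_in_P2: "double_coords \<alpha> \<in> P2"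
  unfolding P2_iff using of_coords_in_partitions by (auto simp: double_coords_coords) (simp add: double_coords_def)

lemma half_coords_eq_iff:
  assumes \<nu>: "\<nu> \<in> P2"
  shows "omega_coords (half \<nu>) = \<alpha> \<longleftrightarrow> lookup \<alpha> 0 = 0 \<and> \<nu> = double_coords \<alpha>"
proof
  assume eq: "omega_coords (half \<nu>) = \<alpha>"
  have "\<nu> = double_coords \<alpha>"
    using \<nu> double_coords_in_P2 [of \<alpha>] half_coords [OF \<nu>]
    by (intro partitions_eqI) (simp_all add: P2_iff double_coords_coords flip: eq)
  then show "lookup \<alpha> 0 = 0 \<and> \<nu> = double_coords \<alpha>"
    using \<nu> half_coords_0 [of \<nu>] eq by (auto simp: P2_iff)
next
  assume \<alpha>: "lookup \<alpha> 0 = 0 \<and> \<nu> = double_coords \<alpha>"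
  show "omega_coords (half \<nu>) = \<alpha>"
  proof (rule poly_mapping_eqI)
    fix j
    show "lookup (omega_coords (half \<nu>)) j = lookup \<alpha> j"
      using \<alpha> half_coords [OF \<nu>, of j] half_coords_0 [of \<nu>] \<nu>
      by (cases "j = 0") (simp_all add: double_coords_coords P2_iff)
  qed
qed

lemma mcoeff_LR_sum:
  assumes lam: "lam \<in> partitions"
  shows "mcoeff (formal_sum P2 (\<lambda>\<nu>. formal_sum P11 (\<lambda>\<delta>. t_pow (half \<nu>) * of_int (LR lam \<delta> \<nu>)))) \<alpha> =
    (if lookup \<alpha> 0 = 0
     then int (card {b \<in> SSYT lam. \<exists>\<mu>\<in>partitions. distinguished lam \<mu> b \<and> phi lam b + \<mu> = double_coords \<alpha>}) else 0)"
    (is "_ = ?rhs")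
proof -
  let ?F = "\<lambda>\<nu>. formal_sum P11 (\<lambda>\<delta>. t_pow (half \<nu>) * of_int (LR lam \<delta> \<nu>))"
  have F: "mcoeff (?F \<nu>) \<alpha> = (if \<nu> = double_coords \<alpha> then ?rhs else 0)" if "\<nu> \<in> P2" for \<nu>
    by (simp add: mcoeff_inner_sum [OF lam that] half_coords_eq_iff [OF that])
  have "mcoeff (formal_sum P2 ?F) \<alpha> = (\<Sum>\<nu>\<in>{\<nu>. \<nu> \<in> P2 \<and> mcoeff (?F \<nu>) \<alpha> \<noteq> 0}. mcoeff (?F \<nu>) \<alpha>)"
    by (rule mcoeff_formal_sum)
  also have "\<dots> = (\<Sum>\<nu>\<in>{double_coords \<alpha>}. mcoeff (?F \<nu>) \<alpha>)"
  proof (rule sum.mono_neutral_left)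
    show "{\<nu>. \<nu> \<in> P2 \<and> mcoeff (?F \<nu>) \<alpha> \<noteq> 0} \<subseteq> {double_coords \<alpha>}"
      using F by (metis (mono_tags, lifting) mem_Collect_eq singletonI subsetI)
  qed (use double_coords_in_P2 in auto)
  also have "\<dots> = ?rhs"
    by (simp only: sum.insert sum.empty finite.emptyI empty_iff F [OF double_coords_in_P2] simp_thms if_True not_False_eq_True add_0_right)
  finally show ?thesis .
qed

text \<open>The factorization of the series on index sets: \<mu> = \<mu>_b + \<rho> with \<rho> in
  \<open>Pbox\<close> corresponds to the exponent \<rho> / 2, supported on even indices.\<close>

lemma distinguished_double_coords_iff:
  assumes lam: "lam \<in> partitions" and b: "b \<in> SSYT lam" and \<gamma>: "lookup \<gamma> 0 = 0"
  shows "(\<exists>\<mu>\<in>partitions. distinguished lam \<mu> b \<and> phi lam b + \<mu> = double_coords \<gamma>) \<longleftrightarrow>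
    b \<in> D lam \<and> (\<exists>\<alpha>\<in>even_tail 0. \<alpha> + omega_coords (half (phi lam b + mu_min lam b)) = \<gamma>)"
proof -
  let ?m = "mu0 lam b"
  let ?c = "omega_coords (half (phi lam b + ?m))"
  note [simp] = partitions_add omega_coords_add phi_in_partitions [OF lam b] mu0_in_partitions [OF lam b]
    phi_coords [OF lam b]
  have c: "2 * lookup ?c j = phi_i lam b j + lookup (omega_coords ?m) j"
    if "distinguished lam ?m b" "1 \<le> j" for j
  proof -
    have "phi lam b + ?m \<in> P2"
      using that by (auto simp: distinguished_def)
    then show ?thesis
      using half_coords that(2) by simp
  qed
  have c0: "lookup ?c 0 = 0"
    by (rule half_coords_0) simp
  show ?thesis
  proof
    assume "\<exists>\<mu>\<in>partitions. distinguished lam \<mu> b \<and> phi lam b + \<mu> = double_coords \<gamma>"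
    then obtain \<mu> where \<mu>: "\<mu> \<in> partitions" "distinguished lam \<mu> b" "phi lam b + \<mu> = double_coords \<gamma>"
      by blast
    then have bD: "b \<in> D lam"
      using b by (auto simp: D_def)
    note dist0 = distinguished_mu0 [OF lam b \<mu>(1,2)]
    then obtain \<rho> where \<rho>: "\<rho> \<in> Pbox" "\<mu> = ?m + \<rho>"
      by (auto simp: le_box_def)
    have \<rho>part: "\<rho> \<in> partitions"
      using \<rho>(1) by (simp add: Pbox_def P2_iff)
    have coords: "2 * lookup \<gamma> j = 2 * lookup ?c j + lookup (omega_coords \<rho>) j" if "1 \<le> j" for j
      using c [OF dist0(1) that] arg_cong [OF \<mu>(3), of "\<lambda>x. lookup (omega_coords x) j"] that \<rho>part
      by (simp add: \<rho>(2) double_coords_coords)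
    \<comment> \<open>In \<omega>-coordinates this is \<rho> / 2.\<close>
    define \<alpha> where "\<alpha> = \<gamma> - ?c"
    have "\<alpha> + ?c = \<gamma>"
    proof (rule poly_mapping_eqI)
      fix j
      show "lookup (\<alpha> + ?c) j = lookup \<gamma> j"
        using coords [of j] \<gamma> c0 by (cases "j = 0") (simp_all add: \<alpha>_def lookup_add lookup_minus)
    qed
    moreover have "\<alpha> \<in> even_tail 0"
    proof -
      have "even j \<and> 2 * 0 < j" if "j \<in> keys \<alpha>" for j
      proof -
        have nz: "lookup \<gamma> j - lookup ?c j \<noteq> 0"
          using that by (simp add: \<alpha>_def in_keys_iff lookup_minus)
        then have j: "1 \<le> j"
          using \<gamma> by (cases "j = 0") simp_all
        moreover have "even j"
        proof (rule ccontr)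
          assume "odd j"
          then have "lookup (omega_coords \<rho>) j = 0"
            using \<rho>(1) j by (simp add: Pbox_def P11_iff)
          then show False
            using coords [OF j] nz by simp
        qed
        ultimately show ?thesis by simp
      qed
      then show ?thesis
        by (simp add: even_tail_def)
    qed
    ultimately show "b \<in> D lam \<and> (\<exists>\<alpha>\<in>even_tail 0. \<alpha> + omega_coords (half (phi lam b + mu_min lam b)) = \<gamma>)"
      using bD mu_min_eq_mu0 [OF lam b bD] by auto
  next
    assume *: "b \<in> D lam \<and> (\<exists>\<alpha>\<in>even_tail 0. \<alpha> + omega_coords (half (phi lam b + mu_min lam b)) = \<gamma>)"
    then have bD: "b \<in> D lam" ..
    then obtain \<mu>' where "\<mu>' \<in> partitions" "distinguished lam \<mu>' b"
      by (auto simp: D_def)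
    then have dist: "distinguished lam ?m b"
      by (rule distinguished_mu0 [OF lam b])
    obtain \<alpha> where \<alpha>: "\<alpha> \<in> even_tail 0" "\<alpha> + ?c = \<gamma>"
      using * mu_min_eq_mu0 [OF lam b bD] by auto
    \<comment> \<open>Reverses the halving: \<alpha> doubled is the element of \<open>Pbox\<close>
      to be added.\<close>
    define \<mu> where "\<mu> = ?m + double_coords \<alpha>"
    have dbl: "double_coords \<alpha> \<in> partitions"
      by (simp add: double_coords_def of_coords_in_partitions)
    then have \<mu>: "\<mu> \<in> partitions"
      by (simp add: \<mu>_def)
    have \<mu>_coords: "lookup (omega_coords \<mu>) j = lookup (omega_coords ?m) j + 2 * lookup \<alpha> j" if "1 \<le> j" for j
      using that dbl by (simp add: \<mu>_def double_coords_coords)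
    have odd0: "lookup \<alpha> j = 0" if "odd j" for j
      using \<alpha>(1) that by (auto simp: even_tail_def in_keys_iff)
    have "distinguished lam \<mu> b"
      using dist odd0
      by (simp add: distinguished_iff [OF lam b \<mu>] distinguished_iff [OF lam b mu0_in_partitions [OF lam b]] \<mu>_coords)
    moreover have "phi lam b + \<mu> = double_coords \<gamma>"
    proof (rule partitions_eqI)
      fix j :: nat assume j: "1 \<le> j"
      have "lookup \<gamma> j = lookup \<alpha> j + lookup ?c j"
        by (simp add: lookup_add flip: \<alpha>(2))
      then show "lookup (omega_coords (phi lam b + \<mu>)) j = lookup (omega_coords (double_coords \<gamma>)) j"
        using c [OF dist j] j \<mu> by (simp add: \<mu>_coords double_coords_coords)
    qed (simp_all add: \<mu> double_coords_def of_coords_in_partitions)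
    ultimately show "\<exists>\<mu>\<in>partitions. distinguished lam \<mu> b \<and> phi lam b + \<mu> = double_coords \<gamma>"
      using \<mu> by blast
  qed
qed

theorem theorem4p8:
  fixes lam :: "nat \<Rightarrow>\<^sub>0 nat"
  assumes "lam \<in> partitions"
  shows "K_C_inf lam = formal_sum (D lam) (\<lambda>b. t_pow (half (phi lam b + mu_min lam b)))"
proof -
  let ?S = "formal_sum P2 (\<lambda>\<nu>. formal_sum P11 (\<lambda>\<delta>. t_pow (half \<nu>) * of_int (LR lam \<delta> \<nu>)))"
  let ?c = "\<lambda>b. omega_coords (half (phi lam b + mu_min lam b))"
  let ?R = "formal_sum (D lam) (\<lambda>b. t_pow (half (phi lam b + mu_min lam b)))"
  have R: "mcoeff ?R \<beta> = int (card {b \<in> D lam. ?c b = \<beta>})" for \<beta>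
    unfolding t_pow_def by (rule mcoeff_formal_sum_monomial)
  have c0: "lookup (?c b) 0 = 0" if b: "b \<in> D lam" for b
  proof -
    have B: "b \<in> SSYT lam"
      using b by (simp add: D_def)
    have "phi lam b + mu_min lam b \<in> partitions"
      unfolding mu_min_eq_mu0 [OF assms B b]
      by (intro partitions_add phi_in_partitions mu0_in_partitions assms B)
    then show ?thesis
      by (rule half_coords_0)
  qed
  \<comment> \<open>Both coefficients at \<gamma> count the same tableaux; on the right each b
    occurs at most once, since b and \<gamma> determine the monomial taken from
    \<open>geometric 0\<close>.\<close>
  have "?S = geometric 0 * ?R"
  proof (rule mseries_eqI)
    fix \<gamma> :: "nat \<Rightarrow>\<^sub>0 nat"
    let ?E = "{x. x \<in> splits \<gamma> \<and> fst x \<in> even_tail 0}"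
    let ?B = "\<lambda>\<beta>. {b \<in> D lam. ?c b = \<beta>}"
    let ?T = "{b \<in> D lam. \<exists>\<alpha>\<in>even_tail 0. \<alpha> + ?c b = \<gamma>}"
    let ?A = "{b \<in> SSYT lam. \<exists>\<mu>\<in>partitions. distinguished lam \<mu> b \<and> phi lam b + \<mu> = double_coords \<gamma>}"
    have DS: "b \<in> SSYT lam" if "b \<in> D lam" for b
      using that by (simp add: D_def)
    have T: "?T = (if lookup \<gamma> 0 = 0 then ?A else {})"
    proof (cases "lookup \<gamma> 0 = 0")
      case True
      then show ?thesis
        using distinguished_double_coords_iff [OF assms _ True] DS by auto
    next
      case False
      have "?T = {}"
      proof (rule ccontr)
        assume "?T \<noteq> {}"
        then obtain b \<alpha> where "b \<in> D lam" "\<alpha> \<in> even_tail 0" "\<alpha> + ?c b = \<gamma>"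
          by blast
        then have "lookup \<gamma> 0 = lookup \<alpha> 0" "0 \<notin> keys \<alpha>"
          using c0 by (auto simp: lookup_add even_tail_def)
        with False show False
          by (simp add: in_keys_iff)
      qed
      with False show ?thesis by simp
    qed
    \<comment> \<open>Finiteness matters because \<open>card\<close> of an infinite set is 0. The
      content of b is a summand of \<open>double_coords \<gamma>\<close>, which leaves finitely many
      b.\<close>
    have finT: "finite ?T"
    proof -
      have "?A \<subseteq> {b \<in> SSYT lam. \<exists>\<rho>. content lam b + \<rho> = double_coords \<gamma>}"
      proof clarify
        fix b \<mu> assume "b \<in> SSYT lam" "phi lam b + \<mu> = double_coords \<gamma>"
        then have "content lam b + (eps lam b + \<mu>) = double_coords \<gamma>"
          by (simp add: phi_eq_eps_add_content [OF assms] add_ac)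
        then show "\<exists>\<rho>. content lam b + \<rho> = double_coords \<gamma>" ..
      qed
      then have "finite ?A"
        by (rule finite_subset) (rule finite_content_le [OF assms])
      then show ?thesis
        unfolding T by simp
    qed
    have "mcoeff (geometric 0 * ?R) \<gamma> = (\<Sum>(\<alpha>, \<beta>)\<in>splits \<gamma>. if \<alpha> \<in> even_tail 0 then int (card (?B \<beta>)) else 0)"
      unfolding mcoeff_mult R by (intro sum.cong) (auto simp: geometric_def)
    also have "\<dots> = (\<Sum>x\<in>?E. int (card (?B (snd x))))"
      by (rule sum_splits_if)
    also have "\<dots> = (\<Sum>\<beta>\<in>snd ` ?E. int (card (?B \<beta>)))"
      by (subst sum.reindex) (auto simp: inj_on_def split_beta)
    also have "\<dots> = int (card (\<Union>\<beta>\<in>snd ` ?E. ?B \<beta>))"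
    proof -
      have "finite (snd ` ?E)"
        by (rule finite_imageI, rule finite_subset [OF _ finite_splits [of \<gamma>]]) auto
      moreover have "finite (?B \<beta>)" if "\<beta> \<in> snd ` ?E" for \<beta>
        by (rule finite_subset [OF _ finT]) (use that in auto)
      ultimately show ?thesis
        unfolding of_nat_sum [symmetric] by (subst card_UN_disjoint) auto
    qed
    also have "(\<Union>\<beta>\<in>snd ` ?E. ?B \<beta>) = ?T"
      by force
    finally show "mcoeff ?S \<gamma> = mcoeff (geometric 0 * ?R) \<gamma>"
      unfolding mcoeff_LR_sum [OF assms] T by simp
  qed
  then have "K_C_inf lam = (formal_prod (\<lambda>i. 1 - tvar (2 * i)) * geometric 0) * ?R"
    by (simp add: K_C_inf_def mult.assoc)
  then show ?thesis
    by (simp add: formal_prod_mult_geometric)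
qed

end
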